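(* Let $n \geq 2$. For any function $f: S^{n-1} \to \mathbb{R}$ with $\|f\|_{\mathrm{Lip}} \leq 1$ and $\sigma_{n-1}$-mean $m = \int_{S^{n-1}} f\,d\sigma_{n-1}$, $$ \sigma_{n-1}\big\{|f-m| \geq r\big\} \leq \frac{1}{r}\,e^{-(n-2)\, r^2/2}\, \int_{S^{n-1}} |f-m|\,d\sigma_{n-1}, \quad r > 0. $$
   Context: $S^{n-1}$ is the Euclidean unit sphere in $\mathbb{R}^n$ and $\sigma_{n-1}$ the uniform probability measure on it. $\|f\|_{\mathrm{Lip}}$ denotes the Lipschitz semi-norm of $f$ on the sphere, taken with respect to the geodesic distance (for $C^1$-smooth $f$ the condition $\|f\|_{\mathrm{Lip}} \leq 1$ means that the spherical gradient satisfies $|\nabla_S f| \leq 1$ everywhere; any function that is 1-Lipschitz for the Euclidean distance also satisfies this condition). *)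

theory Defs
  imports "HOL-Probability.Probability"
begin

text \<open>
  The uniform probability measure on the unit sphere, constructed as the normalised cone measure:
  the law of \<open>x / |x|\<close> for \<open>x\<close> uniformly distributed in the unit ball. The value at \<open>x = 0\<close> is
  irrelevant (null set). The measure lives on the sphere itself: its space is \<open>sphere 0 1\<close> and its
  \<open>\<sigma>\<close>-algebra consists of the Borel subsets of the sphere. The lemmas below confirm that it is a
  probability measure invariant under all orthogonal transformations, which determines it uniquely.
\<close>

definition sphere_measure :: "(real ^ 'n) measure" where
  "sphere_measure =
     restrict_space
       (distr (uniform_measure lborel (ball 0 1)) borel (\<lambda>x. x /\<^sub>R norm x))
       (sphere 0 1)"

text \<open>On the unit sphere the great-circle distance is the angle between the two points.\<close>

definition geodesic_dist :: "real ^ 'n \<Rightarrow> real ^ 'n \<Rightarrow> real" where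
  "geodesic_dist x y = arccos (x \<bullet> y)"

text \<open>The supremum is taken in \<^typ>\<open>ennreal\<close>, so it is \<open>\<infinity>\<close> if \<open>f\<close> is not Lipschitz.\<close>

definition sphere_Lip :: "(real ^ 'n \<Rightarrow> real) \<Rightarrow> ennreal" where
  "sphere_Lip f =
     (SUP (x, y) \<in> {(x, y). x \<in> sphere 0 1 \<and> y \<in> sphere 0 1 \<and> x \<noteq> y}.
        ennreal (\<bar>f x - f y\<bar> / geodesic_dist x y))"

lemma space_sphere_measure [simp]: "space sphere_measure = sphere 0 1"
  by (simp add: sphere_measure_def space_restrict_space)

lemma sets_sphere_measure [simp]:
  "sets sphere_measure = sets (restrict_space borel (sphere 0 1))"
  by (simp add: sphere_measure_def sets_restrict_space)

lemma emeasure_unit_ball_pos_finite: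
  "emeasure lborel (ball (0 :: real ^ 'n) 1) \<noteq> 0"
  "emeasure lborel (ball (0 :: real ^ 'n) 1) \<noteq> \<infinity>"
proof -
  show fin: "emeasure lborel (ball (0 :: real ^ 'n) 1) \<noteq> \<infinity>"
    using emeasure_lborel_ball_finite[of "0 :: real ^ 'n" 1] by simp
  show "emeasure lborel (ball (0 :: real ^ 'n) 1) \<noteq> 0"
    using content_ball_pos[of 1 "0 :: real ^ 'n"] by (auto simp: measure_def)
qed

lemma emeasure_sphere_measure:
  assumes "A \<in> sets borel" "A \<subseteq> sphere (0 :: real ^ 'n) 1"
  shows "emeasure sphere_measure A =
    emeasure lborel {x \<in> ball (0 :: real ^ 'n) 1. x /\<^sub>R norm x \<in> A} / emeasure lborel (ball (0 :: real ^ 'n) 1)"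
proof -
  have m: "(\<lambda>x :: real ^ 'n. x /\<^sub>R norm x) \<in> borel \<rightarrow>\<^sub>M borel"
    by measurable
  have m': "(\<lambda>x :: real ^ 'n. x /\<^sub>R norm x) -` A \<in> sets borel"
    using measurable_sets[OF m assms(1)] by simp
  have "emeasure sphere_measure A =
      emeasure (distr (uniform_measure lborel (ball 0 1)) borel (\<lambda>x :: real ^ 'n. x /\<^sub>R norm x)) A"
    unfolding sphere_measure_def by (rule emeasure_restrict_space) (use assms in auto)
  also have "\<dots> = emeasure (uniform_measure lborel (ball 0 1)) ((\<lambda>x :: real ^ 'n. x /\<^sub>R norm x) -` A)"
    by (subst emeasure_distr) (use m assms in auto)
  also have "\<dots> = emeasure lborel (ball 0 1 \<inter> (\<lambda>x :: real ^ 'n. x /\<^sub>R norm x) -` A)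
      / emeasure lborel (ball (0 :: real ^ 'n) 1)"
    by (rule emeasure_uniform_measure) (use m' in auto)
  also have "ball 0 1 \<inter> (\<lambda>x :: real ^ 'n. x /\<^sub>R norm x) -` A = {x \<in> ball 0 1. x /\<^sub>R norm x \<in> A}"
    by auto
  finally show ?thesis .
qed

lemma prob_space_sphere_measure: "prob_space (sphere_measure :: (real ^ 'n) measure)"
proof
  have *: "{x \<in> ball (0 :: real ^ 'n) 1. x /\<^sub>R norm x \<in> sphere 0 1} = ball 0 1 - {0}"
    by auto
  have **: "emeasure lborel (ball (0 :: real ^ 'n) 1 - {0}) = emeasure lborel (ball (0 :: real ^ 'n) 1)"
    by (rule emeasure_Diff_null_set) auto
  show "emeasure (sphere_measure :: (real ^ 'n) measure) (space sphere_measure) = 1"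
    unfolding space_sphere_measure
    by (subst emeasure_sphere_measure, simp, simp, subst *, subst **)
       (use emeasure_unit_ball_pos_finite[where 'n = 'n] in \<open>auto intro!: ennreal_divide_self simp: less_top\<close>)
qed

text \<open>The \<^class>\<open>wellorder\<close> constraint is inherited from \<open>measure_orthogonal_image\<close> and affects
  only this lemma.\<close>

lemma sphere_measure_orthogonal_invariant:
  fixes T :: "real ^ 'n :: {finite, wellorder} \<Rightarrow> real ^ 'n :: {finite, wellorder}"
  assumes T: "orthogonal_transformation T" and A: "A \<in> sets sphere_measure"
  shows "emeasure sphere_measure (T ` A) = emeasure sphere_measure A"
proof -
  have A': "A \<in> sets borel" "A \<subseteq> sphere 0 1"
    using A by (auto simp: sets_restrict_space)
  have lin: "linear T" and nrm: "\<And>x. norm (T x) = norm x"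
    using T by (auto simp: orthogonal_transformation_def orthogonal_transformation_norm[OF T])
  have bij: "bij T" and inj: "inj T"
    using T orthogonal_transformation_bij bij_is_inj by blast+
  have invT: "orthogonal_transformation (inv T)"
    using T by (rule orthogonal_transformation_inv)
  have "T ` A = inv T -` A"
    using bij by (simp add: bij_vimage_eq_inv_image bij_imp_bij_inv inv_inv_eq)
  moreover have "inv T \<in> borel \<rightarrow>\<^sub>M borel"
    by (intro borel_measurable_continuous_onI linear_continuous_on)
       (use invT in \<open>auto simp: orthogonal_transformation_def linear_conv_bounded_linear\<close>)
  ultimately have TA: "T ` A \<in> sets borel"
    using A'(1) measurable_sets by (metis Int_UNIV_right space_borel)
  have TA': "T ` A \<subseteq> sphere 0 1"
    using A'(2) nrm by auto
  let ?C = "\<lambda>A. {x \<in> ball (0 :: real ^ 'n :: {finite, wellorder}) 1. x /\<^sub>R norm x \<in> A}"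
  have meas: "?C B \<in> sets borel" if "B \<in> sets borel" for B
    using that by measurable
  have fin: "?C B \<in> lmeasurable" if "B \<in> sets borel" for B
  proof (rule bounded_set_imp_lmeasurable)
    show "bounded (?C B)" by (rule bounded_subset[OF bounded_ball[of 0 1]]) auto
    show "?C B \<in> sets lebesgue" using meas[OF that] by auto
  qed
  have im: "?C (T ` A) = T ` ?C A"
  proof (intro set_eqI iffI)
    fix y assume y: "y \<in> ?C (T ` A)"
    obtain x where x: "y = T x" using bij by (metis bij_pointE)
    have "y /\<^sub>R norm y = T (x /\<^sub>R norm x)" using lin by (simp add: x nrm linear_cmul)
    then have "x /\<^sub>R norm x \<in> A" using y inj by (simp add: inj_image_mem_iff)
    then show "y \<in> T ` ?C A" using y x by (auto simp: nrm)
  next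
    fix y assume "y \<in> T ` ?C A"
    then show "y \<in> ?C (T ` A)" using lin by (auto simp: nrm linear_cmul[symmetric])
  qed
  have em: "emeasure lborel (?C B) = ennreal (measure lebesgue (?C B))" if "B \<in> sets borel" for B
    using emeasure_eq_measure2[OF fin[OF that]] emeasure_completion[of "?C B" lborel] meas[OF that]
    by simp
  have "emeasure lborel (?C (T ` A)) = emeasure lborel (?C A)"
    by (simp only: im em[OF TA, unfolded im] em[OF A'(1)] measure_orthogonal_image[OF T fin[OF A'(1)]])
  then show ?thesis
    by (simp only: emeasure_sphere_measure[OF TA TA'] emeasure_sphere_measure[OF A'])
qed

end

theory Submission
  imports Defs
begin

text \<open>
  The dimension \<open>n\<close> enters only through one number: a standard Gaussian vector \<open>X\<close> in \<open>\<real>\<^sup>n\<close> satisfies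
  \<open>E |X|\<^sup>-\<^sup>2 = 1 / (n - 2)\<close> for \<open>n \<ge> 3\<close>. A function \<open>f\<close> on the sphere is extended to a
  \<open>0\<close>-homogeneous function \<open>F x = f (x / |x|)\<close>. The direction \<open>X / |X|\<close> is uniformly distributed,
  so spherical means of \<open>f\<close> are Gaussian means of \<open>F\<close>; and if \<open>f\<close> is \<open>1\<close>-Lipschitz for the geodesic
  distance, then \<open>|\<nabla>F(x)| \<le> 1 / |x|\<close>.

  Let \<open>Y\<close> be an independent copy of \<open>X\<close>, put \<open>X\<^sub>s = cos s X + sin s Y\<close>, and let \<open>H\<close> be nondecreasing.
  Differentiating \<open>s \<mapsto> E F(X) H(F(X\<^sub>s))\<close> and integrating by parts in the variable
  \<open>X\<^sub>s' = - sin s X + cos s Y\<close>, which is independent of \<open>X\<^sub>s\<close>, bounds the covariance of \<open>F\<close> and \<open>H(F)\<close>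
  by the integral over \<open>s \<in> [0, \<pi>/2]\<close> of \<open>sin s \<cdot> E [H'(F(X\<^sub>s)) / (|X| |X\<^sub>s|)]\<close>. Conditionally on \<open>X\<^sub>s\<close>
  the mean of \<open>1 / |X|\<close> depends on \<open>|X\<^sub>s|\<close> only, whereas \<open>F(X\<^sub>s)\<close> depends on the direction only;
  directions and norms are independent and \<open>2 / (|X| |X\<^sub>s|) \<le> |X|\<^sup>-\<^sup>2 + |X\<^sub>s|\<^sup>-\<^sup>2\<close>, so the expectation is
  at most \<open>E H'(F) / (n - 2)\<close>. Hence, with \<open>\<kappa> = n - 2\<close>,
  \<open>E (F - m) H(F - m) \<le> E H'(F - m) / \<kappa>\<close>
  (\<open>gaussian_covariance_inequality\<close>). The factor that is differentiated is obtained there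
  by mollifying \<open>F\<close> on the sphere. Mollification with a rotation invariant kernel keeps the
  Lipschitz constant, since any point of the sphere is carried to any other one by a rotation that
  turns no vector by a larger angle (\<open>angle_lipschitz_smooth_approximation\<close>).

  The deviation bound is this inequality for one particular \<open>H\<close>, whose right derivative
  serves as \<open>H'\<close>. If
  \<open>c = exp (- \<kappa> r\<^sup>2 / 2)\<close>, the function equal to \<open>0\<close> on the negative axis, to \<open>c (exp (\<kappa> x\<^sup>2 / 2) - 1)\<close> on
  \<open>[0, r]\<close> and to \<open>1 - c\<close> beyond \<open>r\<close> satisfies
  \<open>x H(x) - H'(x) / \<kappa> = x 1{x \<ge> r} - c max 0 x\<close>, so that
  \<open>E (F - m) 1{F - m \<ge> r} \<le> c E (F - m)\<^sup>+\<close> (\<open>gaussian_upper_truncated_mean\<close>). Adding the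
  same estimate for \<open>- F\<close> gives \<open>E |F - m| 1{|F - m| \<ge> r} \<le> c E |F - m|\<close>, and the left-hand side is at least
  \<open>r\<close> times the measure of \<open>{|F - m| \<ge> r}\<close>. For \<open>n = 2\<close> one has \<open>c = 1\<close> and the claim is Markov's inequality.
\<close>

section \<open>Lebesgue measure: orthogonal invariance and polar coordinates\<close>

lemma nn_integral_lborel_translate:
  fixes f :: "'a::euclidean_space \<Rightarrow> ennreal"
  assumes [measurable]: "f \<in> borel_measurable borel"
  shows "(\<integral>\<^sup>+x. f (x + a) \<partial>lborel) = (\<integral>\<^sup>+x. f x \<partial>lborel)"
proof -
  have "(\<integral>\<^sup>+x. f x \<partial>lborel) = (\<integral>\<^sup>+x. f x \<partial>distr lborel borel ((+) a))"
    by (simp add: lborel_distr_plus)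
  also have "\<dots> = (\<integral>\<^sup>+x. f (a + x) \<partial>lborel)"
    by (subst nn_integral_distr) auto
  finally show ?thesis by (simp add: add.commute)
qed

lemma orthogonal_transformation_measurable:
  fixes T :: "'a::euclidean_space \<Rightarrow> 'a"
  assumes "orthogonal_transformation T"
  shows "T \<in> borel \<rightarrow>\<^sub>M borel"
  using assms unfolding orthogonal_transformation_def
  by (intro borel_measurable_continuous_onI linear_continuous_on)
     (simp add: linear_conv_bounded_linear)

text \<open>
  The push-forward of Lebesgue measure under \<open>T\<close> is again translation invariant, so Fubini's theorem
  forces it to be a multiple of Lebesgue measure; evaluating both on the unit ball, which \<open>T\<close>
  preserves, shows that the factor is \<open>1\<close>. This argument works in every Euclidean space, in particular
  in \<^typ>\<open>'a::euclidean_space \<times> 'a\<close>.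
\<close>

lemma nn_integral_lborel_orthogonal:
  fixes f :: "'a::euclidean_space \<Rightarrow> ennreal" and T :: "'a \<Rightarrow> 'a"
  assumes T: "orthogonal_transformation T" and f[measurable]: "f \<in> borel_measurable borel"
  shows "(\<integral>\<^sup>+x. f (T x) \<partial>lborel) = (\<integral>\<^sup>+x. f x \<partial>lborel)"
proof -
  note [measurable] = orthogonal_transformation_measurable[OF T]
  have lin: "linear T" using T by (simp add: orthogonal_transformation_def)
  have nrm: "norm (T x) = norm x" for x using orthogonal_transformation_norm[OF T] .
  have surj: "\<exists>z. T z = x" for x using orthogonal_transformation_surj[OF T] by (metis surjD)
  define g :: "'a \<Rightarrow> ennreal" where "g = indicator (ball 0 1)"
  have [measurable]: "g \<in> borel_measurable borel" unfolding g_def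
    by (rule borel_measurable_indicator) simp
  define V where "V = (\<integral>\<^sup>+x. g x \<partial>(lborel :: 'a measure))"
  have V: "V = emeasure lborel (ball (0::'a) 1)" unfolding V_def g_def by simp
  have V0: "V \<noteq> 0" unfolding V using content_ball_pos[of 1 "0::'a"] by (auto simp: measure_def)
  have Vfin: "V \<noteq> \<infinity>" unfolding V using emeasure_lborel_ball_finite[of "0 :: 'a" 1] by simp
  have tr: "(\<integral>\<^sup>+y. f (T y + x) \<partial>lborel) = (\<integral>\<^sup>+y. f (T y) \<partial>lborel)" for x
  proof -
    obtain z where z: "T z = x" using surj by blast
    have "(\<integral>\<^sup>+y. f (T y + x) \<partial>lborel) = (\<integral>\<^sup>+y. f (T (y + z)) \<partial>lborel)"
      using lin by (simp add: linear_add z)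
    also have "\<dots> = (\<integral>\<^sup>+y. f (T y) \<partial>lborel)"
      by (rule nn_integral_lborel_translate[of "\<lambda>y. f (T y)"]) measurable
    finally show ?thesis .
  qed
  have gT: "(\<integral>\<^sup>+y. g (x - T y) \<partial>lborel) = V" for x
  proof -
    obtain z where z: "T z = x" using surj by blast
    have "g (x - T y) = g (y + (- z))" for y
    proof -
      have "x - T y = T (z - y)" using lin by (simp add: linear_diff z)
      then have "norm (x - T y) = norm (z - y)" by (simp add: nrm)
      then show ?thesis by (simp add: g_def indicator_def norm_minus_commute)
    qed
    then show ?thesis unfolding V_def
      using nn_integral_lborel_translate[of g "-z"] by simp
  qed
  have "V * (\<integral>\<^sup>+y. f (T y) \<partial>lborel) = (\<integral>\<^sup>+x. g x * (\<integral>\<^sup>+y. f (T y) \<partial>lborel) \<partial>lborel)"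
    unfolding V_def by (rule nn_integral_multc[symmetric]) measurable
  also have "\<dots> = (\<integral>\<^sup>+x. (\<integral>\<^sup>+y. g x * f (T y + x) \<partial>lborel) \<partial>lborel)"
    by (rule nn_integral_cong) (subst nn_integral_cmult, measurable, simp add: tr)
  also have "\<dots> = (\<integral>\<^sup>+y. (\<integral>\<^sup>+x. g x * f (T y + x) \<partial>lborel) \<partial>lborel)"
    by (rule lborel_pair.Fubini') measurable
  also have "\<dots> = (\<integral>\<^sup>+y. (\<integral>\<^sup>+x. g (x - T y) * f x \<partial>lborel) \<partial>lborel)"
  proof (rule nn_integral_cong)
    fix y
    show "(\<integral>\<^sup>+x. g x * f (T y + x) \<partial>lborel) = (\<integral>\<^sup>+x. g (x - T y) * f x \<partial>lborel)"
      using nn_integral_lborel_translate[of "\<lambda>x. g (x - T y) * f x" "T y"]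
      by (simp add: add.commute)
  qed
  also have "\<dots> = (\<integral>\<^sup>+x. (\<integral>\<^sup>+y. g (x - T y) * f x \<partial>lborel) \<partial>lborel)"
    by (rule lborel_pair.Fubini') measurable
  also have "\<dots> = (\<integral>\<^sup>+x. V * f x \<partial>lborel)"
    by (rule nn_integral_cong) (subst nn_integral_multc, measurable, simp add: gT)
  also have "\<dots> = V * (\<integral>\<^sup>+x. f x \<partial>lborel)"
    by (rule nn_integral_cmult) measurable
  finally show ?thesis using V0 Vfin by (simp add: ennreal_mult_cancel_left)
qed

lemma nn_integral_lborel_scale:
  fixes f :: "'a::euclidean_space \<Rightarrow> ennreal"
  assumes [measurable]: "f \<in> borel_measurable borel" and c: "c > 0"
  shows "(\<integral>\<^sup>+x. f x \<partial>lborel) = ennreal (c ^ DIM('a)) * (\<integral>\<^sup>+x. f (c *\<^sub>R x) \<partial>lborel)"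
proof -
  have *: "lborel = density (distr lborel borel (\<lambda>x::'a. 0 + c *\<^sub>R x)) (\<lambda>_. ennreal (\<bar>c\<bar> ^ DIM('a)))"
    using c by (intro lborel_affine) auto
  have "(\<integral>\<^sup>+x. f x \<partial>lborel) = (\<integral>\<^sup>+x. ennreal (\<bar>c\<bar> ^ DIM('a)) * f x \<partial>(distr lborel borel (\<lambda>x::'a. 0 + c *\<^sub>R x)))"
    by (subst *, subst nn_integral_density) auto
  also have "\<dots> = (\<integral>\<^sup>+x. ennreal (\<bar>c\<bar> ^ DIM('a)) * f (c *\<^sub>R x) \<partial>lborel)"
    by (subst nn_integral_distr) auto
  also have "\<dots> = ennreal (c ^ DIM('a)) * (\<integral>\<^sup>+x. f (c *\<^sub>R x) \<partial>lborel)"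
    using c by (subst nn_integral_cmult) auto
  finally show ?thesis .
qed

lemma measurable_sgn_vec [measurable]: "(sgn :: 'a::euclidean_space \<Rightarrow> 'a) \<in> borel \<rightarrow>\<^sub>M borel"
  unfolding sgn_div_norm[abs_def] by measurable

text \<open>
  Polar coordinates without a surface measure: for a \<open>0\<close>-homogeneous \<open>h\<close>, the weights
  \<open>h\<close> and a constant induce proportional laws of the norm. By scaling, these laws agree on all
  intervals below a given radius, and such intervals generate the Borel sets.
\<close>

lemma nn_integral_polar:
  fixes h :: "'a::euclidean_space \<Rightarrow> ennreal" and w :: "real \<Rightarrow> ennreal"
  assumes h[measurable]: "h \<in> borel_measurable borel" and w[measurable]: "w \<in> borel_measurable borel"
    and hom: "\<And>x c. c > 0 \<Longrightarrow> h (c *\<^sub>R x) = h x" and fin: "(\<integral>\<^sup>+x\<in>ball 0 1. h x \<partial>lborel) \<noteq> \<infinity>"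
  shows "(\<integral>\<^sup>+x. h x * w (norm x) \<partial>lborel) * emeasure lborel (ball (0::'a) 1)
     = (\<integral>\<^sup>+x\<in>ball 0 1. h x \<partial>lborel) * (\<integral>\<^sup>+(x::'a). w (norm x) \<partial>lborel)"
proof -
  define V where "V = emeasure lborel (ball (0::'a) 1)"
  have Vfin: "V \<noteq> \<infinity>" unfolding V_def using emeasure_lborel_ball_finite[of "0 :: 'a" 1] by simp
  define I where "I = (\<integral>\<^sup>+x\<in>ball 0 1. h x \<partial>lborel)"
  have Ifin: "I \<noteq> \<infinity>" using fin by (simp add: I_def)
  define M where "M = distr (density lborel (\<lambda>x. V * h x)) borel (norm :: 'a \<Rightarrow> real)"
  define N where "N = distr (density lborel (\<lambda>x::'a. I)) borel (norm :: 'a \<Rightarrow> real)"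
  have eM: "emeasure M A = V * (\<integral>\<^sup>+x. h x * indicator A (norm x) \<partial>lborel)" if [measurable]: "A \<in> sets borel" for A
  proof -
    have [measurable]: "(norm :: 'a \<Rightarrow> real) -` A \<in> sets borel"
      using measurable_sets[of norm borel borel A] by simp
    have "emeasure M A = (\<integral>\<^sup>+x. V * h x * indicator (norm -` A) x \<partial>lborel)"
      unfolding M_def by (subst emeasure_distr) (auto simp: emeasure_density)
    also have "\<dots> = (\<integral>\<^sup>+x. V * (h x * indicator A (norm x)) \<partial>lborel)"
      by (intro nn_integral_cong) (simp add: indicator_def mult.assoc)
    also have "\<dots> = V * (\<integral>\<^sup>+x. h x * indicator A (norm x) \<partial>lborel)"
      by (rule nn_integral_cmult) measurable
    finally show ?thesis .
  qed
  have eN: "emeasure N A = I * (\<integral>\<^sup>+(x::'a). indicator A (norm x) \<partial>lborel)" if [measurable]: "A \<in> sets borel" for A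
  proof -
    have [measurable]: "(norm :: 'a \<Rightarrow> real) -` A \<in> sets borel"
      using measurable_sets[of norm borel borel A] by simp
    have "emeasure N A = (\<integral>\<^sup>+(x::'a). I * indicator (norm -` A) x \<partial>lborel)"
      unfolding N_def by (subst emeasure_distr) (auto simp: emeasure_density)
    also have "\<dots> = (\<integral>\<^sup>+(x::'a). I * (indicator A (norm x)) \<partial>lborel)"
      by (intro nn_integral_cong) (simp add: indicator_def)
    also have "\<dots> = I * (\<integral>\<^sup>+(x::'a). indicator A (norm x) \<partial>lborel)"
      by (rule nn_integral_cmult) measurable
    finally show ?thesis .
  qed
  have ball_eq: "(\<integral>\<^sup>+x. g x * indicator {..<c} (norm x) \<partial>lborel) = ennreal (c ^ DIM('a)) * (\<integral>\<^sup>+x\<in>ball 0 1. g x \<partial>lborel)"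
    if [measurable]: "g \<in> borel_measurable borel" and "\<And>x c. c > 0 \<Longrightarrow> g (c *\<^sub>R x) = g x" "c > 0" for g :: "'a \<Rightarrow> ennreal" and c
  proof -
    have "(\<integral>\<^sup>+x. g x * indicator {..<c} (norm x) \<partial>lborel) = ennreal (c ^ DIM('a)) * (\<integral>\<^sup>+x. g (c *\<^sub>R x) * indicator {..<c} (norm (c *\<^sub>R x)) \<partial>lborel)"
      by (rule nn_integral_lborel_scale) (use that in auto)
    also have "(\<integral>\<^sup>+x. g (c *\<^sub>R x) * indicator {..<c} (norm (c *\<^sub>R x)) \<partial>lborel) = (\<integral>\<^sup>+x\<in>ball 0 1. g x \<partial>lborel)"
      using that by (intro nn_integral_cong) (auto simp: indicator_def)
    finally show ?thesis .
  qed
  have MN: "emeasure M {..<c} = emeasure N {..<c}" and Mfin: "emeasure M {..<c} \<noteq> \<infinity>" for c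
  proof -
    show "emeasure M {..<c} = emeasure N {..<c}"
    proof (cases "c > 0")
      case True
      have "(\<integral>\<^sup>+x\<in>ball (0::'a) 1. 1 \<partial>lborel) = V" by (simp add: V_def)
      then show ?thesis using ball_eq[OF h hom True] ball_eq[of "\<lambda>_. 1" c] True
        by (simp add: eM eN I_def[symmetric] mult_ac)
    next
      case False
      then have "indicator {..<c} (norm x) = (0::ennreal)" for x :: 'a
        by (auto simp: indicator_def) (meson norm_ge_zero not_le order.strict_trans1 order_less_le_trans)
      then show ?thesis by (simp add: eM eN)
    qed
    show "emeasure M {..<c} \<noteq> \<infinity>"
    proof (cases "c > 0")
      case True
      then show ?thesis using ball_eq[OF h hom True] Ifin Vfin 
        by (simp add: eM I_def[symmetric] ennreal_mult_eq_top_iff)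
    next
      case False
      then have "indicator {..<c} (norm x) = (0::ennreal)" for x :: 'a
        by (auto simp: indicator_def) (meson norm_ge_zero not_le order.strict_trans1 order_less_le_trans)
      then show ?thesis by (simp add: eM)
    qed
  qed
  have "M = N"
  proof (rule measure_eqI_generator_eq)
    let ?E = "range (\<lambda>c::real. {..<c})"
    show "Int_stable ?E" unfolding Int_stable_def by (metis (no_types, lifting) greaterThan_Int_greaterThan lessThan_Int_lessThan imageE rangeI)
    show "?E \<subseteq> Pow UNIV" by auto
    show "\<And>X. X \<in> ?E \<Longrightarrow> emeasure M X = emeasure N X" using MN by auto
    show "sets M = sigma_sets UNIV ?E" "sets N = sigma_sets UNIV ?E"
      unfolding M_def N_def by (simp_all add: borel_Iio)
    show "range (\<lambda>i::nat. {..<real i}) \<subseteq> ?E" by auto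
    show "(\<Union>i::nat. {..<real i}) = UNIV" by (auto intro: reals_Archimedean2)
    show "emeasure M {..<real i} \<noteq> \<infinity>" for i :: nat using Mfin by auto
  qed
  then have "(\<integral>\<^sup>+t. w t \<partial>M) = (\<integral>\<^sup>+t. w t \<partial>N)" by simp
  moreover have "(\<integral>\<^sup>+t. w t \<partial>M) = V * (\<integral>\<^sup>+x. h x * w (norm x) \<partial>lborel)"
    unfolding M_def by (simp add: nn_integral_distr nn_integral_density nn_integral_cmult[symmetric] mult.assoc)
  moreover have "(\<integral>\<^sup>+t. w t \<partial>N) = I * (\<integral>\<^sup>+(x::'a). w (norm x) \<partial>lborel)"
    unfolding N_def by (simp add: nn_integral_distr nn_integral_density nn_integral_cmult)
  ultimately show ?thesis by (simp add: V_def I_def mult.commute)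
qed

section \<open>The standard Gaussian measure\<close>

text \<open>
  The normalisation is explicit so that the product of two standard Gaussian measures is literally the
  standard Gaussian measure of the product space.
\<close>

definition std_gaussian :: "'a::euclidean_space measure" where
  "std_gaussian = density lborel (\<lambda>x. ennreal (exp (- (norm x)\<^sup>2 / 2) / sqrt (2 * pi) ^ DIM('a)))"

lemma space_std_gaussian [simp]: "space std_gaussian = UNIV"
  and sets_std_gaussian [simp, measurable_cong]: "sets std_gaussian = sets borel"
  by (simp_all add: std_gaussian_def)

lemma nn_integral_std_gaussian:
  fixes f :: "'a::euclidean_space \<Rightarrow> ennreal"
  assumes [measurable]: "f \<in> borel_measurable borel"
  shows "(\<integral>\<^sup>+x. f x \<partial>std_gaussian)
    = (\<integral>\<^sup>+x. ennreal (exp (- (norm x)\<^sup>2 / 2) / sqrt (2 * pi) ^ DIM('a)) * f x \<partial>lborel)"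
  unfolding std_gaussian_def by (subst nn_integral_density) auto

lemma std_gaussian_density_eq_prod:
  "exp (- (norm x)\<^sup>2 / 2) / sqrt (2 * pi) ^ DIM('a) = (\<Prod>b\<in>Basis. std_normal_density (x \<bullet> b))"
  for x :: "'a::euclidean_space"
proof -
  have "(\<Prod>b\<in>Basis. std_normal_density (x \<bullet> b)) = (\<Prod>b\<in>(Basis::'a set). exp (- (x \<bullet> b)\<^sup>2 / 2)) / sqrt (2 * pi) ^ DIM('a)"
    unfolding std_normal_density_def by (simp add: prod_dividef)
  also have "(\<Prod>b\<in>(Basis::'a set). exp (- (x \<bullet> b)\<^sup>2 / 2)) = exp (- (norm x)\<^sup>2 / 2)"
    by (simp add: exp_sum[symmetric] norm_eq_sqrt_inner euclidean_inner[of x x] power2_eq_square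
        sum_negf sum_divide_distrib real_sqrt_pow2 sum_nonneg)
  finally show ?thesis by simp
qed

lemma prob_space_std_gaussian: "prob_space (std_gaussian :: 'a::euclidean_space measure)"
proof
  have "emeasure (std_gaussian :: 'a measure) UNIV = (\<integral>\<^sup>+(x::'a). 1 \<partial>std_gaussian)" by simp
  also have "\<dots> = (\<integral>\<^sup>+(x::'a). (\<Prod>b\<in>Basis. ennreal (std_normal_density (x \<bullet> b))) \<partial>lborel)"
    unfolding std_gaussian_density_eq_prod[symmetric] prod_ennreal[OF normal_density_nonneg]
    by (subst nn_integral_std_gaussian) simp_all
  also have "\<dots> = (\<Prod>b\<in>(Basis::'a set). (\<integral>\<^sup>+x. ennreal (std_normal_density x) \<partial>lborel))"
    by (rule nn_integral_lborel_prod) auto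
  also have "(\<integral>\<^sup>+x. ennreal (std_normal_density x) \<partial>lborel) = 1"
    using prob_space.emeasure_space_1[OF prob_space_normal_density[of 1 0]] 
    by (simp add: emeasure_density)
  finally show "emeasure (std_gaussian :: 'a measure) (space std_gaussian) = 1" by simp
qed

interpretation std_gaussian: prob_space "std_gaussian :: 'a::euclidean_space measure"
  by (rule prob_space_std_gaussian)

lemma emeasure_std_gaussian_UNIV [simp]: "emeasure (std_gaussian :: 'a::euclidean_space measure) UNIV = 1"
  using std_gaussian.emeasure_space_1 by simp

interpretation std_gaussian_pair: pair_prob_space
  "std_gaussian :: 'a::euclidean_space measure" "std_gaussian :: 'b::euclidean_space measure" ..

lemma AE_std_gaussian_neq: "AE x in (std_gaussian :: 'a::euclidean_space measure). x \<noteq> z"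
  unfolding std_gaussian_def using AE_lborel_singleton[of z] by (subst AE_density) auto

lemmas AE_std_gaussian_nonzero = AE_std_gaussian_neq[of 0]

lemma distr_std_gaussian_orthogonal:
  fixes T :: "'a::euclidean_space \<Rightarrow> 'a"
  assumes T: "orthogonal_transformation T"
  shows "distr std_gaussian borel T = std_gaussian"
proof (rule measure_eqI)
  note [measurable] = orthogonal_transformation_measurable[OF T]
  fix A :: "'a set" assume "A \<in> sets (distr std_gaussian borel T)"
  then have [measurable]: "A \<in> sets borel" by simp
  have [simp]: "norm (T x) = norm x" for x using orthogonal_transformation_norm[OF T] .
  have "emeasure (distr std_gaussian borel T) A = (\<integral>\<^sup>+x. indicator A x \<partial>distr std_gaussian borel T)"
    by simp
  also have "\<dots> = (\<integral>\<^sup>+x. indicator A (T x) \<partial>std_gaussian)"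
    by (subst nn_integral_distr) auto
  also have "\<dots> = (\<integral>\<^sup>+x. ennreal (exp (- (norm x)\<^sup>2 / 2) / sqrt (2 * pi) ^ DIM('a)) * indicator A (T x) \<partial>lborel)"
    by (rule nn_integral_std_gaussian) measurable
  also have "\<dots> = (\<integral>\<^sup>+x. ennreal (exp (- (norm x)\<^sup>2 / 2) / sqrt (2 * pi) ^ DIM('a)) * indicator A x \<partial>lborel)"
    using nn_integral_lborel_orthogonal[OF T, of "\<lambda>x. ennreal (exp (- (norm x)\<^sup>2 / 2) / sqrt (2 * pi) ^ DIM('a)) * indicator A x"]
    by simp
  also have "\<dots> = (\<integral>\<^sup>+x. indicator A x \<partial>std_gaussian)"
    by (rule nn_integral_std_gaussian[symmetric]) measurable
  finally show "emeasure (distr std_gaussian borel T) A = emeasure std_gaussian A" by simp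
qed simp

lemma std_gaussian_pair:
  "(std_gaussian :: 'a::euclidean_space measure) \<Otimes>\<^sub>M (std_gaussian :: 'b::euclidean_space measure) = std_gaussian"
proof -
  have "(std_gaussian :: 'a measure) \<Otimes>\<^sub>M (std_gaussian :: 'b measure) =
     density (lborel \<Otimes>\<^sub>M lborel) (\<lambda>(x,y). ennreal (exp (- (norm x)\<^sup>2 / 2) / sqrt (2 * pi) ^ DIM('a))
       * ennreal (exp (- (norm y)\<^sup>2 / 2) / sqrt (2 * pi) ^ DIM('b)))"
    unfolding std_gaussian_def
    using std_gaussian.sigma_finite_measure_axioms[where 'a='b, unfolded std_gaussian_def]
    by (intro pair_measure_density) (auto intro: lborel.sigma_finite_measure_axioms)
  also have "\<dots> = density lborel (\<lambda>x::'a\<times>'b. ennreal (exp (- (norm x)\<^sup>2 / 2) / sqrt (2 * pi) ^ DIM('a\<times>'b)))"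
  proof -
    have "(\<lambda>(x,y). ennreal (exp (- (norm x)\<^sup>2 / 2) / sqrt (2 * pi) ^ DIM('a))
       * ennreal (exp (- (norm y)\<^sup>2 / 2) / sqrt (2 * pi) ^ DIM('b)))
      = (\<lambda>x::'a\<times>'b. ennreal (exp (- (norm x)\<^sup>2 / 2) / sqrt (2 * pi) ^ DIM('a\<times>'b)))"
    proof
      fix p :: "'a \<times> 'b"
      obtain x y where p: "p = (x, y)" by (cases p)
      have "- (norm p)\<^sup>2 / 2 = - (norm x)\<^sup>2 / 2 + - (norm y)\<^sup>2 / 2"
        by (simp add: p norm_Pair add_divide_distrib)
      then have "exp (- (norm p)\<^sup>2 / 2) = exp (- (norm x)\<^sup>2 / 2) * exp (- (norm y)\<^sup>2 / 2)"
        by (simp only: exp_add)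
      then show "(case p of (x, y) \<Rightarrow> ennreal (exp (- (norm x)\<^sup>2 / 2) / sqrt (2 * pi) ^ DIM('a))
         * ennreal (exp (- (norm y)\<^sup>2 / 2) / sqrt (2 * pi) ^ DIM('b)))
        = ennreal (exp (- (norm p)\<^sup>2 / 2) / sqrt (2 * pi) ^ DIM('a\<times>'b))"
        by (simp add: p power_add ennreal_mult'[symmetric] del: minus_divide_left)
    qed
    then show ?thesis by (simp only: lborel_prod)
  qed
  finally show ?thesis by (simp add: std_gaussian_def)
qed

text \<open>
  If \<open>X\<close> and \<open>Y\<close> are independent standard Gaussian vectors, so are \<open>c X - s Y\<close> and \<open>s X + c Y\<close>: the
  rotation acts orthogonally on the product space.
\<close>

lemma distr_std_gaussian_rotate:
  fixes c s :: real
  assumes "c\<^sup>2 + s\<^sup>2 = 1"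
  shows "distr (std_gaussian \<Otimes>\<^sub>M std_gaussian) borel
     (\<lambda>(x::'a::euclidean_space, y). (c *\<^sub>R x - s *\<^sub>R y, s *\<^sub>R x + c *\<^sub>R y)) = std_gaussian \<Otimes>\<^sub>M std_gaussian"
proof -
  let ?T = "\<lambda>(x::'a, y). (c *\<^sub>R x - s *\<^sub>R y, s *\<^sub>R x + c *\<^sub>R y)"
  have "orthogonal_transformation ?T"
    unfolding orthogonal_transformation_def
  proof (intro conjI allI)
    show "linear ?T" by (rule linearI) (auto simp: algebra_simps)
    fix v w :: "'a \<times> 'a"
    obtain a b x y where [simp]: "v = (a, b)" "w = (x, y)" by (cases v, cases w)
    have "?T v \<bullet> ?T w = (c\<^sup>2 + s\<^sup>2) * (a \<bullet> x + b \<bullet> y)"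
      by (simp add: inner_diff_left inner_diff_right inner_add_left inner_add_right algebra_simps power2_eq_square)
    then show "?T v \<bullet> ?T w = v \<bullet> w" using assms by simp
  qed
  from distr_std_gaussian_orthogonal[OF this] show ?thesis by (simp add: std_gaussian_pair)
qed

text \<open>
  Integrate the identity \<open>exp (- |x|\<^sup>2 / 2) / |x|\<^sup>2 = (1/2) \<integral>\<^sub>1\<^sup>\<infinity> exp (- l |x|\<^sup>2 / 2) dl\<close> first in \<open>x\<close>;
  by scaling, the inner integral is proportional to \<open>l\<close> to the power \<open>- n / 2\<close>.
\<close>

lemma nn_integral_std_gaussian_inverse_square:
  assumes n: "DIM('a::euclidean_space) \<ge> 3"
  shows "(\<integral>\<^sup>+(x::'a). ennreal (1 / (norm x)\<^sup>2) \<partial>std_gaussian) = ennreal (1 / (real DIM('a) - 2))"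
proof -
  define n where "n = DIM('a)"
  define S where "S = sqrt (2 * pi) ^ n"
  have S: "S > 0" by (simp add: S_def)
  have e1: "(\<integral>\<^sup>+l\<in>{1..}. ennreal (exp (- l * (norm x)\<^sup>2 / 2) / (2 * S)) \<partial>lborel) = ennreal (exp (- (norm x)\<^sup>2 / 2) / S * (1 / (norm x)\<^sup>2))"
    if "x \<noteq> 0" for x :: 'a
  proof -
    define q where "q = (norm x)\<^sup>2"
    have q: "q > 0" using that by (simp add: q_def)
    have "(\<integral>\<^sup>+l. ennreal (exp (- l * q / 2) / (2 * S)) * indicator {1..} l \<partial>lborel) = ennreal (0 - (- exp (- 1 * q / 2) / (q * S)))"
    proof (rule nn_integral_FTC_atLeast)
      show "((\<lambda>l. - exp (- l * q / 2) / (q * S)) \<longlongrightarrow> 0) at_top"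
        using q S by real_asymp
    qed (use q S in \<open>auto intro!: derivative_eq_intros simp: field_simps\<close>)
    then show ?thesis by (simp add: q_def mult_ac)
  qed
  have e2: "(\<integral>\<^sup>+(x::'a). ennreal (exp (- l * (norm x)\<^sup>2 / 2) / (2 * S)) \<partial>lborel) = ennreal (l powr (- real n / 2) / 2)" if "l \<ge> 1" for l
  proof -
    have l: "l > 0" using that by simp
    have "(\<integral>\<^sup>+(x::'a). ennreal (exp (- l * (norm x)\<^sup>2 / 2) / (2 * S)) \<partial>lborel)
      = ennreal ((1 / sqrt l) ^ DIM('a)) * (\<integral>\<^sup>+(x::'a). ennreal (exp (- l * (norm ((1 / sqrt l) *\<^sub>R x))\<^sup>2 / 2) / (2 * S)) \<partial>lborel)"
      by (rule nn_integral_lborel_scale) (use l in auto)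
    also have "(\<integral>\<^sup>+(x::'a). ennreal (exp (- l * (norm ((1 / sqrt l) *\<^sub>R x))\<^sup>2 / 2) / (2 * S)) \<partial>lborel)
      = (\<integral>\<^sup>+(x::'a). ennreal (1/2) \<partial>std_gaussian)"
    proof (subst nn_integral_std_gaussian)
      have "- l * (norm ((1 / sqrt l) *\<^sub>R x))\<^sup>2 / 2 = - (norm x)\<^sup>2 / 2" for x :: 'a
        using l by (simp add: power_mult_distrib power_divide)
      then show "(\<integral>\<^sup>+(x::'a). ennreal (exp (- l * (norm ((1 / sqrt l) *\<^sub>R x))\<^sup>2 / 2) / (2 * S)) \<partial>lborel)
        = (\<integral>\<^sup>+(x::'a). ennreal (exp (- (norm x)\<^sup>2 / 2) / sqrt (2 * pi) ^ DIM('a)) * ennreal (1/2) \<partial>lborel)"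
        by (intro nn_integral_cong) 
           (simp only: S_def n_def, subst ennreal_mult'[symmetric], auto simp: mult.commute)
    qed measurable
    also have "\<dots> = ennreal (1/2)" by simp
    also have "(1 / sqrt l) ^ DIM('a) = l powr (- real n / 2)"
      using l by (simp add: n_def powr_half_sqrt[symmetric] powr_minus_divide powr_powr power_divide flip: powr_realpow)
    finally show ?thesis by (subst (asm) ennreal_mult'[symmetric]) simp_all
  qed
  have e3: "(\<integral>\<^sup>+l\<in>{1..}. ennreal (l powr (- real n / 2) / 2) \<partial>lborel) = ennreal (1 / (real n - 2))"
  proof -
    have "(\<integral>\<^sup>+l. ennreal (l powr (- real n / 2) / 2) * indicator {1..} l \<partial>lborel) = ennreal (0 - (- (1 powr (1 - real n / 2) / (real n - 2))))"
    proof (rule nn_integral_FTC_atLeast[where F = "\<lambda>l::real. - (l powr (1 - real n / 2) / (real n - 2))"])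
      show "((\<lambda>l::real. - (l powr (1 - real n / 2) / (real n - 2))) \<longlongrightarrow> 0) at_top"
      proof -
        have "((\<lambda>l::real. l powr (1 - real n / 2)) \<longlongrightarrow> 0) at_top"
          using n by (intro tendsto_neg_powr filterlim_ident) (auto simp: n_def)
        from tendsto_minus[OF tendsto_divide_zero[OF this]] show ?thesis by simp
      qed
      show "((\<lambda>l::real. - (l powr (1 - real n / 2) / (real n - 2))) has_real_derivative l powr (- real n / 2) / 2) (at l)" if "1 \<le> l" for l
      proof (rule DERIV_cong)
        show "((\<lambda>l. - (l powr (1 - real n / 2) / (real n - 2))) has_real_derivative
            - ((1 - real n / 2) * l powr (1 - real n / 2 - 1) / (real n - 2))) (at l)"
          using that by (intro DERIV_minus DERIV_cdivide has_real_derivative_powr) auto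
        have "1 - real n / 2 = - ((real n - 2) / 2)" by (simp add: field_simps)
        moreover have "real n - 2 \<noteq> 0" using n by (simp add: n_def)
        moreover have "- (- (k / 2) * q / k) = q / 2" if "k \<noteq> 0" for k q :: real
          using that by simp
        ultimately have "- ((1 - real n / 2) * q / (real n - 2)) = q / 2" for q by metis
        then show "- ((1 - real n / 2) * l powr (1 - real n / 2 - 1) / (real n - 2)) = l powr (- real n / 2) / 2"
          by simp
      qed
    qed auto
    then show ?thesis by simp
  qed
  have "(\<integral>\<^sup>+(x::'a). ennreal (1 / (norm x)\<^sup>2) \<partial>std_gaussian) = (\<integral>\<^sup>+(x::'a). ennreal (exp (- (norm x)\<^sup>2 / 2) / S * (1 / (norm x)\<^sup>2)) \<partial>lborel)"
    by (subst nn_integral_std_gaussian) (auto simp: S_def n_def ennreal_mult'[symmetric])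
  also have "\<dots> = (\<integral>\<^sup>+(x::'a). (\<integral>\<^sup>+l\<in>{1..}. ennreal (exp (- l * (norm x)\<^sup>2 / 2) / (2 * S)) \<partial>lborel) \<partial>lborel)"
    by (intro nn_integral_cong_AE eventually_mono[OF AE_lborel_singleton[of "0::'a"]]) (rule e1[symmetric])
  also have "\<dots> = (\<integral>\<^sup>+l. (\<integral>\<^sup>+(x::'a). ennreal (exp (- l * (norm x)\<^sup>2 / 2) / (2 * S)) * indicator {1..} l \<partial>lborel) \<partial>lborel)"
    by (rule lborel_pair.Fubini') measurable
  also have "\<dots> = (\<integral>\<^sup>+l\<in>{1..}. ennreal (l powr (- real n / 2) / 2) \<partial>lborel)"
  proof (rule nn_integral_cong)
    fix l :: real
    show "(\<integral>\<^sup>+(x::'a). ennreal (exp (- l * (norm x)\<^sup>2 / 2) / (2 * S)) * indicator {1..} l \<partial>lborel)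
       = ennreal (l powr (- real n / 2) / 2) * indicator {1..} l"
      using e2[of l] by (cases "l \<ge> 1") auto
  qed
  also note e3
  finally show ?thesis by (simp add: n_def)
qed

text \<open>
  The direction and the norm of a Gaussian vector are independent, and the direction has the same law as
  that of a uniform point of the unit ball.
\<close>

lemma nn_integral_std_gaussian_polar:
  fixes h :: "'a::euclidean_space \<Rightarrow> ennreal" and w :: "real \<Rightarrow> ennreal"
  assumes h[measurable]: "h \<in> borel_measurable borel" and w[measurable]: "w \<in> borel_measurable borel"
    and hom: "\<And>x c. c > 0 \<Longrightarrow> h (c *\<^sub>R x) = h x" and fin: "\<And>x. h x \<le> ennreal C"
  shows "(\<integral>\<^sup>+x. h x * w (norm x) \<partial>std_gaussian) = (\<integral>\<^sup>+x. h x \<partial>std_gaussian) * (\<integral>\<^sup>+(x::'a). w (norm x) \<partial>std_gaussian)"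
    and "(\<integral>\<^sup>+x. h x \<partial>std_gaussian) * emeasure lborel (ball (0::'a) 1) = (\<integral>\<^sup>+x\<in>ball 0 1. h x \<partial>lborel)"
proof -
  define V where "V = emeasure lborel (ball (0::'a) 1)"
  have Vfin: "V \<noteq> \<infinity>" unfolding V_def using emeasure_lborel_ball_finite[of "0 :: 'a" 1] by simp
  have V0: "V \<noteq> 0" unfolding V_def using content_ball_pos[of 1 "0::'a"] by (auto simp: measure_def)
  define d where "d t = ennreal (exp (- t\<^sup>2 / 2) / sqrt (2 * pi) ^ DIM('a))" for t :: real
  have [measurable]: "d \<in> borel_measurable borel" unfolding d_def by measurable
  have D: "(\<integral>\<^sup>+x. f x \<partial>std_gaussian) = (\<integral>\<^sup>+x. f x * d (norm x) \<partial>lborel)" if "f \<in> borel_measurable borel" for f :: "'a \<Rightarrow> ennreal"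
    using that by (simp add: nn_integral_std_gaussian d_def mult.commute)
  have F: "(\<integral>\<^sup>+x\<in>ball 0 1. h x \<partial>lborel) \<noteq> \<infinity>"
  proof -
    have "(\<integral>\<^sup>+x\<in>ball 0 1. h x \<partial>lborel) \<le> (\<integral>\<^sup>+x. ennreal C * indicator (ball (0::'a) 1) x \<partial>lborel)"
      by (intro nn_integral_mono mult_right_mono fin) auto
    also have "\<dots> = ennreal C * V" by (simp add: nn_integral_cmult_indicator V_def)
    also have "\<dots> < \<infinity>" using Vfin by (simp add: ennreal_mult_less_top less_top)
    finally show ?thesis by simp
  qed
  have 1: "(\<integral>\<^sup>+x. h x * u (norm x) \<partial>std_gaussian) * V = (\<integral>\<^sup>+x\<in>ball 0 1. h x \<partial>lborel) * (\<integral>\<^sup>+(x::'a). u (norm x) \<partial>std_gaussian)"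
    if [measurable]: "u \<in> borel_measurable borel" for u
    using nn_integral_polar[OF h _ hom F, of "\<lambda>t. u t * d t"] by (simp add: D V_def mult.assoc)
  from 1[of "\<lambda>_. 1"] show 2: "(\<integral>\<^sup>+x. h x \<partial>std_gaussian) * emeasure lborel (ball (0::'a) 1) = (\<integral>\<^sup>+x\<in>ball 0 1. h x \<partial>lborel)"
    by (simp add: V_def)
  have "(\<integral>\<^sup>+x. h x * w (norm x) \<partial>std_gaussian) * V = (\<integral>\<^sup>+x. h x \<partial>std_gaussian) * (\<integral>\<^sup>+(x::'a). w (norm x) \<partial>std_gaussian) * V"
    using 1[OF w] 2[folded V_def, symmetric] by (metis mult.assoc mult.commute)
  then show "(\<integral>\<^sup>+x. h x * w (norm x) \<partial>std_gaussian) = (\<integral>\<^sup>+x. h x \<partial>std_gaussian) * (\<integral>\<^sup>+(x::'a). w (norm x) \<partial>std_gaussian)"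
    using V0 Vfin by (simp add: mult.commute[of _ V] ennreal_mult_cancel_left)
qed

section \<open>Angles and rotations\<close>

definition hyperplane_reflection :: "'a::real_inner \<Rightarrow> 'a \<Rightarrow> 'a" where
  "hyperplane_reflection w z = z - (2 * (z \<bullet> w) / (w \<bullet> w)) *\<^sub>R w"

lemma orthogonal_transformation_hyperplane_reflection:
  "orthogonal_transformation (hyperplane_reflection w)"
  unfolding orthogonal_transformation_def
proof (intro conjI allI)
  show "linear (hyperplane_reflection w)"
    by (rule linearI) (auto simp: hyperplane_reflection_def inner_add_left algebra_simps add_divide_distrib)
  show "hyperplane_reflection w x \<bullet> hyperplane_reflection w y = x \<bullet> y" for x y
    by (cases "w = 0")
       (auto simp: hyperplane_reflection_def inner_diff_left inner_diff_right inner_commute field_simps)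
qed

lemma hyperplane_reflection_swap:
  assumes "norm a = norm b"
  shows "hyperplane_reflection (a - b) a = b"
proof (cases "a = b")
  case False
  have "a \<bullet> a = b \<bullet> b" using assms by (simp add: norm_eq)
  then have "(a - b) \<bullet> (a - b) = 2 * (a \<bullet> (a - b))"
    by (simp add: inner_diff_left inner_diff_right inner_commute)
  moreover have "(a - b) \<bullet> (a - b) \<noteq> 0" using False by simp
  ultimately have "2 * (a \<bullet> (a - b)) / ((a - b) \<bullet> (a - b)) = 1" by (metis divide_self)
  then show ?thesis unfolding hyperplane_reflection_def by (simp only: scaleR_one) simp
qed (simp add: hyperplane_reflection_def)

definition vec_angle :: "'a::real_inner \<Rightarrow> 'a \<Rightarrow> real" where
  "vec_angle x y = arccos (sgn x \<bullet> sgn y)"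

lemma abs_inner_sgn_le_1: "\<bar>sgn x \<bullet> sgn y\<bar> \<le> 1" for x y :: "'a::real_inner"
  using Cauchy_Schwarz_ineq2[of "sgn x" "sgn y"] by (simp add: norm_sgn split: if_splits)

lemma vec_angle_nonneg: "0 \<le> vec_angle x y"
  and vec_angle_le_pi: "vec_angle x y \<le> pi"
  using abs_inner_sgn_le_1[of x y] by (auto simp: vec_angle_def intro!: arccos_lbound arccos_ubound)

lemma vec_angle_self: "x \<noteq> 0 \<Longrightarrow> vec_angle x x = 0"
  by (simp add: vec_angle_def dot_square_norm norm_sgn)

lemma vec_angle_scale: "c > 0 \<Longrightarrow> vec_angle x (c *\<^sub>R y) = vec_angle x y"
  by (simp add: vec_angle_def sgn_scaleR)

text \<open>
  To first order in the displacement the angle is at most its length divided by \<open>|x|\<close>. An explicit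
  quadratic error term makes difference quotients integrable against Gaussian weights; the
  constant \<open>16\<close> is chosen so that for relative displacements above \<open>1/2\<close> the bound exceeds \<open>4 > \<pi>\<close>.
\<close>

lemma vec_angle_perturb:
  fixes x y :: "'a::real_inner"
  assumes x: "x \<noteq> 0" and y: "y \<noteq> 0"
  shows "vec_angle x y \<le> norm (y - x) / norm x + 16 * (norm (y - x) / norm x)\<^sup>2"
proof -
  define t where "t = norm (y - x) / norm x"
  have t0: "t \<ge> 0" by (simp add: t_def)
  show ?thesis
  proof (cases "t \<le> 1/2")
    case False
    then have "(1/2)\<^sup>2 \<le> t\<^sup>2" by (intro power_mono) auto
    then have "pi \<le> t + 16 * t\<^sup>2" using t0 pi_less_4 by (simp add: power2_eq_square)
    then show ?thesis using vec_angle_le_pi[of x y] by (simp add: t_def)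
  next
    case True
    define k where "k = sgn x \<bullet> sgn y"
    have k: "k = (x \<bullet> y) / (norm x * norm y)" by (simp add: k_def sgn_div_norm divide_inverse mult_ac)
    have nd: "norm (y - x) = t * norm x" using x by (simp add: t_def)
    have "x \<bullet> y = norm x ^ 2 + x \<bullet> (y - x)" by (simp add: inner_diff_right power2_norm_eq_inner)
    moreover have "\<bar>x \<bullet> (y - x)\<bar> \<le> t * norm x ^ 2"
      using Cauchy_Schwarz_ineq2[of x "y - x"] by (simp add: nd power2_eq_square mult_ac)
    moreover have "t * norm x ^ 2 \<le> 1/2 * norm x ^ 2" using True by (intro mult_right_mono) auto
    moreover have "norm x ^ 2 > 0" using x by simp
    ultimately have "x \<bullet> y > 0" by linarith
    then have k0: "k > 0" using x y by (simp add: k)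
    have "(norm x)\<^sup>2 * (norm y)\<^sup>2 - (x \<bullet> y)\<^sup>2 \<le> (norm (y - x))\<^sup>2 * (norm y)\<^sup>2"
    proof -
      have "(norm (y - x))\<^sup>2 * (norm y)\<^sup>2 - ((norm x)\<^sup>2 * (norm y)\<^sup>2 - (x \<bullet> y)\<^sup>2) = ((norm y)\<^sup>2 - x \<bullet> y)\<^sup>2"
        unfolding power2_norm_eq_inner
        by (simp add: inner_diff_left inner_diff_right inner_commute power2_eq_square algebra_simps)
      then show ?thesis using zero_le_power2[of "(norm y)\<^sup>2 - x \<bullet> y"] by linarith
    qed
    then have "((norm x)\<^sup>2 * (norm y)\<^sup>2 - (x \<bullet> y)\<^sup>2) / ((norm x)\<^sup>2 * (norm y)\<^sup>2) \<le> ((norm (y - x))\<^sup>2 * (norm y)\<^sup>2) / ((norm x)\<^sup>2 * (norm y)\<^sup>2)"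
      by (rule divide_right_mono) simp
    then have k2: "1 - k\<^sup>2 \<le> t\<^sup>2"
      using x y by (simp add: k t_def power_divide power_mult_distrib diff_divide_distrib)
    have k1: "\<bar>k\<bar> \<le> 1" using abs_inner_sgn_le_1[of x y] by (simp add: k_def)
    have "(1 - t)\<^sup>2 \<le> 1 - t\<^sup>2" using t0 True by (simp add: power2_eq_square algebra_simps mult_left_le)
    then have "(1 - t)\<^sup>2 \<le> k\<^sup>2" using k2 by linarith
    then have kt: "1 - t \<le> k" using k0 by (rule power2_le_imp_le[OF _ less_imp_le])
    have sint: "sqrt (1 - k\<^sup>2) \<le> t" using k2 t0 real_sqrt_le_mono real_sqrt_unique by fastforce
    define a where "a = arccos k"
    \<comment> \<open>The angle is acute, and its tangent is at most \<open>t / (1 - t)\<close>.\<close>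
    have a: "0 \<le> a" "a < pi / 2" unfolding a_def
      using k0 k1 arccos_lbound[of k] arccos_less_arccos[of 0 k] by auto
    have "a = arctan (tan a)" using a by (simp add: arctan_tan)
    also have "\<dots> \<le> tan a" using a by (intro arctan_le_self) (simp add: tan_def cos_ge_zero sin_ge_zero)
    also have "tan a = sqrt (1 - k\<^sup>2) / k" using k1 by (simp add: tan_def a_def sin_arccos_abs cos_arccos_abs)
    also have "\<dots> \<le> t / (1 - t)"
      by (rule frac_le) (use t0 sint True kt in auto)
    also have "\<dots> \<le> t + 16 * t\<^sup>2"
    proof -
      have "(t + 2 * t\<^sup>2) * (1 - t) - t = t\<^sup>2 * (1 - 2 * t)" by (simp add: power2_eq_square algebra_simps)
      moreover have "t\<^sup>2 * (1 - 2 * t) \<ge> 0" using True by (intro mult_nonneg_nonneg) auto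
      ultimately have "t \<le> (t + 2 * t\<^sup>2) * (1 - t)" by linarith
      then have "t / (1 - t) \<le> t + 2 * t\<^sup>2" using True by (subst pos_divide_le_eq) auto
      moreover have "0 \<le> t\<^sup>2" by simp
      ultimately show ?thesis by linarith
    qed
    finally show ?thesis by (simp add: a_def k_def t_def vec_angle_def)
  qed
qed

text \<open>
  The squared norm of \<open>(1 - \<langle>u,v\<rangle>\<^sup>2)\<close> times the component of \<open>z\<close> orthogonal to \<open>u\<close> and \<open>v\<close> is nonnegative.
\<close>

lemma gram_inequality:
  fixes z u v :: "'a::real_inner"
  assumes u: "u \<bullet> u = 1" and v: "v \<bullet> v = 1" and c: "\<bar>u \<bullet> v\<bar> < 1"
  shows "(z \<bullet> u)\<^sup>2 + (z \<bullet> v)\<^sup>2 - 2 * (u \<bullet> v) * (z \<bullet> u) * (z \<bullet> v) \<le> (1 - (u \<bullet> v)\<^sup>2) * (z \<bullet> z)"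
proof -
  define c a b where "c = u \<bullet> v" and "a = z \<bullet> u" and "b = z \<bullet> v"
  define p where "p = (1 - c\<^sup>2) *\<^sub>R z - (a - c * b) *\<^sub>R u - (b - c * a) *\<^sub>R v"
  have vu: "v \<bullet> u = c" by (simp add: c_def inner_commute)
  have "p \<bullet> u = 0"
    by (simp add: p_def inner_diff_left u vu a_def[symmetric]) (simp add: algebra_simps power2_eq_square)
  moreover have "p \<bullet> v = 0"
    by (simp add: p_def inner_diff_left v c_def[symmetric] b_def[symmetric]) (simp add: algebra_simps power2_eq_square)
  ultimately have "p \<bullet> p = (1 - c\<^sup>2) * (p \<bullet> z)"
    by (subst p_def) (simp add: inner_diff_right inner_diff_left inner_commute)
  also have "p \<bullet> z = (1 - c\<^sup>2) * (z \<bullet> z) - (a\<^sup>2 + b\<^sup>2 - 2 * c * a * b)"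
    by (simp add: p_def inner_diff_left inner_commute[of u z] inner_commute[of v z] a_def[symmetric] b_def[symmetric])
       (simp add: algebra_simps power2_eq_square)
  finally have *: "p \<bullet> p = (1 - c\<^sup>2) * ((1 - c\<^sup>2) * (z \<bullet> z) - (a\<^sup>2 + b\<^sup>2 - 2 * c * a * b))" .
  have "c\<^sup>2 < 1" using c by (simp add: c_def abs_square_less_1)
  then have "0 \<le> (1 - c\<^sup>2) * (z \<bullet> z) - (a\<^sup>2 + b\<^sup>2 - 2 * c * a * b)"
    using * inner_ge_zero[of p] by (metis diff_gt_0_iff_gt zero_le_mult_iff not_less)
  then show ?thesis by (simp add: a_def b_def c_def)
qed

text \<open>
  The rotation in the plane spanned by \<open>u\<close> and \<open>v\<close>, written as the product of the reflections
  along \<open>u\<close> and along \<open>u + v\<close>: vectors in the plane turn by exactly the angle between \<open>u\<close> and \<open>v\<close>, and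
  no other vector turns by more. Antipodal points are excluded because \<open>u + v\<close> then vanishes.
\<close>

lemma rotation_with_controlled_angle:
  fixes u v :: "'a::real_inner"
  assumes u: "norm u = 1" and v: "norm v = 1" and "u \<noteq> - v"
  obtains T where "orthogonal_transformation T" "T u = v"
    "\<And>z. z \<noteq> 0 \<Longrightarrow> vec_angle z (T z) \<le> vec_angle u v"
proof (cases "u = v")
  case True
  show ?thesis
    by (rule that[of id]) (auto simp: True vec_angle_self vec_angle_nonneg orthogonal_transformation_id[unfolded id_def] id_def)
next
  case False
  have uu: "u \<bullet> u = 1" and vv: "v \<bullet> v = 1" using u v by (simp_all add: norm_eq_1)
  define c where "c = u \<bullet> v"
  have vu: "v \<bullet> u = c" by (simp add: c_def inner_commute)
  have c1: "c \<noteq> 1"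
  proof
    assume "c = 1"
    then have "(u - v) \<bullet> (u - v) = 0" by (simp add: inner_diff_left inner_diff_right uu vv vu c_def[symmetric])
    then show False using False by simp
  qed
  have c2: "c \<noteq> -1"
  proof
    assume "c = -1"
    then have "(u + v) \<bullet> (u + v) = 0" by (simp add: inner_add_left inner_add_right uu vv vu c_def[symmetric])
    then have "u + v = 0" by (simp only: inner_eq_zero_iff)
    then show False using \<open>u \<noteq> - v\<close> by (simp add: eq_neg_iff_add_eq_0)
  qed
  have "\<bar>c\<bar> \<le> 1" using Cauchy_Schwarz_ineq2[of u v] by (simp add: c_def u v)
  then have c: "\<bar>c\<bar> < 1" using c1 c2 by auto
  then have cp: "1 + c > 0" by auto
  define w where "w = u + v"
  have ww: "w \<bullet> w = 2 * (1 + c)" by (simp add: w_def inner_add_left inner_add_right uu vv vu c_def[symmetric])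
  have uw: "u \<bullet> w = 1 + c" by (simp add: w_def inner_add_right uu c_def)
  define T where "T = hyperplane_reflection w \<circ> hyperplane_reflection u"
  have T: "orthogonal_transformation T" unfolding T_def
    by (intro orthogonal_transformation_compose orthogonal_transformation_hyperplane_reflection)
  have Hu: "hyperplane_reflection u z = z - (2 * (z \<bullet> u)) *\<^sub>R u" for z
    by (simp add: hyperplane_reflection_def uu)
  have Tz: "T z = z - (2 * (z \<bullet> u)) *\<^sub>R u - ((z \<bullet> v - z \<bullet> u - 2 * c * (z \<bullet> u)) / (1 + c)) *\<^sub>R w" for z
  proof -
    have "(z - (2 * (z \<bullet> u)) *\<^sub>R u) \<bullet> w = z \<bullet> v - z \<bullet> u - 2 * c * (z \<bullet> u)"
      by (simp add: inner_diff_left uw) (simp add: w_def inner_add_right algebra_simps)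
    then show ?thesis using cp
      by (simp only: T_def o_apply Hu) (simp only: hyperplane_reflection_def ww mult_divide_mult_cancel_left zero_neq_numeral not_False_eq_True)
  qed
  have Tu: "T u = v"
  proof -
    have "(c - 1 - 2 * c) / (1 + c) = -1" using cp by (simp add: field_simps)
    then show ?thesis using uu by (simp add: Tz c_def[symmetric] w_def scaleR_2)
  qed
  have ang: "vec_angle z (T z) \<le> vec_angle u v" if z: "z \<noteq> 0" for z
  proof -
    define a b where "a = z \<bullet> u" and "b = z \<bullet> v"
    have "z \<bullet> T z = z \<bullet> z - 2 * a\<^sup>2 - (b - a - 2 * c * a) / (1 + c) * (a + b)"
      by (simp add: Tz inner_diff_right a_def[symmetric] b_def[symmetric])
         (simp add: w_def inner_add_right a_def b_def power2_eq_square)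
    then have "(1 + c) * (z \<bullet> T z) = (1 + c) * (z \<bullet> z - 2 * a\<^sup>2) - (b - a - 2 * c * a) * (a + b)"
      using cp by (simp add: right_diff_distrib)
    also have "\<dots> = (1 + c) * (z \<bullet> z) - (a\<^sup>2 + b\<^sup>2 - 2 * c * a * b)"
      by (simp add: algebra_simps power2_eq_square)
    also have "\<dots> \<ge> (1 + c) * (z \<bullet> z) - (1 - c\<^sup>2) * (z \<bullet> z)"
      using gram_inequality[OF uu vv c[unfolded c_def], of z] by (simp add: a_def b_def c_def)
    also have "(1 + c) * (z \<bullet> z) - (1 - c\<^sup>2) * (z \<bullet> z) = (1 + c) * (c * (z \<bullet> z))"
      by (simp add: algebra_simps power2_eq_square)
    finally have "c * (z \<bullet> z) \<le> z \<bullet> T z" using cp by simp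
    moreover have "norm (T z) = norm z" by (rule orthogonal_transformation_norm[OF T])
    ultimately have "c \<le> sgn z \<bullet> sgn (T z)"
      using z by (simp add: sgn_div_norm divide_inverse[symmetric] field_simps flip: power2_norm_eq_inner power2_eq_square)
    then have "arccos (sgn z \<bullet> sgn (T z)) \<le> arccos c"
      using c abs_inner_sgn_le_1[of z "T z"] by (intro arccos_le_arccos) auto
    then show ?thesis by (simp add: vec_angle_def c_def sgn_div_norm u v)
  qed
  show ?thesis by (rule that[OF T Tu ang])
qed

section \<open>Functions that are Lipschitz with respect to the angle\<close>

text \<open>
  Such functions are exactly the \<open>0\<close>-homogeneous extensions of geodesically \<open>1\<close>-Lipschitz functions on
  the unit sphere; the value at the origin is arbitrary.
\<close>

definition angle_lipschitz :: "('a::real_inner \<Rightarrow> real) \<Rightarrow> bool" where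
  "angle_lipschitz F \<longleftrightarrow> (\<forall>x y. x \<noteq> 0 \<longrightarrow> y \<noteq> 0 \<longrightarrow> \<bar>F x - F y\<bar> \<le> vec_angle x y)"

lemma angle_lipschitzD: "angle_lipschitz F \<Longrightarrow> x \<noteq> 0 \<Longrightarrow> y \<noteq> 0 \<Longrightarrow> \<bar>F x - F y\<bar> \<le> vec_angle x y"
  by (simp add: angle_lipschitz_def)

lemma angle_lipschitz_scale:
  assumes "angle_lipschitz F" "c > 0"
  shows "F (c *\<^sub>R x) = F x"
proof (cases "x = 0")
  case False
  then show ?thesis using angle_lipschitzD[OF assms(1), of x "c *\<^sub>R x"] assms(2)
    by (simp add: vec_angle_scale vec_angle_self)
qed simp

lemma angle_lipschitz_perturb:
  assumes "angle_lipschitz F" "x \<noteq> 0" "y \<noteq> 0"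
  shows "\<bar>F y - F x\<bar> \<le> norm (y - x) / norm x + 16 * (norm (y - x) / norm x)\<^sup>2"
  using angle_lipschitzD[OF assms] vec_angle_perturb[OF assms(2,3)] by linarith

lemma angle_lipschitz_bounded:
  fixes F :: "'a::euclidean_space \<Rightarrow> real"
  assumes "angle_lipschitz F"
  obtains B where "B > 0" "\<And>x. \<bar>F x\<bar> \<le> B"
proof -
  obtain e :: 'a where e: "e \<in> Basis" using nonempty_Basis by blast
  have "\<bar>F x\<bar> \<le> \<bar>F 0\<bar> + \<bar>F e\<bar> + pi" for x
  proof (cases "x = 0")
    case False
    then show ?thesis using angle_lipschitzD[OF assms False, of e] vec_angle_le_pi[of x e] nonzero_Basis[OF e] by linarith
  qed simp
  moreover have "\<bar>F 0\<bar> + \<bar>F e\<bar> + pi > 0" using pi_gt_zero by linarith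
  ultimately show ?thesis using that by blast
qed

lemma angle_lipschitz_continuous:
  fixes F :: "'a::real_inner \<Rightarrow> real"
  assumes F: "angle_lipschitz F" and x: "x \<noteq> 0"
  shows "isCont F x"
proof -
  have "((\<lambda>y. F y - F x) \<longlongrightarrow> 0) (at x)"
  proof (rule Lim_null_comparison)
    have "\<forall>\<^sub>F y in at x. y \<noteq> 0"
      using x by (simp add: eventually_at_topological) (metis open_Compl closed_singleton ComplI singletonD ComplD singletonI)
    then show "\<forall>\<^sub>F y in at x. norm (F y - F x) \<le> norm (y - x) / norm x + 16 * (norm (y - x) / norm x)\<^sup>2"
      by eventually_elim (use angle_lipschitz_perturb[OF F x] in auto)
    show "((\<lambda>y. norm (y - x) / norm x + 16 * (norm (y - x) / norm x)\<^sup>2) \<longlongrightarrow> 0) (at x)"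
      by (auto intro!: tendsto_eq_intros simp: x)
  qed
  then show ?thesis by (simp add: isCont_def LIM_zero_iff)
qed

lemma angle_lipschitz_measurable:
  fixes F :: "'a::euclidean_space \<Rightarrow> real"
  assumes F: "angle_lipschitz F"
  shows "F \<in> borel_measurable borel"
  by (rule borel_measurable_continuous_countable_exceptions[of "{0}"])
     (auto intro!: continuous_at_imp_continuous_on angle_lipschitz_continuous[OF F])

section \<open>Mollification on the sphere\<close>

lemma integrable_bounded_support:
  fixes f :: "'a::euclidean_space \<Rightarrow> 'b::euclidean_space"
  assumes "f \<in> borel_measurable borel" "\<And>x. norm (f x) \<le> C * indicator (cball 0 R) x"
  shows "integrable lborel f"
proof (rule integrableI_bounded_set[where A = "cball 0 R" and B = C])
  show "AE x in lborel. x \<in> cball 0 R \<longrightarrow> norm (f x) \<le> C"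
  proof (intro AE_I2 impI)
    fix x :: 'a assume "x \<in> cball 0 R"
    then show "norm (f x) \<le> C" using assms(2)[of x] by simp
  qed
  show "AE x in lborel. x \<notin> cball 0 R \<longrightarrow> f x = 0"
  proof (intro AE_I2 impI)
    fix x :: 'a assume "x \<notin> cball 0 R"
    then show "f x = 0" using assms(2)[of x] by simp
  qed
qed (use assms emeasure_lborel_cball_finite in \<open>auto\<close>)

lemma integral_lborel_translate:
  fixes f :: "'a::euclidean_space \<Rightarrow> 'b::euclidean_space"
  assumes [measurable]: "f \<in> borel_measurable borel"
  shows "(\<integral>x. f (a + x) \<partial>lborel) = (\<integral>x. f x \<partial>lborel)"
proof -
  have "(\<integral>x. f x \<partial>lborel) = (\<integral>x. f x \<partial>distr lborel borel ((+) a))"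
    by (simp add: lborel_distr_plus)
  also have "\<dots> = (\<integral>x. f (a + x) \<partial>lborel)"
    by (subst integral_distr) auto
  finally show ?thesis by simp
qed

lemma distr_lborel_orthogonal:
  fixes T :: "'a::euclidean_space \<Rightarrow> 'a"
  assumes T: "orthogonal_transformation T"
  shows "distr lborel borel T = lborel"
proof (rule measure_eqI)
  note [measurable] = orthogonal_transformation_measurable[OF T]
  fix A :: "'a set" assume "A \<in> sets (distr lborel borel T)"
  then have [measurable]: "A \<in> sets borel" by simp
  have "emeasure (distr lborel borel T) A = (\<integral>\<^sup>+x. indicator A x \<partial>distr lborel borel T)"
    by simp
  also have "\<dots> = (\<integral>\<^sup>+x. indicator A (T x) \<partial>lborel)"
    by (subst nn_integral_distr) auto
  also have "\<dots> = (\<integral>\<^sup>+x. indicator A x \<partial>lborel)"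
    by (rule nn_integral_lborel_orthogonal[OF T]) measurable
  finally show "emeasure (distr lborel borel T) A = emeasure lborel A" by simp
qed simp

lemma integral_lborel_orthogonal:
  fixes f :: "'a::euclidean_space \<Rightarrow> 'b::euclidean_space" and T :: "'a \<Rightarrow> 'a"
  assumes T: "orthogonal_transformation T" and [measurable]: "f \<in> borel_measurable borel"
  shows "(\<integral>x. f (T x) \<partial>lborel) = (\<integral>x. f x \<partial>lborel)"
proof -
  note [measurable] = orthogonal_transformation_measurable[OF T]
  have "(\<integral>x. f x \<partial>lborel) = (\<integral>x. f x \<partial>distr lborel borel T)"
    by (simp add: distr_lborel_orthogonal[OF T])
  also have "\<dots> = (\<integral>x. f (T x) \<partial>lborel)"
    by (subst integral_distr) auto
  finally show ?thesis by simp
qed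

text \<open>
  A radial kernel supported in the ball of radius \<open>e\<close>. Squaring the positive part makes it
  continuously differentiable with a globally quadratic Taylor remainder, which
  is all that differentiation under the integral requires.
\<close>

definition bump :: "real \<Rightarrow> 'a::real_inner \<Rightarrow> real" where
  "bump e u = (max 0 (e\<^sup>2 - u \<bullet> u))\<^sup>2"

lemma bump_nonneg: "bump e u \<ge> 0" by (simp add: bump_def)

lemma measurable_bump [measurable]: "bump e \<in> borel_measurable (borel :: 'a::euclidean_space measure)"
  unfolding bump_def[abs_def] by measurable

lemma bump_eq_0: "norm u \<ge> e \<Longrightarrow> e \<ge> 0 \<Longrightarrow> bump e u = 0"
  using power_mono[of e "norm u" 2] by (simp add: bump_def power2_norm_eq_inner)

lemma bump_le: "bump e u \<le> e ^ 4"
proof -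
  have "(max 0 (e\<^sup>2 - u \<bullet> u))\<^sup>2 \<le> (e\<^sup>2)\<^sup>2" by (rule power_mono) auto
  then show ?thesis by (simp add: bump_def)
qed

lemma bump_orthogonal: "orthogonal_transformation T \<Longrightarrow> bump e (T u) = bump e u"
  by (simp add: bump_def orthogonal_transformation_def)

lemma pos_part_square_taylor:
  fixes p q :: real
  shows "\<bar>(max 0 p)\<^sup>2 - (max 0 q)\<^sup>2 - 2 * max 0 q * (p - q)\<bar> \<le> (p - q)\<^sup>2"
proof (cases "p \<ge> 0"; cases "q \<ge> 0")
  assume "p \<ge> 0" "q \<ge> 0"
  then have "(max 0 p)\<^sup>2 - (max 0 q)\<^sup>2 - 2 * max 0 q * (p - q) = (p - q)\<^sup>2"
    by (simp add: power2_eq_square algebra_simps)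
  then show ?thesis by simp
next
  assume *: "p \<ge> 0" "\<not> q \<ge> 0"
  then have "p\<^sup>2 \<le> (p - q)\<^sup>2" by (intro power_mono) auto
  then show ?thesis using * by simp
next
  assume *: "\<not> p \<ge> 0" "q \<ge> 0"
  have "(max 0 p)\<^sup>2 - (max 0 q)\<^sup>2 - 2 * max 0 q * (p - q) = q * (q - 2 * p)"
    using * by (simp add: power2_eq_square algebra_simps)
  moreover have "(p - q)\<^sup>2 - q * (q - 2 * p) = p\<^sup>2" by (simp add: power2_eq_square algebra_simps)
  moreover have "q * (q - 2 * p) \<ge> 0" using * by auto
  moreover have "p\<^sup>2 \<ge> 0" by simp
  ultimately show ?thesis by linarith
qed auto

lemma bump_taylor:
  fixes u v :: "'a::real_inner"
  assumes e: "0 < e" "e \<le> 1" and v: "norm v \<le> 1"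
  shows "\<bar>bump e (u - v) - bump e u - 4 * max 0 (e\<^sup>2 - u \<bullet> u) * (u \<bullet> v)\<bar>
    \<le> 27 * (norm v)\<^sup>2 * indicator (cball 0 2) u"
proof (cases "norm u \<le> 2")
  case False
  have "norm (u - v) \<ge> e" using norm_triangle_ineq2[of u v] False v e by linarith
  moreover have "norm u \<ge> e" using False e by linarith
  moreover have "max 0 (e\<^sup>2 - u \<bullet> u) = 0" using power_mono[of e "norm u" 2] False e
    by (simp add: power2_norm_eq_inner)
  ultimately show ?thesis using e by (simp add: bump_eq_0)
next
  case True
  define p q where "p = e\<^sup>2 - (u - v) \<bullet> (u - v)" and "q = e\<^sup>2 - u \<bullet> u"
  have pq: "p - q = 2 * (u \<bullet> v) - (norm v)\<^sup>2"
    by (simp add: p_def q_def inner_diff_left inner_diff_right inner_commute power2_norm_eq_inner)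
  have "\<bar>u \<bullet> v\<bar> \<le> norm u * norm v" by (rule Cauchy_Schwarz_ineq2)
  also have "\<dots> \<le> 2 * norm v" using True by (intro mult_right_mono) auto
  finally have uv: "\<bar>u \<bullet> v\<bar> \<le> 2 * norm v" .
  have vv: "(norm v)\<^sup>2 \<le> norm v" using v by (simp add: power2_eq_square mult_left_le)
  \<comment> \<open>On the ball of radius \<open>2\<close> the remainder is \<open>(5 |v|)\<^sup>2\<close> from the Taylor estimate plus \<open>2 |v|\<^sup>2\<close> from the quadratic part of \<open>p - q\<close>.\<close>
  have "\<bar>p - q\<bar> \<le> 5 * norm v" unfolding pq using uv vv zero_le_power2[of "norm v"] by linarith
  then have "\<bar>p - q\<bar>\<^sup>2 \<le> (5 * norm v)\<^sup>2" by (intro power_mono) auto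
  then have 1: "(p - q)\<^sup>2 \<le> 25 * (norm v)\<^sup>2" by (simp add: power_mult_distrib)
  have "e\<^sup>2 \<le> 1" using e by (simp add: power_le_one)
  then have "q \<le> 1" unfolding q_def using inner_ge_zero[of u] by linarith
  then have "max 0 q \<le> 1" by simp
  then have "max 0 q * (norm v)\<^sup>2 \<le> 1 * (norm v)\<^sup>2" by (intro mult_right_mono) auto
  then have 2: "\<bar>2 * max 0 q * (norm v)\<^sup>2\<bar> \<le> 2 * (norm v)\<^sup>2" by (simp add: abs_mult)
  have "bump e (u - v) - bump e u - 4 * max 0 q * (u \<bullet> v)
     = ((max 0 p)\<^sup>2 - (max 0 q)\<^sup>2 - 2 * max 0 q * (p - q)) - 2 * max 0 q * (norm v)\<^sup>2"
    unfolding pq by (simp add: bump_def p_def q_def algebra_simps)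
  then have "\<bar>bump e (u - v) - bump e u - 4 * max 0 q * (u \<bullet> v)\<bar> \<le> 27 * (norm v)\<^sup>2"
    using 1 2 pos_part_square_taylor[of p q] by linarith
  then show ?thesis using True by (simp add: q_def)
qed

definition bump_smoothing :: "real \<Rightarrow> ('a::euclidean_space \<Rightarrow> real) \<Rightarrow> 'a \<Rightarrow> real" where
  "bump_smoothing e F x = (\<integral>u. F (x + u) * bump e u \<partial>lborel) / (\<integral>(u::'a). bump e u \<partial>lborel)"

lemma integrable_mult_bump:
  fixes g :: "'a::euclidean_space \<Rightarrow> real"
  assumes [measurable]: "g \<in> borel_measurable borel" and B: "\<And>x. \<bar>g x\<bar> \<le> B" and e: "e > 0"
  shows "integrable lborel (\<lambda>u. g u * bump e u)"
proof (rule integrable_bounded_support[where C = "B * e ^ 4" and R = e])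
  have "B \<ge> 0" using B[of 0] by linarith
  then show "norm (g u * bump e u) \<le> B * e ^ 4 * indicator (cball 0 e) u" for u
    using B[of u] bump_nonneg[of e u] bump_le[of e u] bump_eq_0[of e u] e
    by (cases "norm u \<le> e") (auto simp: abs_mult intro!: mult_mono)
qed measurable

lemma integral_bump_pos:
  assumes e: "e > 0"
  shows "(\<integral>(u::'a::euclidean_space). bump e u \<partial>lborel) > 0"
proof -
  have int: "integrable lborel (bump e :: 'a \<Rightarrow> real)"
    using integrable_mult_bump[of "\<lambda>_. 1" 1 e] e by simp
  have "(\<integral>(u::'a). bump e u \<partial>lborel) \<noteq> 0"
  proof
    assume "(\<integral>(u::'a). bump e u \<partial>lborel) = 0"
    then have "AE u::'a in lborel. bump e u = 0"
      using integral_nonneg_eq_0_iff_AE[OF int] bump_nonneg by auto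
    moreover have "bump e u \<noteq> 0" if "u \<in> ball 0 e" for u :: 'a
      using that e power_strict_mono[of "norm u" e 2] by (simp add: bump_def power2_norm_eq_inner)
    ultimately have "AE u::'a in lborel. u \<notin> ball 0 e" by (auto elim!: eventually_mono)
    then have "emeasure lborel (ball (0::'a) e) = 0"
      by (subst (asm) AE_iff_measurable[of "ball 0 e"]) auto
    then show False using content_ball_pos[of e "0::'a"] e by (auto simp: measure_def)
  qed
  moreover have "(\<integral>(u::'a). bump e u \<partial>lborel) \<ge> 0" by (intro integral_nonneg_AE AE_I2 bump_nonneg)
  ultimately show ?thesis by linarith
qed

text \<open>
  After a translation the increment \<open>v\<close> appears in the kernel, whose Taylor expansion is then integrated
  against the bounded function \<open>F\<close>.
\<close>

lemma bump_smoothing_differentiable: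
  fixes F :: "'a::euclidean_space \<Rightarrow> real"
  assumes F[measurable]: "F \<in> borel_measurable borel" and B: "\<And>x. \<bar>F x\<bar> \<le> B" and e: "0 < e" "e \<le> 1"
  shows "bump_smoothing e F differentiable (at x)"
proof -
  define K where "K x = (\<integral>u. F (x + u) * bump e u \<partial>lborel)" for x
  have K: "K (x + v) = (\<integral>u. F (x + u) * bump e (u - v) \<partial>lborel)" for v
    using integral_lborel_translate[of "\<lambda>u. F (x + u) * bump e (u - v)" v]
    by (simp add: K_def add.assoc)
  define g where "g u = 4 * max 0 (e\<^sup>2 - u \<bullet> u) * F (x + u)" for u
  have [measurable]: "g \<in> borel_measurable borel" unfolding g_def by measurable
  define W where "W = (\<integral>u. g u *\<^sub>R u \<partial>lborel)"
  have B0: "B \<ge> 0" using B[of 0] by linarith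
  have gW: "integrable lborel (\<lambda>u. g u *\<^sub>R u)"
  proof (rule integrable_bounded_support[where C = "4 * e\<^sup>2 * B * e" and R = e])
    show "norm (g u *\<^sub>R u) \<le> 4 * e\<^sup>2 * B * e * indicator (cball 0 e) u" for u
    proof (cases "norm u \<le> e")
      case True
      have "\<bar>g u\<bar> \<le> 4 * e\<^sup>2 * B" unfolding g_def abs_mult
        using B by (intro mult_mono) auto
      then show ?thesis using True e B0 by (auto intro!: mult_mono)
    next
      case False
      then have "g u = 0" using power_mono[of e "norm u" 2] e by (simp add: g_def power2_norm_eq_inner)
      then show ?thesis using False by simp
    qed
  qed measurable
  have i1: "integrable lborel (\<lambda>u. F (x + u) * bump e (u - v))" for v
  proof (rule integrable_bounded_support[where C = "B * e ^ 4" and R = "e + norm v"])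
    show "norm (F (x + u) * bump e (u - v)) \<le> B * e ^ 4 * indicator (cball 0 (e + norm v)) u" for u
      using B[of "x + u"] bump_nonneg[of e "u - v"] bump_le[of e "u - v"] bump_eq_0[of e "u - v"] e 
        norm_triangle_ineq2[of u v] B0
      by (cases "norm u \<le> e + norm v") (auto simp: abs_mult intro!: mult_mono)
  qed measurable
  define C where "C = 27 * B * measure lborel (cball (0::'a) 2)"
  have rem: "\<bar>K (x + v) - K x - W \<bullet> v\<bar> \<le> C * (norm v)\<^sup>2" if v: "norm v \<le> 1" for v
  proof -
    have i2: "integrable lborel (\<lambda>u. g u * (u \<bullet> v))"
      using integrable_inner_left[of v, OF gW] by simp
    define R where "R u = F (x + u) * bump e (u - v) - F (x + u) * bump e (u - 0) - g u * (u \<bullet> v)" for u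
    have "W \<bullet> v = (\<integral>u. g u * (u \<bullet> v) \<partial>lborel)"
      unfolding W_def using gW by (subst integral_inner_left[symmetric]) auto
    then have "K (x + v) - K x - W \<bullet> v = (\<integral>u. R u \<partial>lborel)"
      using i1[of v] i1[of 0] i2 K[of v] K[of 0] by (simp add: R_def)
    also have "\<bar>\<integral>u. R u \<partial>lborel\<bar> \<le> (\<integral>u. \<bar>R u\<bar> \<partial>lborel)"
      by (rule integral_abs_bound)
    also have "\<dots> \<le> (\<integral>u. B * (27 * (norm v)\<^sup>2) * indicator (cball (0::'a) 2) u \<partial>lborel)"
    proof (rule integral_mono)
      show "integrable lborel (\<lambda>u. B * (27 * (norm v)\<^sup>2) * indicator (cball (0::'a) 2) u)"
        using emeasure_lborel_cball_finite[of "0::'a" 2] by simp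
      show "integrable lborel (\<lambda>u. \<bar>R u\<bar>)"
        using i1[of v] i1[of 0] i2 unfolding R_def by auto
      fix u
      have "R u = F (x + u) * (bump e (u - v) - bump e u - 4 * max 0 (e\<^sup>2 - u \<bullet> u) * (u \<bullet> v))"
        by (simp add: g_def R_def algebra_simps)
      also have "\<bar>\<dots>\<bar> \<le> B * (27 * (norm v)\<^sup>2 * indicator (cball 0 2) u)"
        unfolding abs_mult[of "F (x + u)"]
        by (intro mult_mono B bump_taylor e v B0) auto
      finally show "\<bar>R u\<bar> \<le> B * (27 * (norm v)\<^sup>2) * indicator (cball 0 2) u" by (simp add: mult.assoc)
    qed
    also have "\<dots> = C * (norm v)\<^sup>2" by (simp add: C_def)
    finally show ?thesis .
  qed
  have "(K has_derivative (\<lambda>v. W \<bullet> v)) (at x)"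
  proof (rule has_derivativeI_sandwich[where e = 1 and H = "\<lambda>y. C * norm (y - x)"])
    show "bounded_linear (\<lambda>v. W \<bullet> v)" by (rule bounded_linear_inner_right)
    fix y assume y: "y \<noteq> x" "dist y x < 1"
    show "norm (K y - K x - W \<bullet> (y - x)) / norm (y - x) \<le> C * norm (y - x)"
      using rem[of "y - x"] y by (simp add: dist_norm divide_le_eq power2_eq_square mult.assoc)
  next
    show "((\<lambda>y. C * norm (y - x)) \<longlongrightarrow> 0) (at x)" by (auto intro!: tendsto_eq_intros)
  qed simp
  then have "((\<lambda>x. K x / (\<integral>(u::'a). bump e u \<partial>lborel)) has_derivative (\<lambda>v. (W \<bullet> v) / (\<integral>(u::'a). bump e u \<partial>lborel))) (at x)"
    using integral_bump_pos[OF e(1), where 'a='a] by (auto intro!: derivative_eq_intros)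
  then show ?thesis unfolding bump_smoothing_def[abs_def] K_def differentiable_def by blast
qed

lemma bump_smoothing_diff_le:
  fixes F G :: "'a::euclidean_space \<Rightarrow> real"
  assumes [measurable]: "F \<in> borel_measurable borel" "G \<in> borel_measurable borel"
    and B: "\<And>x. \<bar>F x\<bar> \<le> B" "\<And>x. \<bar>G x\<bar> \<le> B" and e: "0 < e"
    and d: "AE u in lborel. norm u < e \<longrightarrow> \<bar>F u - G u\<bar> \<le> d"
  shows "\<bar>(\<integral>u. F u * bump e u \<partial>lborel) / (\<integral>(u::'a). bump e u \<partial>lborel)
     - (\<integral>u. G u * bump e u \<partial>lborel) / (\<integral>(u::'a). bump e u \<partial>lborel)\<bar> \<le> d"
proof -
  have pos: "(\<integral>(u::'a). bump e u \<partial>lborel) > 0" by (rule integral_bump_pos[OF e])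
  have int: "integrable lborel (\<lambda>u. F u * bump e u)" "integrable lborel (\<lambda>u. G u * bump e u)"
     "integrable lborel (bump e :: 'a \<Rightarrow> real)"
    using integrable_mult_bump[of F B e] integrable_mult_bump[of G B e] integrable_mult_bump[of "\<lambda>_. 1" 1 e] B e by auto
  have "\<bar>(\<integral>u. F u * bump e u \<partial>lborel) - (\<integral>u. G u * bump e u \<partial>lborel)\<bar> = \<bar>\<integral>u. F u * bump e u - G u * bump e u \<partial>lborel\<bar>"
    using int by simp
  also have "\<dots> \<le> (\<integral>(u::'a). d * bump e u \<partial>lborel)"
    unfolding real_norm_def[symmetric]
  proof (rule order_trans[OF integral_norm_bound integral_mono_AE])
    show "AE u in lborel. norm (F u * bump e u - G u * bump e u) \<le> d * bump e u"
      using d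
    proof eventually_elim
      case (elim u)
      have "norm (F u * bump e u - G u * bump e u) = \<bar>F u - G u\<bar> * bump e u"
        using bump_nonneg[of e u] by (simp add: abs_mult flip: left_diff_distrib)
      also have "\<dots> \<le> d * bump e u"
        using elim bump_nonneg[of e u] bump_eq_0[of e u] e by (cases "norm u < e") (auto intro!: mult_right_mono)
      finally show ?case .
    qed
  qed (use int in auto)
  also have "\<dots> = d * (\<integral>(u::'a). bump e u \<partial>lborel)" by simp
  finally show ?thesis using pos by (simp add: pos_divide_le_eq flip: diff_divide_distrib)
qed

text \<open>
  Rotating the integration variable compares \<open>F (u + z)\<close> with \<open>F (T (u + z))\<close> for a rotation \<open>T\<close> that
  takes \<open>u\<close> to \<open>v\<close> and moves every direction by at most the angle between \<open>u\<close> and \<open>v\<close>. For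
  antipodal points any two values of \<open>F\<close> differ by at most \<open>\<pi>\<close>, which is their angle.
\<close>

lemma bump_smoothing_angle_lipschitz:
  fixes F :: "'a::euclidean_space \<Rightarrow> real"
  assumes F: "angle_lipschitz F" and e: "0 < e"
  shows "angle_lipschitz (\<lambda>x. bump_smoothing e F (sgn x))"
  unfolding angle_lipschitz_def
proof (intro allI impI)
  fix x y :: 'a assume xy: "x \<noteq> 0" "y \<noteq> 0"
  define u v where "u = sgn x" and "v = sgn y"
  have u: "norm u = 1" and v: "norm v = 1" using xy by (auto simp: u_def v_def norm_sgn)
  have "sgn u = u" "sgn v = v" using u v by (simp_all add: sgn_div_norm)
  then have uv: "vec_angle u v = vec_angle x y" by (simp add: u_def v_def vec_angle_def)
  obtain B where "B > 0" and B: "\<And>x. \<bar>F x\<bar> \<le> B" using angle_lipschitz_bounded[OF F] by blast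
  note [measurable] = angle_lipschitz_measurable[OF F]
  have ae: "AE z in lborel. a + z \<noteq> 0" for a :: 'a
    using AE_lborel_singleton[of "-a"] by eventually_elim (metis add.inverse_unique)
  show "\<bar>bump_smoothing e F (sgn x) - bump_smoothing e F (sgn y)\<bar> \<le> vec_angle x y"
  proof (cases "u = - v")
    case True
    have "u \<bullet> v = - 1" using v by (simp add: True norm_eq_1)
    then have "vec_angle u v = pi" using u v by (simp add: vec_angle_def sgn_div_norm)
    have "\<bar>bump_smoothing e F u - bump_smoothing e F v\<bar> \<le> pi"
      unfolding bump_smoothing_def
    proof (rule bump_smoothing_diff_le[OF _ _ B B e])
      show "AE z in lborel. norm z < e \<longrightarrow> \<bar>F (u + z) - F (v + z)\<bar> \<le> pi"
        using ae[of u] ae[of v] by eventually_elim (meson F angle_lipschitzD order_trans vec_angle_le_pi)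
    qed measurable
    then show ?thesis using uv \<open>vec_angle u v = pi\<close> by (simp add: u_def v_def)
  next
    case False
    obtain T where T: "orthogonal_transformation T" "T u = v" and ang: "\<And>z. z \<noteq> 0 \<Longrightarrow> vec_angle z (T z) \<le> vec_angle u v"
      using rotation_with_controlled_angle[OF u v False] by blast
    note [measurable] = orthogonal_transformation_measurable[OF T(1)]
    have lin: "linear T" using T(1) by (simp add: orthogonal_transformation_def)
    have "bump_smoothing e F v = (\<integral>z. F (T (u + z)) * bump e z \<partial>lborel) / (\<integral>(u::'a). bump e u \<partial>lborel)"
      using integral_lborel_orthogonal[OF T(1), of "\<lambda>z. F (v + z) * bump e z"]
      by (simp add: bump_smoothing_def bump_orthogonal[OF T(1)] linear_add[OF lin] T(2))
    moreover have "\<bar>(\<integral>z. F (u + z) * bump e z \<partial>lborel) / (\<integral>(u::'a). bump e u \<partial>lborel)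
        - (\<integral>z. F (T (u + z)) * bump e z \<partial>lborel) / (\<integral>(u::'a). bump e u \<partial>lborel)\<bar> \<le> vec_angle u v"
    proof (rule bump_smoothing_diff_le[OF _ _ B B e])
      show "AE z in lborel. norm z < e \<longrightarrow> \<bar>F (u + z) - F (T (u + z))\<bar> \<le> vec_angle u v"
        using ae[of u]
      proof eventually_elim
        case (elim z)
        have "T (u + z) \<noteq> 0" using elim orthogonal_transformation_norm[OF T(1), of "u + z"] by auto
        then show ?case using angle_lipschitzD[OF F elim, of "T (u + z)"] ang[OF elim] by linarith
      qed
    qed measurable
    ultimately have "\<bar>bump_smoothing e F u - bump_smoothing e F v\<bar> \<le> vec_angle u v"
      by (simp only: bump_smoothing_def)
    then show ?thesis using uv by (simp add: u_def v_def)
  qed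
qed

lemma angle_lipschitz_smooth_approximation:
  fixes F :: "'a::euclidean_space \<Rightarrow> real"
  assumes F: "angle_lipschitz F"
  obtains G :: "nat \<Rightarrow> 'a \<Rightarrow> real" where
    "\<And>k. angle_lipschitz (G k)" "\<And>k x. x \<noteq> 0 \<Longrightarrow> G k differentiable (at x)"
    "\<And>x. x \<noteq> 0 \<Longrightarrow> (\<lambda>k. G k x) \<longlonglongrightarrow> F x"
proof -
  obtain B where "B > 0" and B: "\<And>x. \<bar>F x\<bar> \<le> B" using angle_lipschitz_bounded[OF F] by blast
  note [measurable] = angle_lipschitz_measurable[OF F]
  define e where "e k = 1 / (real k + 2)" for k
  have e: "0 < e k" "e k < 1" for k by (auto simp: e_def)
  define G where "G k x = bump_smoothing (e k) F (sgn x)" for k and x :: 'a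
  have 1: "angle_lipschitz (G k)" for k
    unfolding G_def using e by (intro bump_smoothing_angle_lipschitz F)
  have 2: "G k differentiable (at x)" if "x \<noteq> 0" for k x
  proof -
    have "(\<lambda>x. inverse (norm x) *\<^sub>R x) differentiable (at x)" 
      using that by (intro differentiable_scaleR differentiable_inverse differentiable_norm_at differentiable_ident) auto
    then have "sgn differentiable (at x)" by (simp add: sgn_div_norm[abs_def])
    moreover have "bump_smoothing (e k) F differentiable (at (sgn x))"
      using e[of k] by (intro bump_smoothing_differentiable[where B=B] B) auto
    ultimately show ?thesis unfolding G_def
      using differentiable_chain_at[of sgn x "bump_smoothing (e k) F"] by (simp add: o_def)
  qed
  have 3: "(\<lambda>k. G k x) \<longlonglongrightarrow> F x" if x: "x \<noteq> 0" for x
  proof -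
    define u where "u = sgn x"
    have u: "norm u = 1" using x by (simp add: u_def norm_sgn)
    have "F u = F x" using angle_lipschitz_scale[OF F, of "inverse (norm x)" x] x by (simp add: u_def sgn_div_norm)
    have b: "\<bar>G k x - F x\<bar> \<le> e k + 16 * (e k)\<^sup>2" for k
    proof -
      have "\<bar>(\<integral>z. F (u + z) * bump (e k) z \<partial>lborel) / (\<integral>(u::'a). bump (e k) u \<partial>lborel)
         - (\<integral>(z::'a). F u * bump (e k) z \<partial>lborel) / (\<integral>(u::'a). bump (e k) u \<partial>lborel)\<bar> \<le> e k + 16 * (e k)\<^sup>2"
      proof (rule bump_smoothing_diff_le[where B = B])
        have "\<bar>F (u + z) - F u\<bar> \<le> e k + 16 * (e k)\<^sup>2" if z: "norm z < e k" for z
        proof -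
          have "u + z \<noteq> 0"
          proof
            assume "u + z = 0"
            then have "norm u = norm z" by (metis add_eq_0_iff norm_minus_cancel)
            then show False using z u e[of k] by simp
          qed
          moreover have "u \<noteq> 0" using u by auto
          ultimately have "\<bar>F (u + z) - F u\<bar> \<le> norm z + 16 * (norm z)\<^sup>2"
            using angle_lipschitz_perturb[OF F, of u "u + z"] u by simp
          also have "\<dots> \<le> e k + 16 * (e k)\<^sup>2" using z by (intro add_mono mult_left_mono power_mono) auto
          finally show ?thesis .
        qed
        then show "AE z in lborel. norm z < e k \<longrightarrow> \<bar>F (u + z) - F u\<bar> \<le> e k + 16 * (e k)\<^sup>2" by simp
      qed (use B e in auto)
      moreover have "(\<integral>(z::'a). F u * bump (e k) z \<partial>lborel) / (\<integral>(u::'a). bump (e k) u \<partial>lborel) = F u"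
        using integral_bump_pos[OF e(1), where 'a='a, of k] by simp
      ultimately show ?thesis using \<open>F u = F x\<close> by (simp add: G_def bump_smoothing_def u_def)
    qed
    have "(\<lambda>k. G k x - F x) \<longlonglongrightarrow> 0"
    proof (rule Lim_null_comparison)
      show "(\<lambda>k. e k + 16 * (e k)\<^sup>2) \<longlonglongrightarrow> 0" unfolding e_def by real_asymp
    qed (use b in auto)
    then show ?thesis by (simp add: LIM_zero_iff)
  qed
  show ?thesis by (rule that[OF 1 2 3])
qed

section \<open>Decoupling directions and norms of Gaussian pairs\<close>

lemma nn_integral_std_gaussian_rotate:
  fixes f :: "'a::euclidean_space \<Rightarrow> 'a \<Rightarrow> ennreal" and c s :: real
  assumes [measurable]: "case_prod f \<in> borel_measurable (borel \<Otimes>\<^sub>M borel)" and cs: "c\<^sup>2 + s\<^sup>2 = 1"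
  shows "(\<integral>\<^sup>+x. \<integral>\<^sup>+y. f (c *\<^sub>R x - s *\<^sub>R y) (s *\<^sub>R x + c *\<^sub>R y) \<partial>std_gaussian \<partial>std_gaussian)
    = (\<integral>\<^sup>+x. \<integral>\<^sup>+y. f x y \<partial>std_gaussian \<partial>std_gaussian)"
proof -
  let ?P = "(std_gaussian :: 'a measure) \<Otimes>\<^sub>M (std_gaussian :: 'a measure)"
  let ?T = "\<lambda>(x::'a, y). (c *\<^sub>R x - s *\<^sub>R y, s *\<^sub>R x + c *\<^sub>R y)"
  have "(\<integral>\<^sup>+x. \<integral>\<^sup>+y. f x y \<partial>std_gaussian \<partial>std_gaussian) = (\<integral>\<^sup>+p. case_prod f p \<partial>?P)"
    by (subst std_gaussian.nn_integral_fst[symmetric]) auto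
  also have "\<dots> = (\<integral>\<^sup>+p. case_prod f p \<partial>distr ?P borel ?T)"
    by (simp only: distr_std_gaussian_rotate[OF cs])
  also have "\<dots> = (\<integral>\<^sup>+p. case_prod f (?T p) \<partial>?P)"
    by (intro nn_integral_distr) (auto simp: borel_prod[symmetric])
  also have "\<dots> = (\<integral>\<^sup>+x. \<integral>\<^sup>+y. f (c *\<^sub>R x - s *\<^sub>R y) (s *\<^sub>R x + c *\<^sub>R y) \<partial>std_gaussian \<partial>std_gaussian)"
    by (subst std_gaussian.nn_integral_fst[symmetric]) auto
  finally show ?thesis by simp
qed

lemma nn_integral_std_gaussian_orthogonal:
  fixes f :: "'a::euclidean_space \<Rightarrow> ennreal" and T :: "'a \<Rightarrow> 'a"
  assumes T: "orthogonal_transformation T" and [measurable]: "f \<in> borel_measurable borel"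
  shows "(\<integral>\<^sup>+x. f (T x) \<partial>std_gaussian) = (\<integral>\<^sup>+x. f x \<partial>std_gaussian)"
proof -
  note [measurable] = orthogonal_transformation_measurable[OF T]
  have "(\<integral>\<^sup>+x. f x \<partial>std_gaussian) = (\<integral>\<^sup>+x. f x \<partial>distr std_gaussian borel T)"
    by (simp add: distr_std_gaussian_orthogonal[OF T])
  also have "\<dots> = (\<integral>\<^sup>+x. f (T x) \<partial>std_gaussian)"
    by (subst nn_integral_distr) auto
  finally show ?thesis by simp
qed

text \<open>
  The inner integral is invariant under orthogonal transformations of \<open>a\<close>, hence a function of \<open>|a|\<close>,
  and so independent of the direction of \<open>a\<close>, on which alone \<open>h\<close> depends. What remains is \<open>E [1 / (|X| |X'|)]\<close>
  for two standard Gaussian vectors, at most \<open>E |X|\<^sup>-\<^sup>2\<close> by the arithmetic-geometric mean inequality.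
\<close>

lemma nn_integral_gaussian_homogeneous_decouple:
  fixes h :: "'a::euclidean_space \<Rightarrow> ennreal"
  assumes n: "DIM('a) \<ge> 3" and h[measurable]: "h \<in> borel_measurable borel"
    and hom: "\<And>x c. c > 0 \<Longrightarrow> h (c *\<^sub>R x) = h x" and fin: "\<And>x. h x \<le> ennreal C"
    and cs: "c\<^sup>2 + s\<^sup>2 = 1"
  shows "(\<integral>\<^sup>+a. h a * ennreal (1 / norm a) * (\<integral>\<^sup>+b. ennreal (1 / norm (c *\<^sub>R a - s *\<^sub>R b)) \<partial>std_gaussian) \<partial>std_gaussian)
    \<le> (\<integral>\<^sup>+a. h a \<partial>std_gaussian) * ennreal (1 / (real DIM('a) - 2))"
proof -
  define r where "r a = (\<integral>\<^sup>+b. ennreal (1 / norm (c *\<^sub>R a - s *\<^sub>R b)) \<partial>std_gaussian)" for a :: 'a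
  have [measurable]: "r \<in> borel_measurable borel" unfolding r_def by measurable
  have rT: "r (T a) = r a" if T: "orthogonal_transformation T" for T a
  proof -
    have lin: "linear T" using T by (simp add: orthogonal_transformation_def)
    have "c *\<^sub>R T a - s *\<^sub>R T b = T (c *\<^sub>R a - s *\<^sub>R b)" for b
      using lin by (simp add: linear_diff linear_cmul)
    then have "norm (c *\<^sub>R T a - s *\<^sub>R T b) = norm (c *\<^sub>R a - s *\<^sub>R b)" for b
      using orthogonal_transformation_norm[OF T] by simp
    then show ?thesis
      using nn_integral_std_gaussian_orthogonal[OF T, of "\<lambda>b. ennreal (1 / norm (c *\<^sub>R T a - s *\<^sub>R b))"]
      by (simp add: r_def)
  qed
  obtain e :: 'a where e: "e \<in> Basis" using nonempty_Basis by blast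
  have re: "r (norm a *\<^sub>R e) = r a" for a
  proof -
    have "norm a = norm (norm a *\<^sub>R e)" using e by simp
    from hyperplane_reflection_swap[OF this] show ?thesis
      using rT[OF orthogonal_transformation_hyperplane_reflection, of "a - norm a *\<^sub>R e" a] by simp
  qed
  define K where "K = ennreal (1 / (real DIM('a) - 2))"
  have inv2: "(\<integral>\<^sup>+(x::'a). ennreal (1 / (norm x)\<^sup>2) \<partial>std_gaussian) = K"
    using nn_integral_std_gaussian_inverse_square[OF n] by (simp add: K_def)
  have "(\<integral>\<^sup>+a. h a * ennreal (1 / norm a) * r a \<partial>std_gaussian)
     = (\<integral>\<^sup>+a. h a * (\<lambda>t. ennreal (1 / t) * r (t *\<^sub>R e)) (norm a) \<partial>std_gaussian)"
    by (simp add: re mult.assoc)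
  also have "\<dots> = (\<integral>\<^sup>+a. h a \<partial>std_gaussian) * (\<integral>\<^sup>+a. (\<lambda>t. ennreal (1 / t) * r (t *\<^sub>R e)) (norm (a::'a)) \<partial>std_gaussian)"
    by (rule nn_integral_std_gaussian_polar(1)[OF h _ hom fin]) measurable
  also have "(\<integral>\<^sup>+a. (\<lambda>t. ennreal (1 / t) * r (t *\<^sub>R e)) (norm (a::'a)) \<partial>std_gaussian) = (\<integral>\<^sup>+a. ennreal (1 / norm a) * r a \<partial>std_gaussian)"
    by (simp add: re)
  also have "\<dots> = (\<integral>\<^sup>+a. \<integral>\<^sup>+b. ennreal (1 / norm (a::'a)) * ennreal (1 / norm (c *\<^sub>R a - s *\<^sub>R b)) \<partial>std_gaussian \<partial>std_gaussian)"
    unfolding r_def by (subst nn_integral_cmult) auto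
  also have "\<dots> \<le> (\<integral>\<^sup>+a. \<integral>\<^sup>+b. (ennreal (1/2) * ennreal (1 / (norm (a::'a))\<^sup>2) + ennreal (1/2) * ennreal (1 / (norm (c *\<^sub>R a - s *\<^sub>R b))\<^sup>2)) \<partial>std_gaussian \<partial>std_gaussian)"
  proof (intro nn_integral_mono)
    fix a b :: 'a
    define p q where "p = 1 / norm a" and "q = 1 / norm (c *\<^sub>R a - s *\<^sub>R b)"
    have pq: "p * q \<le> 1/2 * p\<^sup>2 + 1/2 * q\<^sup>2" using zero_le_power2[of "p - q"] by (simp add: power2_diff algebra_simps power2_eq_square)
    have "p \<ge> 0" "q \<ge> 0" by (auto simp: p_def q_def)
    then have "ennreal p * ennreal q = ennreal (p * q)"
      by (intro ennreal_mult[symmetric])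
    also have "\<dots> \<le> ennreal (1/2 * p\<^sup>2 + 1/2 * q\<^sup>2)"
      by (rule ennreal_leI[OF pq])
    also have "\<dots> = ennreal (1/2 * p\<^sup>2) + ennreal (1/2 * q\<^sup>2)"
      by (rule ennreal_plus) auto
    also have "\<dots> = ennreal (1/2) * ennreal (p\<^sup>2) + ennreal (1/2) * ennreal (q\<^sup>2)"
      by (simp only: ennreal_mult'' zero_le_power2)
    finally have "ennreal p * ennreal q \<le> ennreal (1/2) * ennreal (p\<^sup>2) + ennreal (1/2) * ennreal (q\<^sup>2)" .
    then show "ennreal (1 / norm (a::'a)) * ennreal (1 / norm (c *\<^sub>R a - s *\<^sub>R b))
      \<le> ennreal (1/2) * ennreal (1 / (norm (a::'a))\<^sup>2) + ennreal (1/2) * ennreal (1 / (norm (c *\<^sub>R a - s *\<^sub>R b))\<^sup>2)"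
      by (simp only: p_def q_def power_divide power_one)
  qed
  also have "\<dots> = (\<integral>\<^sup>+a. ennreal (1/2) * ennreal (1 / (norm (a::'a))\<^sup>2) \<partial>std_gaussian) + (\<integral>\<^sup>+a. \<integral>\<^sup>+b. ennreal (1/2) * ennreal (1 / (norm (c *\<^sub>R (a::'a) - s *\<^sub>R b))\<^sup>2) \<partial>std_gaussian \<partial>std_gaussian)"
  proof -
    have "(\<integral>\<^sup>+b. (ennreal (1/2) * ennreal (1 / (norm a)\<^sup>2) + ennreal (1/2) * ennreal (1 / (norm (c *\<^sub>R a - s *\<^sub>R b))\<^sup>2)) \<partial>std_gaussian)
       = ennreal (1/2) * ennreal (1 / (norm a)\<^sup>2) + (\<integral>\<^sup>+b. ennreal (1/2) * ennreal (1 / (norm (c *\<^sub>R a - s *\<^sub>R b))\<^sup>2) \<partial>std_gaussian)" for a :: 'a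
      by (subst nn_integral_add) simp_all
    then show ?thesis by (simp only:) (rule nn_integral_add; measurable)
  qed
  also have "(\<integral>\<^sup>+a. \<integral>\<^sup>+b. ennreal (1/2) * ennreal (1 / (norm (c *\<^sub>R (a::'a) - s *\<^sub>R b))\<^sup>2) \<partial>std_gaussian \<partial>std_gaussian)
     = (\<integral>\<^sup>+a. \<integral>\<^sup>+(b::'a). ennreal (1/2) * ennreal (1 / (norm (a::'a))\<^sup>2) \<partial>std_gaussian \<partial>std_gaussian)"
    by (rule nn_integral_std_gaussian_rotate[OF _ cs, of "\<lambda>a b. ennreal (1/2) * ennreal (1 / (norm a)\<^sup>2)"]) measurable
  also have "(\<integral>\<^sup>+a. ennreal (1/2) * ennreal (1 / (norm (a::'a))\<^sup>2) \<partial>std_gaussian) = ennreal (1/2) * K"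
    unfolding inv2[symmetric] by (rule nn_integral_cmult) measurable
  also have "(\<integral>\<^sup>+a. \<integral>\<^sup>+(b::'a). ennreal (1/2) * ennreal (1 / (norm (a::'a))\<^sup>2) \<partial>std_gaussian \<partial>std_gaussian) = ennreal (1/2) * K"
    unfolding inv2[symmetric] by (subst nn_integral_cmult[symmetric]) auto
  also have "ennreal (1/2) * K + ennreal (1/2) * K = K"
    unfolding distrib_right[symmetric] by (subst ennreal_plus[symmetric]) auto
  finally show ?thesis
    unfolding r_def K_def by (simp add: mult_left_mono)
qed

section \<open>Gaussian integration by parts\<close>

text \<open>
  Any factor below \<open>1/2\<close> would do; \<open>3/8\<close> leaves \<open>exp (- |x|\<^sup>2 / 8)\<close>, the Gaussian density stretched by
  \<open>2\<close>. Up to a constant, this one majorant dominates every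
  polynomial and every exponential of the norm.
\<close>

lemma integrable_std_gaussian_exp_square:
  "integrable std_gaussian (\<lambda>x::'a::euclidean_space. exp (3 * (norm x)\<^sup>2 / 8))"
proof (rule integrableI_nonneg)
  define Z where "Z = sqrt (2 * pi) ^ DIM('a)"
  have "(\<integral>\<^sup>+(x::'a). ennreal (exp (3 * (norm x)\<^sup>2 / 8)) \<partial>std_gaussian) = (\<integral>\<^sup>+(x::'a). ennreal (exp (- (norm x)\<^sup>2 / 8) / Z) \<partial>lborel)"
  proof (subst nn_integral_std_gaussian)
    have "exp (- (norm x)\<^sup>2 / 2) / Z * exp (3 * (norm x)\<^sup>2 / 8) = exp (- (norm x)\<^sup>2 / 8) / Z" for x :: 'a
      by (simp add: exp_add[symmetric])
    then show "(\<integral>\<^sup>+(x::'a). ennreal (exp (- (norm x)\<^sup>2 / 2) / sqrt (2 * pi) ^ DIM('a)) * ennreal (exp (3 * (norm x)\<^sup>2 / 8)) \<partial>lborel)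
      = (\<integral>\<^sup>+(x::'a). ennreal (exp (- (norm x)\<^sup>2 / 8) / Z) \<partial>lborel)"
      unfolding Z_def[symmetric] by (intro nn_integral_cong) (simp only: ennreal_mult'[symmetric] exp_ge_zero ennreal_mult''[symmetric])
  qed measurable
  also have "\<dots> = ennreal (2 ^ DIM('a)) * (\<integral>\<^sup>+(x::'a). ennreal (exp (- (norm (2 *\<^sub>R x))\<^sup>2 / 8) / Z) \<partial>lborel)"
    by (rule nn_integral_lborel_scale) auto
  also have "(\<integral>\<^sup>+(x::'a). ennreal (exp (- (norm (2 *\<^sub>R x))\<^sup>2 / 8) / Z) \<partial>lborel) = (\<integral>\<^sup>+(x::'a). 1 \<partial>std_gaussian)"
    by (subst nn_integral_std_gaussian) (auto simp: Z_def power_mult_distrib)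
  finally show "(\<integral>\<^sup>+(x::'a). ennreal (exp (3 * (norm x)\<^sup>2 / 8)) \<partial>std_gaussian) < \<infinity>"
    by (simp add: less_top[symmetric])
qed auto

lemma integral_std_gaussian:
  fixes f :: "'a::euclidean_space \<Rightarrow> real"
  assumes [measurable]: "f \<in> borel_measurable borel"
  shows "(\<integral>x. f x \<partial>std_gaussian) = (\<integral>x. exp (- (norm x)\<^sup>2 / 2) / sqrt (2 * pi) ^ DIM('a) * f x \<partial>lborel)"
  unfolding std_gaussian_def by (subst integral_density) auto

text \<open>
  The Cameron-Martin formula.
\<close>

lemma integral_std_gaussian_translate:
  fixes f :: "'a::euclidean_space \<Rightarrow> real"
  assumes [measurable]: "f \<in> borel_measurable borel"
  shows "(\<integral>x. f (x + v) \<partial>std_gaussian) = (\<integral>x. f x * exp (v \<bullet> x - (norm v)\<^sup>2 / 2) \<partial>std_gaussian)"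
proof -
  define Z where "Z = sqrt (2 * pi) ^ DIM('a)"
  have "(\<integral>x. f (x + v) \<partial>std_gaussian) = (\<integral>x. exp (- (norm x)\<^sup>2 / 2) / Z * f (x + v) \<partial>lborel)"
    unfolding Z_def by (rule integral_std_gaussian) measurable
  also have "\<dots> = (\<integral>x. exp (- (norm (x - v))\<^sup>2 / 2) / Z * f x \<partial>lborel)"
    using integral_lborel_translate[of "\<lambda>x. exp (- (norm (x - v))\<^sup>2 / 2) / Z * f x" v]
    by (simp add: add.commute)
  also have "\<dots> = (\<integral>x. exp (- (norm x)\<^sup>2 / 2) / Z * (f x * exp (v \<bullet> x - (norm v)\<^sup>2 / 2)) \<partial>lborel)"
  proof (rule Bochner_Integration.integral_cong[OF refl])
    fix x
    have "- (norm (x - v))\<^sup>2 / 2 = - (norm x)\<^sup>2 / 2 + (v \<bullet> x - (norm v)\<^sup>2 / 2)"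
      by (simp add: power2_norm_eq_inner inner_diff_left inner_diff_right inner_commute field_simps)
    then show "exp (- (norm (x - v))\<^sup>2 / 2) / Z * f x = exp (- (norm x)\<^sup>2 / 2) / Z * (f x * exp (v \<bullet> x - (norm v)\<^sup>2 / 2))"
      by (simp only: exp_add) simp
  qed
  also have "\<dots> = (\<integral>x. f x * exp (v \<bullet> x - (norm v)\<^sup>2 / 2) \<partial>std_gaussian)"
    unfolding Z_def by (rule integral_std_gaussian[symmetric]) measurable
  finally show ?thesis .
qed

lemma exp_minus_one_abs_le: "\<bar>exp y - 1\<bar> \<le> \<bar>y\<bar> * exp \<bar>y\<bar>" for y :: real
proof (cases "y \<ge> 0")
  case True
  have "1 - y \<le> exp (- y)" using exp_ge_add_one_self[of "- y"] by simp
  then have "(1 - y) * exp y \<le> exp (- y) * exp y" by (intro mult_right_mono) auto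
  also have "exp (- y) * exp y = 1" by (simp flip: exp_add)
  finally show ?thesis using True by (simp add: algebra_simps)
next
  case False
  have "1 + y \<le> exp y" by (rule exp_ge_add_one_self)
  moreover have "exp y \<le> 1" using False by simp
  moreover have "\<bar>y\<bar> * 1 \<le> \<bar>y\<bar> * exp \<bar>y\<bar>" by (intro mult_left_mono) auto
  ultimately show ?thesis using False by linarith
qed

text \<open>
  For smooth \<open>F\<close>, Gaussian integration by parts turns \<open>E F(a - s B) \<langle>v, B\<rangle>\<close> into
  \<open>- s E \<langle>\<nabla>F(a - s B), v\<rangle>\<close>, and \<open>|\<nabla>F(x)| \<le> 1 / |x|\<close>. Differentiability is avoided by differentiating the
  Cameron-Martin formula along \<open>v\<close> instead: on one side the density is differentiated, on the other side
  the Lipschitz property bounds the difference quotients of \<open>F\<close>. The finiteness assumption holds for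
  almost every \<open>a\<close> and makes the quadratic error in the angle estimate vanish in the limit.
\<close>

lemma gaussian_integration_by_parts_bound:
  fixes F :: "'a::euclidean_space \<Rightarrow> real"
  assumes F: "angle_lipschitz F" and s: "s > 0"
    and fin: "(\<integral>\<^sup>+b. ennreal (1 / (norm (a - s *\<^sub>R b))\<^sup>2) \<partial>std_gaussian) < \<infinity>"
  shows "ennreal \<bar>\<integral>b. F (a - s *\<^sub>R b) * (v \<bullet> b) \<partial>std_gaussian\<bar>
    \<le> ennreal (s * norm v) * (\<integral>\<^sup>+b. ennreal (1 / norm (a - s *\<^sub>R b)) \<partial>std_gaussian)"
proof -
  obtain B where B0: "B > 0" and B: "\<And>x. \<bar>F x\<bar> \<le> B" using angle_lipschitz_bounded[OF F] by blast
  note [measurable] = angle_lipschitz_measurable[OF F]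
  define P where "P b = F (a - s *\<^sub>R b)" for b
  have [measurable]: "P \<in> borel_measurable borel" unfolding P_def by measurable
  have PB: "\<bar>P b\<bar> \<le> B" for b unfolding P_def by (rule B)
  have int2: "integrable std_gaussian (\<lambda>b. 1 / (norm (a - s *\<^sub>R b))\<^sup>2)"
    by (rule integrableI_nonneg) (use fin in auto)
  have int1: "integrable std_gaussian (\<lambda>b. 1 / norm (a - s *\<^sub>R b))"
  proof (rule Bochner_Integration.integrable_bound)
    show "integrable std_gaussian (\<lambda>b. 1 + 1 / (norm (a - s *\<^sub>R b))\<^sup>2)"
      using int2 by simp
    have "q \<le> 1 + q\<^sup>2" for q :: real using zero_le_power2[of "q - 1/2"] by (simp add: power2_eq_square algebra_simps)
    from this[of "1 / norm (a - s *\<^sub>R b)" for b] show "AE b in std_gaussian. norm (1 / norm (a - s *\<^sub>R b)) \<le> norm (1 + 1 / (norm (a - s *\<^sub>R b))\<^sup>2)"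
      by (simp add: power_divide)
  qed measurable
  define J1 J2 where "J1 = (\<integral>b. 1 / norm (a - s *\<^sub>R b) \<partial>std_gaussian)" and "J2 = (\<integral>b. 1 / (norm (a - s *\<^sub>R b))\<^sup>2 \<partial>std_gaussian)"
  define h where "h k = 1 / real (Suc k)" for k
  have h: "h k > 0" "h k \<le> 1" for k by (auto simp: h_def)
  have h0: "h \<longlonglongrightarrow> 0" unfolding h_def by real_asymp
  define Q where "Q k = (\<integral>b. P b * ((exp ((h k *\<^sub>R v) \<bullet> b - (norm (h k *\<^sub>R v))\<^sup>2 / 2) - 1) / h k) \<partial>std_gaussian)" for k
  have dom: "\<bar>(exp ((h k *\<^sub>R v) \<bullet> b - (norm (h k *\<^sub>R v))\<^sup>2 / 2) - 1) / h k\<bar> \<le> exp (4 * (norm v)\<^sup>2) * exp (3 * (norm b)\<^sup>2 / 8)" for k b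
  proof -
    define y where "y = (h k *\<^sub>R v) \<bullet> b - (norm (h k *\<^sub>R v))\<^sup>2 / 2"
    define Y where "Y = norm v * norm b + (norm v)\<^sup>2 / 2"
    have Y0: "Y \<ge> 0" by (simp add: Y_def)
    have "\<bar>(h k *\<^sub>R v) \<bullet> b\<bar> \<le> h k * (norm v * norm b)"
      using Cauchy_Schwarz_ineq2[of v b] h[of k] by (simp add: abs_mult)
    moreover have "(norm (h k *\<^sub>R v))\<^sup>2 \<le> h k * (norm v)\<^sup>2"
      using h[of k] by (simp add: power_mult_distrib power2_eq_square[of "h k"] mult_left_le mult_right_mono)
    moreover have "0 \<le> (norm (h k *\<^sub>R v))\<^sup>2" by simp
    ultimately have yY: "\<bar>y\<bar> \<le> h k * Y" unfolding y_def Y_def distrib_left by linarith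
    also have "h k * Y \<le> Y" using h[of k] Y0 by (simp add: mult_left_le_one_le)
    finally have yY': "\<bar>y\<bar> \<le> Y" .
    have "\<bar>exp y - 1\<bar> \<le> \<bar>y\<bar> * exp \<bar>y\<bar>" by (rule exp_minus_one_abs_le)
    also have "\<dots> \<le> (h k * Y) * exp Y" using yY yY' Y0 h[of k] by (intro mult_mono) auto
    also have "\<dots> \<le> (h k * exp Y) * exp Y"
    proof -
      have "Y \<le> exp Y" using exp_ge_add_one_self[of Y] by linarith
      then show ?thesis using h[of k] by (intro mult_right_mono mult_left_mono) auto
    qed
    also have "\<dots> = h k * exp (2 * Y)" by (simp add: exp_double power2_eq_square)
    also have "\<dots> \<le> h k * exp (4 * (norm v)\<^sup>2 + 3 * (norm b)\<^sup>2 / 8)"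
    proof -
      \<comment> \<open>Young inequality, weighted to produce the exponent \<open>3 |b|\<^sup>2 / 8\<close>.\<close>
      have "0 \<le> (4 * norm v - (3/2) * norm b)\<^sup>2" by simp
      then have "12 * (norm v * norm b) \<le> 16 * (norm v)\<^sup>2 + (9/4) * (norm b)\<^sup>2"
        by (simp add: power2_diff power_mult_distrib power_divide mult.commute)
      then have "2 * Y \<le> 4 * (norm v)\<^sup>2 + 3 * (norm b)\<^sup>2 / 8" using zero_le_power2[of "norm v"] unfolding Y_def distrib_left by linarith
      then show ?thesis using h[of k] by (intro mult_left_mono) auto
    qed
    finally have "\<bar>(exp y - 1) / h k\<bar> \<le> exp (4 * (norm v)\<^sup>2) * exp (3 * (norm b)\<^sup>2 / 8)"
      using h(1)[of k] by (simp add: exp_add divide_le_eq mult_ac)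
    then show ?thesis by (simp only: y_def)
  qed
  have lim: "Q \<longlonglongrightarrow> (\<integral>b. P b * (v \<bullet> b) \<partial>std_gaussian)"
    unfolding Q_def
  proof (rule integral_dominated_convergence)
    show "integrable std_gaussian (\<lambda>b::'a. B * (exp (4 * (norm v)\<^sup>2) * exp (3 * (norm b)\<^sup>2 / 8)))"
      by (intro integrable_mult_right integrable_std_gaussian_exp_square)
    show "AE b in std_gaussian. norm (P b * ((exp ((h k *\<^sub>R v) \<bullet> b - (norm (h k *\<^sub>R v))\<^sup>2 / 2) - 1) / h k))
       \<le> B * (exp (4 * (norm v)\<^sup>2) * exp (3 * (norm b)\<^sup>2 / 8))" for k
      unfolding real_norm_def abs_mult[of "P _"] using PB dom B0 by (intro AE_I2 mult_mono) auto
    show "AE b in std_gaussian. (\<lambda>k. P b * ((exp ((h k *\<^sub>R v) \<bullet> b - (norm (h k *\<^sub>R v))\<^sup>2 / 2) - 1) / h k)) \<longlonglongrightarrow> P b * (v \<bullet> b)"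
    proof (intro AE_I2 tendsto_mult tendsto_const)
      fix b :: 'a
      have D: "((\<lambda>t. exp (t * (v \<bullet> b) - t\<^sup>2 * (norm v)\<^sup>2 / 2)) has_real_derivative v \<bullet> b) (at 0)"
        by (auto intro!: derivative_eq_intros)
      have "filterlim h (at 0) sequentially"
        using h0 h by (auto simp: filterlim_at intro!: always_eventually) (metis less_irrefl)
      then have "(\<lambda>k. (exp (h k * (v \<bullet> b) - (h k)\<^sup>2 * (norm v)\<^sup>2 / 2) - 1) / h k) \<longlonglongrightarrow> v \<bullet> b"
        using filterlim_compose[OF D[unfolded DERIV_def], of h sequentially] by simp
      then show "(\<lambda>k. (exp ((h k *\<^sub>R v) \<bullet> b - (norm (h k *\<^sub>R v))\<^sup>2 / 2) - 1) / h k) \<longlonglongrightarrow> v \<bullet> b"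
        by (simp add: power_mult_distrib)
    qed
  qed measurable
  have Qle: "\<bar>Q k\<bar> \<le> s * norm v * J1 + h k * (16 * s\<^sup>2 * (norm v)\<^sup>2 * J2)" for k
  proof -
    define E where "E b = exp ((h k *\<^sub>R v) \<bullet> b - (norm (h k *\<^sub>R v))\<^sup>2 / 2)" for b
    have [measurable]: "E \<in> borel_measurable borel" unfolding E_def by measurable
    have intP: "integrable std_gaussian P"
      by (rule std_gaussian.integrable_const_bound[where B = B]) (use PB in auto)
    have intPs: "integrable std_gaussian (\<lambda>b. P (b + h k *\<^sub>R v))"
      by (rule std_gaussian.integrable_const_bound[where B = B]) (use PB in auto)
    have intPE': "integrable std_gaussian (\<lambda>b. P b * ((E b - 1) / h k))"
      unfolding E_def
    proof (rule Bochner_Integration.integrable_bound)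
      show "integrable std_gaussian (\<lambda>b::'a. B * (exp (4 * (norm v)\<^sup>2) * exp (3 * (norm b)\<^sup>2 / 8)))"
        by (intro integrable_mult_right integrable_std_gaussian_exp_square)
      show "AE b in std_gaussian. norm (P b * ((exp ((h k *\<^sub>R v) \<bullet> b - (norm (h k *\<^sub>R v))\<^sup>2 / 2) - 1) / h k))
         \<le> norm (B * (exp (4 * (norm v)\<^sup>2) * exp (3 * (norm b)\<^sup>2 / 8)))"
        unfolding real_norm_def abs_mult[of "P _"] abs_mult[of B] using PB dom B0 by (intro AE_I2 mult_mono) auto
    qed measurable
    have "integrable std_gaussian (\<lambda>b. h k * (P b * ((E b - 1) / h k)) + P b)"
      by (intro Bochner_Integration.integrable_add integrable_mult_right intPE' intP)
    also have "(\<lambda>b. h k * (P b * ((E b - 1) / h k)) + P b) = (\<lambda>b. P b * E b)"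
      using h(1)[of k] by (simp add: field_simps)
    finally have intPE: "integrable std_gaussian (\<lambda>b. P b * E b)" .
    have "Q k = ((\<integral>b. P b * E b \<partial>std_gaussian) - (\<integral>b. P b \<partial>std_gaussian)) / h k"
      unfolding Q_def E_def[symmetric] using intPE intP
      by (simp add: right_diff_distrib diff_divide_distrib)
    also have "\<dots> = ((\<integral>b. P (b + h k *\<^sub>R v) \<partial>std_gaussian) - (\<integral>b. P b \<partial>std_gaussian)) / h k"
      by (simp add: integral_std_gaussian_translate E_def)
    also have "\<dots> = (\<integral>b. (P (b + h k *\<^sub>R v) - P b) / h k \<partial>std_gaussian)"
      using intP intPs by simp
    finally have Qk: "Q k = (\<integral>b. (P (b + h k *\<^sub>R v) - P b) / h k \<partial>std_gaussian)" .
    have i12: "integrable std_gaussian (\<lambda>b. s * norm v * (1 / norm (a - s *\<^sub>R b)) + h k * (16 * s\<^sup>2 * (norm v)\<^sup>2 * (1 / (norm (a - s *\<^sub>R b))\<^sup>2)))"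
      by (intro Bochner_Integration.integrable_add integrable_mult_right int1 int2)
    have "\<bar>Q k\<bar> \<le> (\<integral>b. \<bar>(P (b + h k *\<^sub>R v) - P b) / h k\<bar> \<partial>std_gaussian)"
      unfolding Qk by (rule integral_abs_bound)
    also have "\<dots> \<le> (\<integral>b. s * norm v * (1 / norm (a - s *\<^sub>R b)) + h k * (16 * s\<^sup>2 * (norm v)\<^sup>2 * (1 / (norm (a - s *\<^sub>R b))\<^sup>2)) \<partial>std_gaussian)"
    proof (rule integral_mono_AE)
      have ae: "AE b in std_gaussian. a - s *\<^sub>R b \<noteq> 0"
        using AE_std_gaussian_neq[of "(1 / s) *\<^sub>R a"] by eventually_elim (use s in auto)
      have ae': "AE b in std_gaussian. a - s *\<^sub>R (b + h k *\<^sub>R v) \<noteq> 0"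
        using AE_std_gaussian_neq[of "(1 / s) *\<^sub>R a - h k *\<^sub>R v"]
      proof eventually_elim
        case (elim b)
        show ?case
        proof
          assume "a - s *\<^sub>R (b + h k *\<^sub>R v) = 0"
          then have "(1 / s) *\<^sub>R a = (1 / s) *\<^sub>R (s *\<^sub>R (b + h k *\<^sub>R v))" by simp
          then have "(1 / s) *\<^sub>R a = b + h k *\<^sub>R v" using s by simp
          then show False using elim by simp
        qed
      qed
      show "AE b in std_gaussian. \<bar>(P (b + h k *\<^sub>R v) - P b) / h k\<bar>
         \<le> s * norm v * (1 / norm (a - s *\<^sub>R b)) + h k * (16 * s\<^sup>2 * (norm v)\<^sup>2 * (1 / (norm (a - s *\<^sub>R b))\<^sup>2))"
        using ae ae'
      proof eventually_elim
        case (elim b)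
        define x y where "x = a - s *\<^sub>R b" and "y = a - s *\<^sub>R (b + h k *\<^sub>R v)"
        have "y - x = - (s * h k) *\<^sub>R v" by (simp add: x_def y_def algebra_simps)
        then have nyx: "norm (y - x) = s * h k * norm v" using s h[of k] by (simp add: abs_mult)
        have "\<bar>P (b + h k *\<^sub>R v) - P b\<bar> \<le> norm (y - x) / norm x + 16 * (norm (y - x) / norm x)\<^sup>2"
          unfolding P_def x_def[symmetric] y_def[symmetric]
          by (rule angle_lipschitz_perturb[OF F]) (use elim in \<open>auto simp: x_def y_def\<close>)
        also have "\<dots> = h k * (s * norm v * (1 / norm x) + h k * (16 * s\<^sup>2 * (norm v)\<^sup>2 * (1 / (norm x)\<^sup>2)))"
          unfolding nyx by (simp add: power_divide power_mult_distrib algebra_simps power2_eq_square)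
        finally show ?case using h(1)[of k] by (simp add: divide_le_eq x_def mult_ac)
      qed
    qed (use intP intPs i12 in \<open>auto simp del: times_divide_eq_right\<close>)
    also have "\<dots> = s * norm v * J1 + h k * (16 * s\<^sup>2 * (norm v)\<^sup>2 * J2)"
      unfolding J1_def J2_def
      by (subst Bochner_Integration.integral_add[OF integrable_mult_right[OF int1] integrable_mult_right[OF integrable_mult_right[OF int2]]])
         (simp only: integral_mult_right_zero)
    finally show ?thesis .
  qed
  have "\<bar>\<integral>b. P b * (v \<bullet> b) \<partial>std_gaussian\<bar> \<le> s * norm v * J1 + 0 * (16 * s\<^sup>2 * (norm v)\<^sup>2 * J2)"
  proof (rule LIMSEQ_le)
    show "(\<lambda>k. \<bar>Q k\<bar>) \<longlonglongrightarrow> \<bar>\<integral>b. P b * (v \<bullet> b) \<partial>std_gaussian\<bar>" by (intro tendsto_rabs lim)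
    show "(\<lambda>k. s * norm v * J1 + h k * (16 * s\<^sup>2 * (norm v)\<^sup>2 * J2)) \<longlonglongrightarrow> s * norm v * J1 + 0 * (16 * s\<^sup>2 * (norm v)\<^sup>2 * J2)"
      by (intro tendsto_intros h0)
  qed (use Qle in auto)
  then have "ennreal \<bar>\<integral>b. P b * (v \<bullet> b) \<partial>std_gaussian\<bar> \<le> ennreal (s * norm v * J1)"
    by (intro ennreal_leI) simp
  also have "\<dots> = ennreal (s * norm v) * ennreal J1" using s by (intro ennreal_mult') simp
  also have "ennreal J1 = (\<integral>\<^sup>+b. ennreal (1 / norm (a - s *\<^sub>R b)) \<partial>std_gaussian)"
    unfolding J1_def using int1 by (intro nn_integral_eq_integral[symmetric]) auto
  finally show ?thesis by (simp add: P_def)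
qed

section \<open>The covariance inequality\<close>

lemma integral_std_gaussian_rotate:
  fixes f :: "'a::euclidean_space \<times> 'a \<Rightarrow> real" and c s :: real
  assumes [measurable]: "f \<in> borel_measurable (borel \<Otimes>\<^sub>M borel)" and cs: "c\<^sup>2 + s\<^sup>2 = 1"
  shows "(\<integral>p. f p \<partial>(std_gaussian \<Otimes>\<^sub>M std_gaussian))
    = (\<integral>(a, b). f (c *\<^sub>R a - s *\<^sub>R b, s *\<^sub>R a + c *\<^sub>R b) \<partial>(std_gaussian \<Otimes>\<^sub>M std_gaussian))"
proof -
  let ?P = "(std_gaussian :: 'a measure) \<Otimes>\<^sub>M (std_gaussian :: 'a measure)"
  let ?T = "\<lambda>(x::'a, y). (c *\<^sub>R x - s *\<^sub>R y, s *\<^sub>R x + c *\<^sub>R y)"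
  have "(\<integral>p. f p \<partial>?P) = (\<integral>p. f p \<partial>distr ?P borel ?T)"
    by (simp only: distr_std_gaussian_rotate[OF cs])
  also have "\<dots> = (\<integral>p. f (?T p) \<partial>?P)"
    by (intro integral_distr) (auto simp: borel_prod[symmetric])
  finally show ?thesis by (simp add: case_prod_unfold)
qed

lemma integrable_norm_square_std_gaussian:
  "integrable std_gaussian (\<lambda>b::'a::euclidean_space. (norm b)\<^sup>2)"
proof (rule Bochner_Integration.integrable_bound)
  show "integrable std_gaussian (\<lambda>b::'a. (8/3) * exp (3 * (norm b)\<^sup>2 / 8))"
    by (intro integrable_mult_right integrable_std_gaussian_exp_square)
  have "x\<^sup>2 \<le> (8/3) * exp (3 * x\<^sup>2 / 8)" for x :: real
    using exp_ge_add_one_self[of "3 * x\<^sup>2 / 8"] by linarith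
  then show "AE b::'a in std_gaussian. norm ((norm b)\<^sup>2) \<le> norm ((8/3) * exp (3 * (norm b)\<^sup>2 / 8))"
    by simp
qed measurable

lemma integrable_std_gaussian_pair_ratio:
  assumes n: "DIM('a::euclidean_space) \<ge> 3"
  shows "integrable ((std_gaussian :: 'a measure) \<Otimes>\<^sub>M (std_gaussian :: 'a measure)) (\<lambda>(a, b). (norm b)\<^sup>2 * (1 / (norm a)\<^sup>2))"
proof (rule integrableI_nonneg)
  have "(\<integral>\<^sup>+p. ennreal (case p of (a::'a, b::'a) \<Rightarrow> (norm b)\<^sup>2 * (1 / (norm a)\<^sup>2)) \<partial>(std_gaussian \<Otimes>\<^sub>M std_gaussian))
     = (\<integral>\<^sup>+(a::'a). \<integral>\<^sup>+(b::'a). ennreal ((norm b)\<^sup>2) * ennreal (1 / (norm a)\<^sup>2) \<partial>std_gaussian \<partial>std_gaussian)"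
    by (subst std_gaussian.nn_integral_fst[symmetric]) (auto simp: ennreal_mult''[symmetric])
  also have "\<dots> = (\<integral>\<^sup>+(b::'a). ennreal ((norm b)\<^sup>2) \<partial>std_gaussian) * (\<integral>\<^sup>+(a::'a). ennreal (1 / (norm a)\<^sup>2) \<partial>std_gaussian)"
    by (simp add: nn_integral_multc nn_integral_cmult)
  also have "\<dots> < \<infinity>"
    unfolding nn_integral_std_gaussian_inverse_square[OF n]
    using integrable_norm_square_std_gaussian[where 'a='a] 
    by (simp add: ennreal_mult_less_top integrable_iff_bounded)
  finally show "(\<integral>\<^sup>+p. ennreal (case p of (a::'a, b::'a) \<Rightarrow> (norm b)\<^sup>2 * (1 / (norm a)\<^sup>2)) \<partial>(std_gaussian \<Otimes>\<^sub>M std_gaussian)) < \<infinity>" .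
qed auto

lemma angle_lipschitz_derivative_bound:
  fixes g :: "'a::euclidean_space \<Rightarrow> real"
  assumes g: "angle_lipschitz g" and a: "a \<noteq> 0" and D: "(g has_derivative g') (at a)"
  shows "\<bar>g' b\<bar> \<le> norm b / norm a"
proof -
  have lin: "linear g'" using D by (rule has_derivative_linear)
  have "((\<lambda>t. g (a + t *\<^sub>R b)) has_derivative (\<lambda>t. g' (t *\<^sub>R b))) (at 0)"
  proof (rule has_derivative_compose[of "\<lambda>t. a + t *\<^sub>R b" "\<lambda>t. t *\<^sub>R b" 0 UNIV g g'])
    show "((\<lambda>t. a + t *\<^sub>R b) has_derivative (\<lambda>t. t *\<^sub>R b)) (at 0)"
      by (auto intro!: derivative_eq_intros)
  qed (use D in auto)
  then have "((\<lambda>t. g (a + t *\<^sub>R b)) has_real_derivative g' b) (at 0)"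
    unfolding has_field_derivative_def by (rule has_derivative_eq_rhs) (auto simp: linear_cmul[OF lin])
  then have lim: "((\<lambda>t. (g (a + t *\<^sub>R b) - g a) / t) \<longlongrightarrow> g' b) (at 0)"
    by (simp add: DERIV_def)
  have "\<bar>g' b\<bar> \<le> norm b / norm a + 0 * (16 * (norm b / norm a)\<^sup>2)"
  proof (rule tendsto_le)
    show "((\<lambda>t. \<bar>(g (a + t *\<^sub>R b) - g a) / t\<bar>) \<longlongrightarrow> \<bar>g' b\<bar>) (at 0)" by (intro tendsto_rabs lim)
    show "((\<lambda>t. norm b / norm a + \<bar>t\<bar> * (16 * (norm b / norm a)\<^sup>2)) \<longlongrightarrow> norm b / norm a + 0 * (16 * (norm b / norm a)\<^sup>2)) (at (0::real))"
      by (auto intro!: tendsto_eq_intros)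
    have "((\<lambda>t. a + t *\<^sub>R b) \<longlongrightarrow> a) (at (0::real))" by (auto intro!: tendsto_eq_intros)
    then have "\<forall>\<^sub>F t in at (0::real). a + t *\<^sub>R b \<noteq> 0" using a by (rule tendsto_imp_eventually_ne)
    moreover have "\<forall>\<^sub>F t in at (0::real). t \<noteq> 0" by (simp add: eventually_at_filter)
    ultimately show "\<forall>\<^sub>F t in at 0. \<bar>(g (a + t *\<^sub>R b) - g a) / t\<bar> \<le> norm b / norm a + \<bar>t\<bar> * (16 * (norm b / norm a)\<^sup>2)"
    proof eventually_elim
      case (elim t)
      have "\<bar>g (a + t *\<^sub>R b) - g a\<bar> \<le> norm (t *\<^sub>R b) / norm a + 16 * (norm (t *\<^sub>R b) / norm a)\<^sup>2"
        using angle_lipschitz_perturb[OF g a elim(1)] by simp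
      also have "\<dots> = \<bar>t\<bar> * (norm b / norm a + \<bar>t\<bar> * (16 * (norm b / norm a)\<^sup>2))"
        by (simp add: power_divide power_mult_distrib power2_eq_square algebra_simps)
      finally show ?case using elim(2) by (simp add: pos_divide_le_eq mult.commute)
    qed
  qed simp
  then show ?thesis by simp
qed

text \<open>
  The covariance is \<open>D 0 - D (\<pi> / 2)\<close> for \<open>D t = E F(X) H(g(cos t X + sin t Y))\<close>. Rotating the pair, the
  increment of \<open>D\<close> at \<open>t\<close> becomes an increment of \<open>H \<circ> g\<close> near a point \<open>a\<close> in the direction of an
  independent Gaussian \<open>b\<close>; hence \<open>D'\<close> is the mean of \<open>F (cos t a - sin t b) \<langle>\<nabla>(H \<circ> g)(a), b\<rangle>\<close>. Integration
  by parts in \<open>b\<close> and decoupling give \<open>|D' t| \<le> sin t \<cdot> M\<close> where \<open>M = E H'(g) / (n - 2)\<close>, and \<open>sin\<close> has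
  integral \<open>1\<close> over \<open>[0, \<pi>/2]\<close>.
\<close>

theorem gaussian_covariance_inequality:
  fixes F g :: "'a::euclidean_space \<Rightarrow> real"
  assumes n: "DIM('a) \<ge> 3" and F: "angle_lipschitz F" and g: "angle_lipschitz g"
    and dg: "\<And>x. x \<noteq> 0 \<Longrightarrow> g differentiable (at x)"
    and H: "\<And>x. (H has_real_derivative H' x) (at x)" and H': "continuous_on UNIV H'" "\<And>x. H' x \<ge> 0"
  shows "(\<integral>x. F x * H (g x) \<partial>std_gaussian) - (\<integral>x. F x \<partial>std_gaussian) * (\<integral>x. H (g x) \<partial>std_gaussian)
    \<le> (\<integral>x. H' (g x) \<partial>std_gaussian) / (real DIM('a) - 2)"
proof -
  define P where "P = (std_gaussian :: 'a measure) \<Otimes>\<^sub>M (std_gaussian :: 'a measure)"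
  interpret P: prob_space P unfolding P_def std_gaussian_pair by (rule prob_space_std_gaussian)
  have [measurable_cong]: "sets P = sets (borel \<Otimes>\<^sub>M borel)"
    unfolding P_def by (intro sets_pair_measure_cong) auto
  obtain Bf where Bf0: "Bf > 0" and Bf: "\<And>x. \<bar>F x\<bar> \<le> Bf" using angle_lipschitz_bounded[OF F] by blast
  obtain Bg where Bg0: "Bg > 0" and Bg: "\<And>x. \<bar>g x\<bar> \<le> Bg" using angle_lipschitz_bounded[OF g] by blast
  note [measurable] = angle_lipschitz_measurable[OF F] angle_lipschitz_measurable[OF g]
  have contH: "continuous_on UNIV H" using H by (auto intro!: continuous_at_imp_continuous_on DERIV_isCont)
  have [measurable]: "H \<in> borel_measurable borel" "H' \<in> borel_measurable borel"
    using contH H' by (auto intro: borel_measurable_continuous_onI)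
  obtain L where L0: "L > 0" and L: "\<And>x. \<bar>x\<bar> \<le> Bg \<Longrightarrow> \<bar>H' x\<bar> \<le> L"
  proof -
    have "bounded (H' ` {- Bg..Bg})"
      by (intro compact_imp_bounded compact_continuous_image continuous_on_subset[OF H'(1)]) auto
    then obtain L where "L > 0" "\<forall>y\<in>H' ` {- Bg..Bg}. norm y \<le> L" by (auto simp: bounded_pos)
    then show ?thesis by (intro that[of L]) (auto simp: abs_le_iff)
  qed
  obtain BH where BH0: "BH > 0" and BH: "\<And>x. \<bar>x\<bar> \<le> Bg \<Longrightarrow> \<bar>H x\<bar> \<le> BH"
  proof -
    have "bounded (H ` {- Bg..Bg})"
      by (intro compact_imp_bounded compact_continuous_image continuous_on_subset[OF contH]) auto
    then obtain L where "L > 0" "\<forall>y\<in>H ` {- Bg..Bg}. norm y \<le> L" by (auto simp: bounded_pos)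
    then show ?thesis by (intro that[of L]) (auto simp: abs_le_iff)
  qed
  have HL: "\<bar>H u - H v\<bar> \<le> L * \<bar>u - v\<bar>" if "\<bar>u\<bar> \<le> Bg" "\<bar>v\<bar> \<le> Bg" for u v
  proof -
    have "norm (H u - H v) \<le> L * norm (u - v)"
      by (rule field_differentiable_bound[of "{- Bg..Bg}" H H'])
         (use that L in \<open>auto intro: has_field_derivative_at_within[OF H]\<close>)
    then show ?thesis by simp
  qed
  define G where "G x = H (g x)" for x
  have [measurable]: "G \<in> borel_measurable borel" unfolding G_def by measurable
  have GB: "\<bar>G x\<bar> \<le> BH" for x unfolding G_def by (intro BH Bg)
  define C where "C = L * (1 + 2 * Bg)"
  have C0: "C > 0" using L0 Bg0 by (simp add: C_def)
  have Gpert: "\<bar>G y - G x\<bar> \<le> C * (norm (y - x) / norm x + 16 * (norm (y - x) / norm x)\<^sup>2)" if x: "x \<noteq> 0" for x y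
  proof -
    define t where "t = norm (y - x) / norm x + 16 * (norm (y - x) / norm x)\<^sup>2"
    have t0: "t \<ge> 0" by (simp add: t_def)
    have "\<bar>g y - g x\<bar> \<le> (1 + 2 * Bg) * t"
    \<comment> \<open>The Lipschitz estimate fails at the origin only, where \<open>t = 1 + 16\<close> and the bound on \<open>g\<close> suffices.\<close>
    proof (cases "y = 0")
      case True
      then have "t = 17" using x by (simp add: t_def)
      then show ?thesis using Bg[of y] Bg[of x] Bg0 by (simp add: algebra_simps)
    next
      case False
      then have "\<bar>g y - g x\<bar> \<le> t" using angle_lipschitz_perturb[OF g x] by (simp add: t_def)
      moreover have "2 * Bg * t \<ge> 0" using Bg0 t0 by simp
      ultimately show ?thesis by (simp add: algebra_simps)
    qed
    then have "L * \<bar>g y - g x\<bar> \<le> L * ((1 + 2 * Bg) * t)" using L0 by (intro mult_left_mono) auto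
    with HL[OF Bg[of y] Bg[of x]] show ?thesis by (simp add: G_def C_def t_def mult.assoc)
  qed
  \<comment> \<open>The derivative of \<open>G\<close> off the origin; at the origin, a null set, it is \<open>0\<close> so that it is linear everywhere.\<close>
  define dG where "dG a = (\<lambda>b. if a = 0 then 0 else H' (g a) * frechet_derivative g (at a) b)" for a
  have gder: "(g has_derivative frechet_derivative g (at a)) (at a)" if "a \<noteq> 0" for a
    using dg[OF that] by (simp add: frechet_derivative_works)
  have dGlin: "linear (dG a)" for a
  proof (cases "a = 0")
    case False
    have "linear (frechet_derivative g (at a))" using gder[OF False] by (rule has_derivative_linear)
    then show ?thesis using False by (auto simp: dG_def linear_iff algebra_simps)
  qed (auto simp: dG_def linear_iff)
  have dGbound: "\<bar>dG a b\<bar> \<le> H' (g a) * (norm b / norm a)" for a b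
  proof (cases "a = 0")
    case False
    then show ?thesis using mult_left_mono[OF angle_lipschitz_derivative_bound[OF g False gder[OF False], of b] H'(2)[of "g a"]] H'(2)[of "g a"]
      by (simp add: dG_def abs_mult)
  qed (simp add: dG_def)
  define quot where "quot h p = (G (cos h *\<^sub>R fst p + sin h *\<^sub>R snd p) - G (fst p)) / h" for h :: real and p :: "'a \<times> 'a"
  have [measurable]: "quot h \<in> borel_measurable (borel \<Otimes>\<^sub>M borel)" for h unfolding quot_def by measurable
  have quot_lim: "((\<lambda>h. quot h (a, b)) \<longlongrightarrow> dG a b) (at 0)" if a: "a \<noteq> 0" for a b
  proof -
    let ?p = "\<lambda>h::real. cos h *\<^sub>R a + sin h *\<^sub>R b"
    have 1: "(?p has_derivative (\<lambda>h. h *\<^sub>R b)) (at 0)" by (auto intro!: derivative_eq_intros)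
    have "((\<lambda>h. g (?p h)) has_derivative (\<lambda>h. frechet_derivative g (at a) (h *\<^sub>R b))) (at 0)"
      by (rule has_derivative_compose[OF 1]) (use gder[OF a] in simp)
    then have 2: "((\<lambda>h. g (?p h)) has_real_derivative frechet_derivative g (at a) b) (at 0)"
      unfolding has_field_derivative_def
      by (rule has_derivative_eq_rhs) (auto simp: linear_cmul[OF has_derivative_linear[OF gder[OF a]]])
    have "((\<lambda>h. H (g (?p h))) has_real_derivative H' (g a) * frechet_derivative g (at a) b) (at 0)"
      by (rule DERIV_chain2[OF _ 2]) (simp add: H)
    then show ?thesis using a by (simp add: DERIV_def quot_def G_def dG_def)
  qed
  \<comment> \<open>A majorant for the difference quotients that is uniform in \<open>h\<close>: with \<open>q = 1 + |b| / |a|\<close>, the relative displacement is at most \<open>|h| q\<close>.\<close>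
  have quot_bound: "\<bar>quot h (a, b)\<bar> \<le> 34 * C * (1 + (norm b)\<^sup>2 * (1 / (norm a)\<^sup>2))" if a: "a \<noteq> 0" and h: "h \<noteq> 0" "\<bar>h\<bar> \<le> 1" for a b h
  proof -
    define q where "q = 1 + norm b / norm a"
    have q1: "q \<ge> 1" by (simp add: q_def)
    define y where "y = cos h *\<^sub>R a + sin h *\<^sub>R b"
    have cosh: "\<bar>cos h - 1\<bar> \<le> \<bar>h\<bar>"
    proof -
      have "1 - cos h = 2 * (sin (h / 2))\<^sup>2" using cos_double_sin[of "h / 2"] by simp
      also have "\<dots> \<le> 2 * (\<bar>h / 2\<bar> * 1)"
      proof -
        have "(sin (h/2))\<^sup>2 = \<bar>sin (h/2)\<bar> * \<bar>sin (h/2)\<bar>" by (simp add: power2_eq_square)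
        also have "\<dots> \<le> \<bar>h/2\<bar> * 1" by (intro mult_mono abs_sin_x_le_abs_x) auto
        finally show ?thesis by simp
      qed
      finally show ?thesis using cos_le_one[of h] by linarith
    qed
    have "y - a = (cos h - 1) *\<^sub>R a + sin h *\<^sub>R b" by (simp add: y_def algebra_simps)
    then have "norm (y - a) \<le> \<bar>cos h - 1\<bar> * norm a + \<bar>sin h\<bar> * norm b"
      using norm_triangle_ineq[of "(cos h - 1) *\<^sub>R a" "sin h *\<^sub>R b"] by simp
    also have "\<dots> \<le> \<bar>h\<bar> * norm a + \<bar>h\<bar> * norm b"
      by (intro add_mono mult_right_mono cosh abs_sin_x_le_abs_x) auto
    finally have "norm (y - a) / norm a \<le> \<bar>h\<bar> * q"
      using a by (simp add: q_def field_simps)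
    then have t: "norm (y - a) / norm a \<le> \<bar>h\<bar> * q" "(norm (y - a) / norm a)\<^sup>2 \<le> (\<bar>h\<bar> * q)\<^sup>2"
      by (auto intro: power_mono)
    have "\<bar>G y - G a\<bar> \<le> C * (norm (y - a) / norm a + 16 * (norm (y - a) / norm a)\<^sup>2)" by (rule Gpert[OF a])
    also have "\<dots> \<le> C * (\<bar>h\<bar> * q + 16 * (\<bar>h\<bar> * q)\<^sup>2)" using t C0 by (intro mult_left_mono) auto
    also have "\<dots> \<le> C * (\<bar>h\<bar> * (17 * q\<^sup>2))"
    proof -
      have "\<bar>h\<bar> * q \<le> \<bar>h\<bar> * q\<^sup>2" using q1 by (intro mult_left_mono) (auto simp: power2_eq_square)
      moreover have "(\<bar>h\<bar> * q)\<^sup>2 \<le> \<bar>h\<bar> * q\<^sup>2"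
      proof -
        have "\<bar>h\<bar> * (\<bar>h\<bar> * q\<^sup>2) \<le> 1 * (\<bar>h\<bar> * q\<^sup>2)" using h by (intro mult_right_mono) auto
        moreover have "(\<bar>h\<bar> * q)\<^sup>2 = \<bar>h\<bar> * (\<bar>h\<bar> * q\<^sup>2)" by (simp only: power2_eq_square mult_ac)
        ultimately show ?thesis by simp
      qed
      ultimately show ?thesis using C0 by (intro mult_left_mono) auto
    qed
    also have "\<dots> \<le> C * (\<bar>h\<bar> * (34 * (1 + (norm b)\<^sup>2 * (1 / (norm a)\<^sup>2))))"
    proof -
      have "q\<^sup>2 \<le> 2 * (1 + (norm b / norm a)\<^sup>2)" using zero_le_power2[of "1 - norm b / norm a"]
        unfolding q_def by (simp add: power2_diff power2_sum)
      then have "17 * q\<^sup>2 \<le> 34 * (1 + (norm b)\<^sup>2 * (1 / (norm a)\<^sup>2))" by (simp add: power_divide)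
      then show ?thesis using C0 by (intro mult_left_mono) auto
    qed
    finally have "\<bar>G y - G a\<bar> \<le> \<bar>h\<bar> * (34 * C * (1 + (norm b)\<^sup>2 * (1 / (norm a)\<^sup>2)))" by (simp add: mult_ac)
    then show ?thesis using h by (simp add: quot_def y_def[symmetric] pos_divide_le_eq mult.commute)
  qed
  have [measurable]: "(\<lambda>p. dG (fst p) (snd p)) \<in> borel_measurable (borel \<Otimes>\<^sub>M borel)"
  proof (rule borel_measurable_LIMSEQ_real)
    fix p :: "'a \<times> 'a"
    have "filterlim (\<lambda>i. 1 / real (Suc i)) (at 0) sequentially"
      unfolding filterlim_at using LIMSEQ_Suc[OF lim_1_over_n] by (auto intro!: always_eventually)
    then show "(\<lambda>i. if fst p = 0 then 0 else quot (1 / real (Suc i)) p) \<longlonglongrightarrow> dG (fst p) (snd p)"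
      using filterlim_compose[OF quot_lim[of "fst p" "snd p"]] by (cases "fst p = 0") (auto simp: dG_def)
  qed measurable
  define D where "D t = (\<integral>p. F (fst p) * G (cos t *\<^sub>R fst p + sin t *\<^sub>R snd p) \<partial>P)" for t
  have Drot: "D (t + h) = (\<integral>p. F (cos t *\<^sub>R fst p - sin t *\<^sub>R snd p) * G (cos h *\<^sub>R fst p + sin h *\<^sub>R snd p) \<partial>P)" for t h
  proof -
    have "cos (t + h) *\<^sub>R (cos t *\<^sub>R a - sin t *\<^sub>R b) + sin (t + h) *\<^sub>R (sin t *\<^sub>R a + cos t *\<^sub>R b) = cos h *\<^sub>R a + sin h *\<^sub>R b" for a b :: 'a
    proof -
      have 1: "cos (t + h) * cos t + sin (t + h) * sin t = cos h" using cos_diff[of "t + h" t] by simp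
      have 2: "sin (t + h) * cos t - cos (t + h) * sin t = sin h" using sin_diff[of "t + h" t] by simp
      have "cos (t + h) *\<^sub>R (cos t *\<^sub>R a - sin t *\<^sub>R b) + sin (t + h) *\<^sub>R (sin t *\<^sub>R a + cos t *\<^sub>R b)
         = (cos (t + h) * cos t + sin (t + h) * sin t) *\<^sub>R a + (sin (t + h) * cos t - cos (t + h) * sin t) *\<^sub>R b"
        by (simp add: algebra_simps)
      then show ?thesis by (simp only: 1 2)
    qed
    then show ?thesis unfolding D_def P_def
      by (subst integral_std_gaussian_rotate[of _ "cos t" "sin t"]) (auto simp: case_prod_unfold)
  qed
  have aeP: "AE p in P. fst p \<noteq> 0"
  proof -
    have "{p \<in> space P. fst p \<noteq> 0} \<in> sets P" by measurable
    then show ?thesis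
      unfolding P_def by (rule std_gaussian_pair.AE_pair_measure) (use AE_std_gaussian_nonzero in simp)
  qed
  define W where "W p = Bf * (34 * C * (1 + (norm (snd p))\<^sup>2 * (1 / (norm (fst p))\<^sup>2)))" for p :: "'a \<times> 'a"
  have Wint: "integrable P W"
    using integrable_std_gaussian_pair_ratio[OF n] unfolding W_def P_def[symmetric]
    by (intro integrable_mult_right Bochner_Integration.integrable_add P.integrable_const) (auto simp: case_prod_unfold)
  define D' where "D' t = (\<integral>p. F (cos t *\<^sub>R fst p - sin t *\<^sub>R snd p) * dG (fst p) (snd p) \<partial>P)" for t
  have der: "(D has_real_derivative D' t) (at t)" 
    and D'int: "integrable P (\<lambda>p. F (cos t *\<^sub>R fst p - sin t *\<^sub>R snd p) * dG (fst p) (snd p))" for t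
  proof -
    have eq: "(D (t + h) - D t) / h = (\<integral>p. F (cos t *\<^sub>R fst p - sin t *\<^sub>R snd p) * quot h p \<partial>P)" if "h \<noteq> 0" for h
    proof -
      have int: "integrable P (\<lambda>p. F (cos t *\<^sub>R fst p - sin t *\<^sub>R snd p) * G (cos h *\<^sub>R fst p + sin h *\<^sub>R snd p))" for h
        by (rule P.integrable_const_bound[where B = "Bf * BH"])
           (use Bf GB Bf0 in \<open>auto simp: abs_mult intro!: mult_mono\<close>)
      show ?thesis using int[of h] int[of 0] Drot[of t h] Drot[of t 0]
        by (simp add: quot_def right_diff_distrib diff_divide_distrib)
    qed
    have bd: "AE p in P. norm (F (cos t *\<^sub>R fst p - sin t *\<^sub>R snd p) * quot h p) \<le> W p" if "h \<noteq> 0" "\<bar>h\<bar> \<le> 1" for h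
      using aeP
    proof eventually_elim
      case (elim p)
      show ?case unfolding real_norm_def abs_mult W_def
        using quot_bound[of "fst p" h "snd p"] elim that Bf0 by (intro mult_mono Bf) auto
    qed
    have *: "integrable P (\<lambda>p. F (cos t *\<^sub>R fst p - sin t *\<^sub>R snd p) * dG (fst p) (snd p)) \<and>
       (\<lambda>k. \<integral>p. F (cos t *\<^sub>R fst p - sin t *\<^sub>R snd p) * quot (h k) p \<partial>P) \<longlonglongrightarrow> D' t"
      if h: "\<And>k. h k \<noteq> 0" "\<And>k. \<bar>h k\<bar> \<le> 1" "h \<longlonglongrightarrow> 0" for h :: "nat \<Rightarrow> real"
    proof -
      have lim: "AE p in P. (\<lambda>k. F (cos t *\<^sub>R fst p - sin t *\<^sub>R snd p) * quot (h k) p) \<longlonglongrightarrow> F (cos t *\<^sub>R fst p - sin t *\<^sub>R snd p) * dG (fst p) (snd p)"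
        using aeP
      proof eventually_elim
        case (elim p)
        have "filterlim h (at 0) sequentially" using h by (auto simp: filterlim_at)
        from filterlim_compose[OF quot_lim[OF elim, of "snd p"] this] show ?case
          by (intro tendsto_mult tendsto_const) auto
      qed
      have meas: "(\<lambda>p. F (cos t *\<^sub>R fst p - sin t *\<^sub>R snd p) * dG (fst p) (snd p)) \<in> borel_measurable P"
        "\<And>k. (\<lambda>p. F (cos t *\<^sub>R fst p - sin t *\<^sub>R snd p) * quot (h k) p) \<in> borel_measurable P"
        by measurable
      show ?thesis unfolding D'_def
        using integrable_dominated_convergence[OF meas Wint lim bd[OF h(1,2)]]
          integral_dominated_convergence[OF meas Wint lim bd[OF h(1,2)]] by blast
    qed
    show "integrable P (\<lambda>p. F (cos t *\<^sub>R fst p - sin t *\<^sub>R snd p) * dG (fst p) (snd p))"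
      using *[of "\<lambda>k. 1 / real (Suc k)"] LIMSEQ_Suc[OF lim_1_over_n] by (auto simp: field_simps)
    show "(D has_real_derivative D' t) (at t)"
      unfolding DERIV_def tendsto_at_iff_sequentially comp_def
    proof (intro allI impI)
      fix X :: "nat \<Rightarrow> real" assume X: "\<forall>i. X i \<in> UNIV - {0}" "X \<longlonglongrightarrow> 0"
      then have "\<forall>\<^sub>F i in sequentially. \<bar>X i\<bar> < 1"
        using tendstoD[of X 0 sequentially 1] by (simp add: dist_real_def)
      then obtain N where N: "\<And>i. i \<ge> N \<Longrightarrow> \<bar>X i\<bar> < 1" by (auto simp: eventually_sequentially)
      have "(\<lambda>k. \<integral>p. F (cos t *\<^sub>R fst p - sin t *\<^sub>R snd p) * quot (X (k + N)) p \<partial>P) \<longlonglongrightarrow> D' t"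
        by (rule *[THEN conjunct2]) (use X in \<open>auto intro: LIMSEQ_ignore_initial_segment less_imp_le[OF N]\<close>)
      then have "(\<lambda>k. (D (t + X (k + N)) - D t) / X (k + N)) \<longlonglongrightarrow> D' t"
        using X by (simp add: eq)
      then show "(\<lambda>i. (D (t + X i) - D t) / X i) \<longlonglongrightarrow> D' t"
        by (rule LIMSEQ_offset)
    qed
  qed
  define M where "M = (\<integral>x. H' (g x) \<partial>std_gaussian) / (real DIM('a) - 2)"
  have intH': "integrable std_gaussian (\<lambda>x. H' (g x))"
    by (rule std_gaussian.integrable_const_bound[where B = L]) (use L Bg in auto)
  have M0: "M \<ge> 0" using n H'(2) by (auto simp: M_def intro!: divide_nonneg_nonneg integral_nonneg_AE)
  have bound: "\<bar>D' t\<bar> \<le> sin t * M" if t: "0 < t" "t < pi / 2" for t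
  proof -
    define c s where "c = cos t" and "s = sin t"
    have s: "s > 0" using t by (simp add: s_def sin_gt_zero)
    have cs: "c\<^sup>2 + s\<^sup>2 = 1" by (simp add: c_def s_def)
    define r where "r a = (\<integral>\<^sup>+b. ennreal (1 / norm (c *\<^sub>R a - s *\<^sub>R b)) \<partial>std_gaussian)" for a :: 'a
    have [measurable]: "r \<in> borel_measurable borel" unfolding r_def by measurable
    have int: "integrable (std_gaussian \<Otimes>\<^sub>M std_gaussian) (\<lambda>(a, b). F (c *\<^sub>R a - s *\<^sub>R b) * dG a b)"
      using D'int[of t] unfolding P_def c_def s_def by (simp add: case_prod_unfold)
    have D'eq: "D' t = (\<integral>a. (\<integral>b. F (c *\<^sub>R a - s *\<^sub>R b) * dG a b \<partial>std_gaussian) \<partial>std_gaussian)"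
      using std_gaussian_pair.integral_fst'[OF int] by (simp add: D'_def P_def c_def s_def case_prod_unfold)
    have fin: "AE a in std_gaussian. (\<integral>\<^sup>+b. ennreal (1 / (norm (c *\<^sub>R a - s *\<^sub>R b))\<^sup>2) \<partial>(std_gaussian :: 'a measure)) \<noteq> \<infinity>"
    proof (rule nn_integral_noteq_infinite)
      have "(\<integral>\<^sup>+a. \<integral>\<^sup>+b. ennreal (1 / (norm (c *\<^sub>R a - s *\<^sub>R b))\<^sup>2) \<partial>(std_gaussian :: 'a measure) \<partial>std_gaussian)
        = (\<integral>\<^sup>+a. \<integral>\<^sup>+b. ennreal (1 / (norm a)\<^sup>2) \<partial>(std_gaussian :: 'a measure) \<partial>(std_gaussian :: 'a measure))"
        by (rule nn_integral_std_gaussian_rotate[OF _ cs, of "\<lambda>a b. ennreal (1 / (norm a)\<^sup>2)"]) measurable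
      then show "(\<integral>\<^sup>+a. \<integral>\<^sup>+b. ennreal (1 / (norm (c *\<^sub>R a - s *\<^sub>R b))\<^sup>2) \<partial>(std_gaussian :: 'a measure) \<partial>std_gaussian) \<noteq> \<infinity>"
        using nn_integral_std_gaussian_inverse_square[OF n] by simp
    qed measurable
    have "ennreal \<bar>D' t\<bar> \<le> (\<integral>\<^sup>+a. ennreal \<bar>\<integral>b. F (c *\<^sub>R a - s *\<^sub>R b) * dG a b \<partial>std_gaussian\<bar> \<partial>std_gaussian)"
      unfolding D'eq using integral_norm_bound_ennreal[OF std_gaussian_pair.integrable_fst'[OF int]] by simp
    also have "\<dots> \<le> (\<integral>\<^sup>+a. ennreal s * (ennreal (H' (g a)) * ennreal (1 / norm a) * r a) \<partial>std_gaussian)"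
    proof (rule nn_integral_mono_AE)
      show "AE a in std_gaussian. ennreal \<bar>\<integral>b. F (c *\<^sub>R a - s *\<^sub>R b) * dG a b \<partial>std_gaussian\<bar>
         \<le> ennreal s * (ennreal (H' (g a)) * ennreal (1 / norm a) * r a)"
        using fin AE_std_gaussian_nonzero
      proof eventually_elim
        case (elim a)
        \<comment> \<open>The gradient of \<open>G\<close> at \<open>a\<close>.\<close>
        define V where "V = (\<Sum>i\<in>Basis. dG a i *\<^sub>R i)"
        have Vb: "dG a b = V \<bullet> b" for b
        proof -
          have "dG a b = dG a (\<Sum>i\<in>Basis. (b \<bullet> i) *\<^sub>R i)" by (simp add: euclidean_representation)
          also have "\<dots> = (\<Sum>i\<in>Basis. (b \<bullet> i) * dG a i)"
            by (simp add: linear_sum[OF dGlin] linear_cmul[OF dGlin])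
          also have "\<dots> = V \<bullet> b" by (simp add: V_def inner_sum_left inner_commute[of b] mult.commute)
          finally show ?thesis .
        qed
        have nV: "norm V \<le> H' (g a) * (1 / norm a)"
        proof (cases "V = 0")
          case False
          have "(norm V)\<^sup>2 = \<bar>dG a V\<bar>" by (simp add: Vb power2_norm_eq_inner)
          also have "\<dots> \<le> H' (g a) * (1 / norm a) * norm V" using dGbound[of a V] by simp
          finally have "norm V * norm V \<le> H' (g a) * (1 / norm a) * norm V" by (simp only: power2_eq_square)
          then show ?thesis by (rule mult_right_le_imp_le) (use False in simp)
        qed (use H'(2)[of "g a"] in auto)
        have "ennreal \<bar>\<integral>b. F (c *\<^sub>R a - s *\<^sub>R b) * dG a b \<partial>std_gaussian\<bar> \<le> ennreal (s * norm V) * r a"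
          unfolding Vb r_def using elim(1) by (intro gaussian_integration_by_parts_bound F s) (simp add: less_top)
        also have "\<dots> \<le> ennreal (s * (H' (g a) * (1 / norm a))) * r a"
          using nV s by (intro mult_right_mono ennreal_leI mult_left_mono) auto
        also have "ennreal (s * (H' (g a) * (1 / norm a))) = ennreal s * (ennreal (H' (g a)) * ennreal (1 / norm a))"
          using s H'(2)[of "g a"] by (simp add: ennreal_mult'[symmetric])
        finally show ?case by (simp add: mult.assoc)
      qed
    qed
    also have "\<dots> = ennreal s * (\<integral>\<^sup>+a. ennreal (H' (g a)) * ennreal (1 / norm a) * r a \<partial>std_gaussian)"
      by (rule nn_integral_cmult) measurable
    also have "\<dots> \<le> ennreal s * ((\<integral>\<^sup>+a. ennreal (H' (g a)) \<partial>std_gaussian) * ennreal (1 / (real DIM('a) - 2)))"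
      unfolding r_def
      by (intro mult_left_mono nn_integral_gaussian_homogeneous_decouple[where C = L] n cs)
         (use L Bg in \<open>auto simp: angle_lipschitz_scale[OF g] abs_le_iff intro!: ennreal_leI\<close>)
    also have "(\<integral>\<^sup>+a. ennreal (H' (g a)) \<partial>std_gaussian) = ennreal (\<integral>a. H' (g a) \<partial>std_gaussian)"
      using intH' H'(2) by (intro nn_integral_eq_integral) auto
    also have "ennreal s * (ennreal (\<integral>a. H' (g a) \<partial>std_gaussian) * ennreal (1 / (real DIM('a) - 2))) = ennreal (s * M)"
      using s n H'(2) by (simp add: M_def ennreal_mult''[symmetric] ennreal_mult'[symmetric] integral_nonneg_AE)
    finally show ?thesis using s M0 by (simp add: s_def)
  qed
  \<comment> \<open>\<open>D - M cos\<close> is nondecreasing; \<open>cos\<close> falls from \<open>1\<close> to \<open>0\<close>.\<close>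
  have "D 0 - M * cos 0 \<le> D (pi / 2) - M * cos (pi / 2)"
  proof (rule DERIV_nonneg_imp_increasing_open[of 0 "pi/2" "\<lambda>t. D t - M * cos t"])
    fix t :: real assume t: "0 < t" "t < pi / 2"
    have "((\<lambda>t. D t - M * cos t) has_real_derivative D' t + M * sin t) (at t)"
      by (auto intro!: derivative_eq_intros der)
    moreover have "D' t + M * sin t \<ge> 0" using bound[OF t] by (simp add: mult.commute abs_le_iff)
    ultimately show "\<exists>y. ((\<lambda>t. D t - M * cos t) has_real_derivative y) (at t) \<and> 0 \<le> y" by blast
  next
    have "isCont D t" for t using der by (rule DERIV_isCont)
    then show "continuous_on {0..pi/2} (\<lambda>t. D t - M * cos t)"
      by (intro continuous_intros continuous_at_imp_continuous_on) auto
  qed auto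
  then have main: "D 0 - D (pi / 2) \<le> M" by simp
  have i1: "integrable (std_gaussian \<Otimes>\<^sub>M std_gaussian) (\<lambda>(a::'a, b::'a). F a * G a)"
    and i2: "integrable (std_gaussian \<Otimes>\<^sub>M std_gaussian) (\<lambda>(a::'a, b::'a). F a * G b)"
    unfolding P_def[symmetric]
    using Bf GB Bf0 unfolding case_prod_unfold
    by (auto simp: abs_mult intro!: AE_I2 mult_mono P.integrable_const_bound[where B = "Bf * BH"])
  have "D 0 = (\<integral>x. F x * G x \<partial>std_gaussian)"
    using std_gaussian_pair.integral_fst'[OF i1] std_gaussian.prob_space[where 'a='a] by (simp add: D_def P_def case_prod_unfold)
  moreover have "D (pi / 2) = (\<integral>x. F x \<partial>std_gaussian) * (\<integral>x. G x \<partial>std_gaussian)"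
    using std_gaussian_pair.integral_fst'[OF i2] by (simp add: D_def P_def case_prod_unfold)
  ultimately show ?thesis using main by (simp add: G_def M_def)
qed

section \<open>From covariances to deviations\<close>

text \<open>
  Apply the covariance inequality to \<open>F\<close> and to smooth approximations of \<open>F\<close> in the place of \<open>g\<close>. All angle-Lipschitz functions oscillate by at most \<open>\<pi>\<close>, so the
  approximations are uniformly bounded and dominated convergence applies.
\<close>

lemma gaussian_covariance_angle_lipschitz:
  fixes F :: "'a::euclidean_space \<Rightarrow> real" and m :: real
  assumes n: "DIM('a) \<ge> 3" and F: "angle_lipschitz F" and m: "m = (\<integral>x. F x \<partial>std_gaussian)"
    and H: "\<And>x. (H has_real_derivative H' x) (at x)" and H': "continuous_on UNIV H'" "\<And>x. H' x \<ge> 0"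
  shows "(\<integral>x. (F x - m) * H (F x - m) \<partial>std_gaussian) \<le> (\<integral>x. H' (F x - m) \<partial>std_gaussian) / (real DIM('a) - 2)"
proof -
  obtain G :: "nat \<Rightarrow> 'a \<Rightarrow> real" where G: "\<And>k. angle_lipschitz (G k)"
    and Gd: "\<And>k x. x \<noteq> 0 \<Longrightarrow> G k differentiable (at x)" and Glim: "\<And>x. x \<noteq> 0 \<Longrightarrow> (\<lambda>k. G k x) \<longlonglongrightarrow> F x"
    using angle_lipschitz_smooth_approximation[OF F] by blast
  note [measurable] = angle_lipschitz_measurable[OF F] angle_lipschitz_measurable[OF G]
  obtain Bf where Bf0: "Bf > 0" and Bf: "\<And>x. \<bar>F x\<bar> \<le> Bf" using angle_lipschitz_bounded[OF F] by blast
  have contH: "continuous_on UNIV H" using H by (auto intro!: continuous_at_imp_continuous_on DERIV_isCont)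
  have [measurable]: "H \<in> borel_measurable borel" "H' \<in> borel_measurable borel"
    using contH H' by (auto intro: borel_measurable_continuous_onI)
  obtain e :: 'a where e: "e \<in> Basis" using nonempty_Basis by blast
  then have e0: "e \<noteq> 0" by (rule nonzero_Basis)
  have "Bseq (\<lambda>k. G k e)" using Glim[OF e0] by (intro convergent_imp_Bseq convergentI)
  then obtain K where "K > 0" and K: "\<And>k. \<bar>G k e\<bar> \<le> K" by (auto simp: Bseq_def)
  define B where "B = K + pi + \<bar>m\<bar>"
  have GB: "\<bar>G k x - m\<bar> \<le> B" if "x \<noteq> 0" for k x
    using angle_lipschitzD[OF G that e0, of k] vec_angle_le_pi[of x e] K[of k] unfolding B_def by linarith
  have bounded_on: "\<exists>C\<ge>0. \<forall>x\<in>{- B..B}. \<bar>h x\<bar> \<le> C" if "continuous_on UNIV h" for h :: "real \<Rightarrow> real"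
  proof -
    have "bounded (h ` {- B..B})"
      by (intro compact_imp_bounded compact_continuous_image continuous_on_subset[OF that]) auto
    then show ?thesis by (auto simp: bounded_pos intro: less_imp_le)
  qed
  obtain C where C: "C \<ge> 0" "\<And>x. x \<in> {- B..B} \<Longrightarrow> \<bar>H x\<bar> \<le> C" using bounded_on[OF contH] by blast
  obtain C' where C': "C' \<ge> 0" "\<And>x. x \<in> {- B..B} \<Longrightarrow> \<bar>H' x\<bar> \<le> C'" using bounded_on[OF H'(1)] by blast
  have HG: "AE x in std_gaussian. \<bar>H (G k x - m)\<bar> \<le> C" "AE x in std_gaussian. \<bar>H' (G k x - m)\<bar> \<le> C'" for k
  proof -
    have "G k x - m \<in> {- B..B}" if "x \<noteq> 0" for x
      using GB[OF that, of k] by (simp add: abs_le_iff minus_le_iff)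
    then show "AE x in std_gaussian. \<bar>H (G k x - m)\<bar> \<le> C" "AE x in std_gaussian. \<bar>H' (G k x - m)\<bar> \<le> C'"
      using AE_std_gaussian_nonzero[where 'a='a] C(2) C'(2) by (auto elim!: eventually_mono)
  qed
  have ineq: "(\<integral>x. (F x - m) * H (G k x - m) \<partial>std_gaussian) \<le> (\<integral>x. H' (G k x - m) \<partial>std_gaussian) / (real DIM('a) - 2)" for k
  proof -
    have "(\<integral>x. F x * H (G k x - m) \<partial>std_gaussian) - (\<integral>x. F x \<partial>std_gaussian) * (\<integral>x. H (G k x - m) \<partial>std_gaussian)
      \<le> (\<integral>x. H' (G k x - m) \<partial>std_gaussian) / (real DIM('a) - 2)"
    proof (rule gaussian_covariance_inequality[OF n F G Gd, where H = "\<lambda>x. H (x - m)" and H' = "\<lambda>x. H' (x - m)"])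
      show "((\<lambda>x. H (x - m)) has_real_derivative H' (x - m)) (at x)" for x
      proof -
        have "((\<lambda>x. x - m) has_real_derivative 1) (at x)" by (auto intro!: derivative_eq_intros)
        from DERIV_chain2[OF H this] show ?thesis by simp
      qed
      show "continuous_on UNIV (\<lambda>x. H' (x - m))"
        by (intro continuous_on_compose2[OF H'(1)] continuous_intros) auto
    qed (use H' in auto)
    moreover have "integrable std_gaussian (\<lambda>x. H (G k x - m))"
      by (rule std_gaussian.integrable_const_bound[where B = C]) (use HG in auto)
    moreover have "integrable std_gaussian (\<lambda>x. F x * H (G k x - m))"
    proof (rule std_gaussian.integrable_const_bound[where B = "Bf * C"])
      show "AE x in std_gaussian. norm (F x * H (G k x - m)) \<le> Bf * C"
        using HG(1)[of k] by eventually_elim (use Bf Bf0 in \<open>auto simp: abs_mult intro!: mult_mono\<close>)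
    qed measurable
    ultimately show ?thesis by (simp add: left_diff_distrib m)
  qed
  have lim: "AE x in std_gaussian. (\<lambda>k. h (G k x - m)) \<longlonglongrightarrow> h (F x - m)" if "continuous_on UNIV h" for h :: "real \<Rightarrow> real"
    using AE_std_gaussian_nonzero
  proof eventually_elim
    case (elim x)
    have "isCont h (F x - m)" using that by (simp add: continuous_on_eq_continuous_at)
    moreover have "(\<lambda>k. G k x - m) \<longlonglongrightarrow> F x - m" by (intro tendsto_intros Glim elim)
    ultimately show ?case by (rule isCont_tendsto_compose)
  qed
  show ?thesis
  proof (rule LIMSEQ_le)
    show "(\<lambda>k. \<integral>x. (F x - m) * H (G k x - m) \<partial>std_gaussian) \<longlonglongrightarrow> (\<integral>x. (F x - m) * H (F x - m) \<partial>std_gaussian)"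
    proof (rule integral_dominated_convergence[where w = "\<lambda>_. (Bf + \<bar>m\<bar>) * C"])
      show "AE x in std_gaussian. (\<lambda>k. (F x - m) * H (G k x - m)) \<longlonglongrightarrow> (F x - m) * H (F x - m)"
        using lim[OF contH] by eventually_elim (intro tendsto_intros)
      show "AE x in std_gaussian. norm ((F x - m) * H (G k x - m)) \<le> (Bf + \<bar>m\<bar>) * C" for k
        using HG(1)[of k]
      proof eventually_elim
        case (elim x)
        have "\<bar>F x - m\<bar> \<le> Bf + \<bar>m\<bar>" using Bf[of x] by linarith
        then show ?case using elim Bf0 by (auto simp: abs_mult intro!: mult_mono)
      qed
    qed auto
    have "(\<lambda>k. \<integral>x. H' (G k x - m) \<partial>std_gaussian) \<longlonglongrightarrow> (\<integral>x. H' (F x - m) \<partial>std_gaussian)"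
      by (rule integral_dominated_convergence[where w = "\<lambda>_. C'"]) (use HG lim[OF H'(1)] in auto)
    then show "(\<lambda>k. (\<integral>x. H' (G k x - m) \<partial>std_gaussian) / (real DIM('a) - 2)) \<longlonglongrightarrow> (\<integral>x. H' (F x - m) \<partial>std_gaussian) / (real DIM('a) - 2)"
      by (intro tendsto_divide tendsto_const) (use n in auto)
  qed (use ineq in auto)
qed

text \<open>
  Replace \<open>h\<close> by its means over \<open>[x, x + e]\<close>: these are continuously differentiable, with derivative the
  forward difference quotient of \<open>h\<close>. Averaging to the right is what puts the right derivative into the
  limit, so corners of \<open>h\<close> are admissible even at values that \<open>F - m\<close> takes with positive
  probability.
\<close>

lemma gaussian_covariance_right_derivative:
  fixes F :: "'a::euclidean_space \<Rightarrow> real" and m :: real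
  assumes n: "DIM('a) \<ge> 3" and F: "angle_lipschitz F" and m: "m = (\<integral>x. F x \<partial>std_gaussian)"
    and h: "continuous_on UNIV h" "mono h" "\<And>x. \<bar>h x\<bar> \<le> B" "\<And>x y. \<bar>h x - h y\<bar> \<le> L * \<bar>x - y\<bar>"
    and d: "\<And>x. ((\<lambda>t. (h (x + t) - h x) / t) \<longlongrightarrow> d x) (at_right 0)"
  shows "(\<integral>x. (F x - m) * h (F x - m) \<partial>std_gaussian) \<le> (\<integral>x. d (F x - m) \<partial>std_gaussian) / (real DIM('a) - 2)"
proof -
  note [measurable] = angle_lipschitz_measurable[OF F]
  obtain Bf where Bf0: "Bf > 0" and Bf: "\<And>x. \<bar>F x\<bar> \<le> Bf" using angle_lipschitz_bounded[OF F] by blast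
  have B0: "B \<ge> 0" using h(3)[of 0] by linarith
  define e where "e k = 1 / real (Suc k)" for k
  have e: "e k > 0" for k by (simp add: e_def)
  have "e \<longlonglongrightarrow> 0" unfolding e_def by (rule LIMSEQ_Suc[OF lim_1_over_n])
  moreover have "e k \<noteq> 0" for k using e[of k] by simp
  ultimately have e0: "filterlim e (at_right 0) sequentially" using e by (simp add: filterlim_at)
  have "\<exists>P. \<forall>x::real. -\<infinity> < ereal x \<longrightarrow> ereal x < \<infinity> \<longrightarrow> (P has_vector_derivative h x) (at x)"
    using h(1) by (intro einterval_antiderivative) (auto simp: continuous_on_eq_continuous_at)
  then obtain P where P: "\<And>x. (P has_real_derivative h x) (at x)"
    by (auto simp: has_real_derivative_iff_has_vector_derivative)
  define H H' where "H k x = (P (x + e k) - P x) / e k" and "H' k x = (h (x + e k) - h x) / e k" for k x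
  have [measurable]: "h \<in> borel_measurable borel" using h(1) by (rule borel_measurable_continuous_onI)
  have HD: "(H k has_real_derivative H' k x) (at x)" for k x
    unfolding H_def[abs_def] H'_def using e[of k] DERIV_shift[of P "h (x + e k)" x "e k"] P
    by (auto intro!: derivative_eq_intros)
  have contH: "continuous_on UNIV (H k)" for k using HD by (auto intro!: continuous_at_imp_continuous_on DERIV_isCont)
  have contH': "continuous_on UNIV (H' k)" for k
    unfolding H'_def[abs_def] using e[of k]
    by (intro continuous_intros continuous_on_compose2[OF h(1)]) auto
  have H'0: "H' k x \<ge> 0" for k x unfolding H'_def using e[of k] h(2) by (auto intro!: divide_nonneg_nonneg simp: mono_def)
  have [measurable]: "H k \<in> borel_measurable borel" "H' k \<in> borel_measurable borel" for k
    using contH contH' by (auto intro: borel_measurable_continuous_onI)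
  have HB: "\<bar>H k x\<bar> \<le> B" for k x
  proof -
    obtain z where "P (x + e k) - P x = (x + e k - x) * h z"
      using MVT2[of x "x + e k" P h] P e[of k] by auto
    then have "H k x = h z" using e[of k] by (simp add: H_def)
    then show ?thesis using h(3) by simp
  qed
  have Hlim: "(\<lambda>k. H k x) \<longlonglongrightarrow> h x" for x
    using filterlim_compose[OF P[of x, unfolded DERIV_def] filterlim_mono[OF e0 at_le[of "{0<..}" UNIV 0] order_refl]]
    by (simp add: H_def)
  have H'lim: "(\<lambda>k. H' k x) \<longlonglongrightarrow> d x" for x
    using filterlim_compose[OF d e0] by (simp add: H'_def)
  have [measurable]: "d \<in> borel_measurable borel"
    by (rule borel_measurable_LIMSEQ_real[OF H'lim]) measurable
  have H'L: "\<bar>H' k x\<bar> \<le> L" for k x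
    using h(4)[of "x + e k" x] e[of k] by (simp add: H'_def abs_divide pos_divide_le_eq)
  show ?thesis
  proof (rule LIMSEQ_le)
    show "(\<lambda>k. \<integral>x. (F x - m) * H k (F x - m) \<partial>std_gaussian) \<longlonglongrightarrow> (\<integral>x. (F x - m) * h (F x - m) \<partial>std_gaussian)"
    proof (rule integral_dominated_convergence[where w = "\<lambda>_. (Bf + \<bar>m\<bar>) * B"])
      show "AE x in std_gaussian. norm ((F x - m) * H k (F x - m)) \<le> (Bf + \<bar>m\<bar>) * B" for k
      proof (intro AE_I2)
        fix x
        have "\<bar>F x - m\<bar> \<le> Bf + \<bar>m\<bar>" using Bf[of x] by linarith
        then show "norm ((F x - m) * H k (F x - m)) \<le> (Bf + \<bar>m\<bar>) * B"
          using HB Bf0 by (auto simp: abs_mult intro!: mult_mono)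
      qed
    qed (auto intro!: tendsto_intros Hlim)
    have "(\<lambda>k. \<integral>x. H' k (F x - m) \<partial>std_gaussian) \<longlonglongrightarrow> (\<integral>x. d (F x - m) \<partial>std_gaussian)"
      by (rule integral_dominated_convergence[where w = "\<lambda>_. L"]) (use H'lim H'L in auto)
    then show "(\<lambda>k. (\<integral>x. H' k (F x - m) \<partial>std_gaussian) / (real DIM('a) - 2)) \<longlonglongrightarrow> (\<integral>x. d (F x - m) \<partial>std_gaussian) / (real DIM('a) - 2)"
      by (intro tendsto_divide tendsto_const) (use n in auto)
  next
    show "\<exists>N. \<forall>k\<ge>N. (\<integral>x. (F x - m) * H k (F x - m) \<partial>std_gaussian) \<le> (\<integral>x. H' k (F x - m) \<partial>std_gaussian) / (real DIM('a) - 2)"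
      using gaussian_covariance_angle_lipschitz[OF n F m HD contH' H'0] by blast
  qed
qed

text \<open>
  The test function \<open>h\<close> solves \<open>k x h(x) - h'(x) = k (x 1{x \<ge> r} - c max 0 x)\<close>. It is continuous at \<open>r\<close>
  and constant from there on precisely because of the choice of \<open>c\<close>, and its right derivative at the
  corner \<open>r\<close> is \<open>0\<close>, so the level \<open>r\<close> itself is counted in the truncated mean.
\<close>

lemma gaussian_upper_truncated_mean:
  fixes F :: "'a::euclidean_space \<Rightarrow> real" and m r :: real
  assumes n: "DIM('a) \<ge> 3" and F: "angle_lipschitz F" and m: "m = (\<integral>x. F x \<partial>std_gaussian)" and r: "r > 0"
  shows "(\<integral>x. (F x - m) * indicator {r..} (F x - m) \<partial>std_gaussian)
    \<le> exp (- (real DIM('a) - 2) * r\<^sup>2 / 2) * (\<integral>x. max 0 (F x - m) \<partial>std_gaussian)"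
proof -
  define k where "k = real DIM('a) - 2"
  have k: "k > 0" using n by (simp add: k_def)
  define c where "c = exp (- k * r\<^sup>2 / 2)"
  have c0: "c > 0" by (simp add: c_def)
  define q where "q y = c * (exp (k * y\<^sup>2 / 2) - 1)" for y :: real
  define clamp where "clamp x = min (max x 0) r" for x :: real
  define h where "h x = q (clamp x)" for x
  define d where "d x = (if 0 \<le> x \<and> x < r then c * (k * x) * exp (k * x\<^sup>2 / 2) else 0)" for x
  have qr: "q r = 1 - c"
    by (simp add: q_def c_def right_diff_distrib exp_minus field_simps)
  have clamp: "clamp x \<in> {0..r}" for x using r by (auto simp: clamp_def)
  have clampL: "\<bar>clamp x - clamp y\<bar> \<le> \<bar>x - y\<bar>" for x y by (auto simp: clamp_def min_def max_def abs_if)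
  have qD: "(q has_real_derivative c * (k * y) * exp (k * y\<^sup>2 / 2)) (at y)" for y
    unfolding q_def by (auto intro!: derivative_eq_intros)
  have qmono: "q x \<le> q y" if "0 \<le> x" "x \<le> y" for x y
    using that k c0 by (auto simp: q_def intro!: mult_left_mono power_mono)
  have hB: "\<bar>h x\<bar> \<le> 1" for x
  proof -
    have "q 0 \<le> h x" "h x \<le> q r" unfolding h_def using clamp[of x] by (auto intro!: qmono)
    moreover have "q 0 = 0" by (simp add: q_def)
    ultimately show ?thesis using c0 qr by (simp add: abs_le_iff)
  qed
  have ineq: "(\<integral>x. (F x - m) * h (F x - m) \<partial>std_gaussian) \<le> (\<integral>x. d (F x - m) \<partial>std_gaussian) / (real DIM('a) - 2)"
  proof (rule gaussian_covariance_right_derivative[OF n F m])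
    have "continuous_on UNIV clamp" unfolding clamp_def[abs_def] by (intro continuous_intros)
    moreover have "continuous_on UNIV q" unfolding q_def[abs_def] by (intro continuous_intros) auto
    ultimately show "continuous_on UNIV h"
      unfolding h_def[abs_def] using continuous_on_compose2[of UNIV q UNIV clamp] by auto
    show "mono h" unfolding h_def using clamp by (intro monoI qmono) (auto simp: clamp_def)
    show "\<bar>h x\<bar> \<le> 1" for x by (rule hB)
    show "\<bar>h x - h y\<bar> \<le> (c * (k * r) * exp (k * r\<^sup>2 / 2)) * \<bar>x - y\<bar>" for x y
    proof -
      have "norm (h x - h y) \<le> (c * (k * r) * exp (k * r\<^sup>2 / 2)) * norm (clamp x - clamp y)"
        unfolding h_def
      proof (rule field_differentiable_bound[of "{0..r}" q])
        fix z assume z: "z \<in> {0..r}"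
        show "(q has_field_derivative c * (k * z) * exp (k * z\<^sup>2 / 2)) (at z within {0..r})"
          by (rule has_field_derivative_at_within[OF qD])
        have "c * (k * z) * exp (k * z\<^sup>2 / 2) \<le> c * (k * r) * exp (k * r\<^sup>2 / 2)"
          using z k c0 by (intro mult_mono) (auto intro!: power_mono)
        then show "norm (c * (k * z) * exp (k * z\<^sup>2 / 2)) \<le> c * (k * r) * exp (k * r\<^sup>2 / 2)"
          using z k c0 by (simp add: abs_mult)
      qed (use clamp in auto)
      also have "\<dots> \<le> (c * (k * r) * exp (k * r\<^sup>2 / 2)) * \<bar>x - y\<bar>"
        using clampL k c0 r by (intro mult_left_mono) auto
      finally show ?thesis by simp
    qed
    show "((\<lambda>t. (h (x + t) - h x) / t) \<longlongrightarrow> d x) (at_right 0)" for x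
    proof -
      consider "x < 0" | "0 \<le> x" "x < r" | "x \<ge> r" by linarith
      then show ?thesis
      proof cases
        case 1
        have "\<forall>\<^sub>F t in at_right 0. t < - x" using 1 by (intro eventually_at_rightI[of 0 "-x"]) auto
        then have "\<forall>\<^sub>F t in at_right 0. (h (x + t) - h x) / t = d x"
          by eventually_elim (use 1 r in \<open>auto simp: h_def clamp_def d_def\<close>)
        then show ?thesis by (rule tendsto_eventually)
      next
        case 2
        have "\<forall>\<^sub>F t in at_right 0. t \<in> {0<..<r - x}" using 2 by (intro eventually_at_rightI[of 0 "r-x"]) auto
        then have "\<forall>\<^sub>F t in at_right 0. (q (x + t) - q x) / t = (h (x + t) - h x) / t"
          by eventually_elim (use 2 in \<open>auto simp: h_def clamp_def\<close>)
        moreover have "((\<lambda>t. (q (x + t) - q x) / t) \<longlongrightarrow> d x) (at_right 0)"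
          using qD[of x, unfolded DERIV_def] 2 by (auto simp: d_def intro: tendsto_mono[OF at_le])
        ultimately show ?thesis by (rule Lim_transform_eventually[rotated])
      next
        case 3
        have "\<forall>\<^sub>F t in at_right 0. t \<in> {0<..<1::real}" by (intro eventually_at_rightI[of 0 1]) auto
        then have "\<forall>\<^sub>F t in at_right 0. (h (x + t) - h x) / t = d x"
          by eventually_elim (use 3 r in \<open>auto simp: h_def clamp_def d_def\<close>)
        then show ?thesis by (rule tendsto_eventually)
      qed
    qed
  qed
  have id: "x * indicator {r..} x - c * max 0 x = x * h x - d x / k" for x
  proof -
    consider "x < 0" | "0 \<le> x" "x < r" | "x \<ge> r" by linarith
    then show ?thesis
    proof cases
      case 1 then show ?thesis using r by (simp add: h_def clamp_def q_def d_def)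
    next
      case 2
      then show ?thesis using k by (simp add: h_def clamp_def q_def d_def algebra_simps)
    next
      case 3
      then have "h x = 1 - c" "d x = 0" using r qr by (auto simp: h_def clamp_def d_def)
      then have "x * h x - d x / k = x * (1 - c)" by simp
      also have "\<dots> = x * indicator {r..} x - c * max 0 x"
        using 3 r by (simp add: right_diff_distrib mult.commute)
      finally show ?thesis by simp
    qed
  qed
  note [measurable] = angle_lipschitz_measurable[OF F]
  obtain Bf where Bf0: "Bf > 0" and Bf: "\<And>x. \<bar>F x\<bar> \<le> Bf" using angle_lipschitz_bounded[OF F] by blast
  have Fm: "\<bar>F x - m\<bar> \<le> Bf + \<bar>m\<bar>" for x using Bf[of x] by linarith
  have [measurable]: "h \<in> borel_measurable borel" "d \<in> borel_measurable borel"
    unfolding h_def[abs_def] d_def[abs_def] q_def clamp_def by measurable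
  have i1: "integrable std_gaussian (\<lambda>x. (F x - m) * indicator {r..} (F x - m))"
    by (rule std_gaussian.integrable_const_bound[where B = "Bf + \<bar>m\<bar>"])
       (use Fm in \<open>auto simp: indicator_def intro: order_trans[OF abs_ge_zero Fm]\<close>)
  have i2: "integrable std_gaussian (\<lambda>x. max 0 (F x - m))"
  proof (rule std_gaussian.integrable_const_bound[where B = "Bf + \<bar>m\<bar>"])
    have "norm (max 0 (F x - m)) \<le> Bf + \<bar>m\<bar>" for x using Fm[of x] Bf0 by (auto simp: max_def)
    then show "AE x in std_gaussian. norm (max 0 (F x - m)) \<le> Bf + \<bar>m\<bar>" by simp
  qed measurable
  have i3: "integrable std_gaussian (\<lambda>x. (F x - m) * h (F x - m))"
  proof (rule std_gaussian.integrable_const_bound[where B = "(Bf + \<bar>m\<bar>) * 1"])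
    show "AE x in std_gaussian. norm ((F x - m) * h (F x - m)) \<le> (Bf + \<bar>m\<bar>) * 1"
      unfolding real_norm_def abs_mult using Bf0 by (intro AE_I2 mult_mono Fm hB) auto
  qed measurable
  have i4: "integrable std_gaussian (\<lambda>x. d (F x - m))"
  proof (rule std_gaussian.integrable_const_bound[where B = "c * (k * r) * exp (k * r\<^sup>2 / 2)"])
    have "norm (d z) \<le> c * (k * r) * exp (k * r\<^sup>2 / 2)" for z
    proof (cases "0 \<le> z \<and> z < r")
      case True
      then have "c * (k * z) * exp (k * z\<^sup>2 / 2) \<le> c * (k * r) * exp (k * r\<^sup>2 / 2)"
        using k c0 by (intro mult_mono) (auto intro!: power_mono)
      then show ?thesis using True k c0 by (simp add: d_def abs_mult)
    qed (use k c0 r in \<open>auto simp: d_def\<close>)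
    then show "AE x in std_gaussian. norm (d (F x - m)) \<le> c * (k * r) * exp (k * r\<^sup>2 / 2)" by simp
  qed measurable
  have "(\<integral>x. (F x - m) * indicator {r..} (F x - m) \<partial>std_gaussian) - c * (\<integral>x. max 0 (F x - m) \<partial>std_gaussian)
     = (\<integral>x. (F x - m) * indicator {r..} (F x - m) - c * max 0 (F x - m) \<partial>std_gaussian)"
    using i1 i2 by simp
  also have "\<dots> = (\<integral>x. (F x - m) * h (F x - m) - d (F x - m) / k \<partial>std_gaussian)"
    by (simp only: id)
  also have "\<dots> = (\<integral>x. (F x - m) * h (F x - m) \<partial>std_gaussian) - (\<integral>x. d (F x - m) \<partial>std_gaussian) / k"
    using i3 i4 by simp
  also have "\<dots> \<le> 0" using ineq by (simp add: k_def)
  finally show ?thesis by (simp add: c_def k_def)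
qed

lemma angle_lipschitz_minus: "angle_lipschitz F \<Longrightarrow> angle_lipschitz (\<lambda>x. - F x)"
  by (auto simp: angle_lipschitz_def abs_minus_commute)

text \<open>
  In dimension \<open>2\<close> the exponential factor is \<open>1\<close> and truncation only decreases the mean.
\<close>

theorem gaussian_two_sided_deviation:
  fixes F :: "'a::euclidean_space \<Rightarrow> real" and m r :: real
  assumes n: "DIM('a) \<ge> 2" and F: "angle_lipschitz F" and m: "m = (\<integral>x. F x \<partial>std_gaussian)" and r: "r > 0"
  shows "measure std_gaussian {x. \<bar>F x - m\<bar> \<ge> r}
    \<le> 1 / r * exp (- (real DIM('a) - 2) * r\<^sup>2 / 2) * (\<integral>x. \<bar>F x - m\<bar> \<partial>std_gaussian)"
proof -
  note [measurable] = angle_lipschitz_measurable[OF F]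
  obtain Bf where Bf0: "Bf > 0" and Bf: "\<And>x. \<bar>F x\<bar> \<le> Bf" using angle_lipschitz_bounded[OF F] by blast
  have Fm: "\<bar>F x - m\<bar> \<le> Bf + \<bar>m\<bar>" for x using Bf[of x] by linarith
  have int: "integrable std_gaussian (\<lambda>x. h (F x - m))"
    if [measurable]: "h \<in> borel_measurable borel" and "\<And>x. \<bar>h x\<bar> \<le> \<bar>x\<bar>" for h :: "real \<Rightarrow> real"
    by (rule std_gaussian.integrable_const_bound[where B = "Bf + \<bar>m\<bar>"])
       (use that Fm order_trans in \<open>auto intro!: AE_I2 intro: order_trans[OF that(2) Fm]\<close>)
  define c where "c = exp (- (real DIM('a) - 2) * r\<^sup>2 / 2)"
  have trunc: "(\<integral>x. \<bar>F x - m\<bar> * indicator {r..} \<bar>F x - m\<bar> \<partial>std_gaussian) \<le> c * (\<integral>x. \<bar>F x - m\<bar> \<partial>std_gaussian)"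
  proof (cases "DIM('a) = 2")
    case True
    have "(\<integral>x. \<bar>F x - m\<bar> * indicator {r..} \<bar>F x - m\<bar> \<partial>std_gaussian) \<le> (\<integral>x. \<bar>F x - m\<bar> \<partial>std_gaussian)"
    proof (rule integral_mono)
      show "integrable std_gaussian (\<lambda>x. \<bar>F x - m\<bar> * indicator {r..} \<bar>F x - m\<bar>)"
        by (rule int[of "\<lambda>z. \<bar>z\<bar> * indicator {r..} \<bar>z\<bar>"]) (auto simp: indicator_def)
      show "integrable std_gaussian (\<lambda>x. \<bar>F x - m\<bar>)"
        by (rule int[of abs]) auto
    qed (auto simp: indicator_def)
    then show ?thesis by (simp add: c_def True)
  next
    case False
    then have n3: "DIM('a) \<ge> 3" using n by simp
    have m': "- m = (\<integral>x. - F x \<partial>std_gaussian)" by (simp add: m)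
    have 1: "(\<integral>x. (F x - m) * indicator {r..} (F x - m) \<partial>std_gaussian) \<le> c * (\<integral>x. max 0 (F x - m) \<partial>std_gaussian)"
      unfolding c_def by (rule gaussian_upper_truncated_mean[OF n3 F m r])
    have 2: "(\<integral>x. - (F x - m) * indicator {r..} (- (F x - m)) \<partial>std_gaussian) \<le> c * (\<integral>x. max 0 (- (F x - m)) \<partial>std_gaussian)"
      using gaussian_upper_truncated_mean[OF n3 angle_lipschitz_minus[OF F] m' r] by (simp add: c_def)
    have "(\<integral>x. \<bar>F x - m\<bar> * indicator {r..} \<bar>F x - m\<bar> \<partial>std_gaussian)
      = (\<integral>x. (F x - m) * indicator {r..} (F x - m) + (- (F x - m) * indicator {r..} (- (F x - m))) \<partial>std_gaussian)"
      using r by (intro Bochner_Integration.integral_cong) (auto simp: indicator_def)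
    also have "\<dots> = (\<integral>x. (F x - m) * indicator {r..} (F x - m) \<partial>std_gaussian) + (\<integral>x. - (F x - m) * indicator {r..} (- (F x - m)) \<partial>std_gaussian)"
      by (intro Bochner_Integration.integral_add int[of "\<lambda>z. z * indicator {r..} z"] int[of "\<lambda>z. - z * indicator {r..} (- z)"])
         (auto simp: indicator_def)
    also have "\<dots> \<le> c * ((\<integral>x. max 0 (F x - m) \<partial>std_gaussian) + (\<integral>x. max 0 (- (F x - m)) \<partial>std_gaussian))"
      using 1 2 by (simp add: distrib_left)
    also have "(\<integral>x. max 0 (F x - m) \<partial>std_gaussian) + (\<integral>x. max 0 (- (F x - m)) \<partial>std_gaussian)
      = (\<integral>x. max 0 (F x - m) + max 0 (- (F x - m)) \<partial>std_gaussian)"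
      by (intro Bochner_Integration.integral_add[symmetric] int[of "\<lambda>z. max 0 z"] int[of "\<lambda>z. max 0 (- z)"]) (auto simp: max_def)
    also have "\<dots> = (\<integral>x. \<bar>F x - m\<bar> \<partial>std_gaussian)"
      by (intro Bochner_Integration.integral_cong) (auto simp: max_def)
    finally show ?thesis .
  qed
  have "r * measure std_gaussian {x. \<bar>F x - m\<bar> \<ge> r} = (\<integral>x. r * indicator {x. \<bar>F x - m\<bar> \<ge> r} x \<partial>std_gaussian)"
    by simp
  also have "\<dots> \<le> (\<integral>x. \<bar>F x - m\<bar> * indicator {r..} \<bar>F x - m\<bar> \<partial>std_gaussian)"
  proof (rule integral_mono)
    have "{x. \<bar>F x - m\<bar> \<ge> r} \<in> sets borel" by measurable
    then show "integrable std_gaussian (\<lambda>x. r * indicator {x. \<bar>F x - m\<bar> \<ge> r} x)"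
      by (intro integrable_mult_right) (simp add: integrable_indicator_iff less_top[symmetric])
    show "integrable std_gaussian (\<lambda>x. \<bar>F x - m\<bar> * indicator {r..} \<bar>F x - m\<bar>)"
      by (rule int[of "\<lambda>z. \<bar>z\<bar> * indicator {r..} \<bar>z\<bar>"]) (auto simp: indicator_def)
  qed (auto simp: indicator_def)
  also note trunc
  finally have "measure std_gaussian {x. \<bar>F x - m\<bar> \<ge> r} \<le> c * (\<integral>x. \<bar>F x - m\<bar> \<partial>std_gaussian) / r"
    using r by (simp add: pos_le_divide_eq mult.commute)
  then show ?thesis by (simp add: c_def)
qed

section \<open>Transfer to the sphere\<close>

text \<open>
  Unlike \<^const>\<open>sgn\<close> this takes values on the sphere at every point; the value chosen at the
  origin is irrelevant for integrals.
\<close>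

definition to_sphere :: "'a::euclidean_space \<Rightarrow> 'a" where
  "to_sphere x = (if x = 0 then SOME e. e \<in> Basis else sgn x)"

lemma norm_to_sphere: "norm (to_sphere x) = 1"
  using someI_ex[of "\<lambda>e. e \<in> (Basis :: 'a::euclidean_space set)"] nonempty_Basis
  by (auto simp: to_sphere_def norm_sgn)

lemma measurable_to_sphere: "to_sphere \<in> borel \<rightarrow>\<^sub>M restrict_space borel (sphere (0::'a::euclidean_space) 1)"
proof (rule measurable_restrict_space2)
  show "(to_sphere :: 'a \<Rightarrow> 'a) \<in> borel_measurable borel" unfolding to_sphere_def[abs_def] by measurable
qed (simp add: norm_to_sphere)

text \<open>
  The cone measure of a set of directions and its Gaussian probability agree, because
  the law of the direction is the same for every radial distribution.
\<close>

lemma sphere_measure_eq_distr_std_gaussian: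
  "(sphere_measure :: (real ^ 'n) measure) = distr std_gaussian (restrict_space borel (sphere 0 1)) to_sphere"
proof (rule measure_eqI)
  fix A :: "(real ^ 'n) set" assume "A \<in> sets sphere_measure"
  then have A[measurable]: "A \<in> sets borel" and A': "A \<subseteq> sphere 0 1" and A'': "A \<in> sets (restrict_space borel (sphere 0 1))"
    by (auto simp: sets_restrict_space)
  have "emeasure (distr std_gaussian (restrict_space borel (sphere 0 1)) to_sphere) A = emeasure std_gaussian (to_sphere -` A)"
    using measurable_to_sphere[where 'a="real^'n"] A'' by (subst emeasure_distr) auto
  also have "\<dots> = (\<integral>\<^sup>+x. indicator A (sgn x) \<partial>std_gaussian)"
  proof -
    have [measurable]: "to_sphere -` A \<in> sets (borel :: (real^'n) measure)"
      using measurable_sets[OF measurable_to_sphere A''] by simp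
    have "emeasure std_gaussian (to_sphere -` A) = (\<integral>\<^sup>+x. indicator (to_sphere -` A) x \<partial>std_gaussian)"
      by simp
    also have "\<dots> = (\<integral>\<^sup>+x. indicator A (sgn x) \<partial>std_gaussian)"
    proof (rule nn_integral_cong_AE)
      show "AE x in std_gaussian. indicator (to_sphere -` A) x = (indicator A (sgn x) :: ennreal)"
        using AE_std_gaussian_nonzero by eventually_elim (auto simp: to_sphere_def indicator_def)
    qed
    finally show ?thesis .
  qed
  also have "\<dots> = (\<integral>\<^sup>+x\<in>ball 0 1. indicator A (sgn x) \<partial>lborel) / emeasure lborel (ball (0 :: real ^ 'n) 1)"
  proof -
    have "(\<integral>\<^sup>+x. indicator A (sgn x) \<partial>std_gaussian) * emeasure lborel (ball (0 :: real^'n) 1) = (\<integral>\<^sup>+x\<in>ball 0 1. indicator A (sgn x) \<partial>lborel)"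
      by (rule nn_integral_std_gaussian_polar(2)[of _ "\<lambda>_. 1" 1])
         (auto simp: sgn_scaleR indicator_def)
    then show ?thesis using emeasure_unit_ball_pos_finite[where 'n='n]
      by (metis ennreal_mult_divide_eq infinity_ennreal_def)
  qed
  also have "(\<integral>\<^sup>+x\<in>ball 0 1. indicator A (sgn x) \<partial>lborel) = emeasure lborel {x \<in> ball (0 :: real ^ 'n) 1. x /\<^sub>R norm x \<in> A}"
  proof -
    have [measurable]: "{x \<in> ball (0 :: real ^ 'n) 1. x /\<^sub>R norm x \<in> A} \<in> sets borel" by measurable
    have "(\<integral>\<^sup>+x\<in>ball 0 1. indicator A (sgn x) \<partial>lborel) = (\<integral>\<^sup>+x. indicator {x \<in> ball (0 :: real ^ 'n) 1. x /\<^sub>R norm x \<in> A} x \<partial>lborel)"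
      by (intro nn_integral_cong) (auto simp: indicator_def sgn_div_norm)
    then show ?thesis by simp
  qed
  finally show "emeasure sphere_measure A = emeasure (distr std_gaussian (restrict_space borel (sphere 0 1)) to_sphere) A"
    by (simp add: emeasure_sphere_measure[OF A A'])
qed simp

lemma sphere_Lip_le_1D:
  fixes f :: "real ^ 'n \<Rightarrow> real"
  assumes f: "sphere_Lip f \<le> 1" and x: "norm x = 1" and y: "norm y = 1"
  shows "\<bar>f x - f y\<bar> \<le> arccos (x \<bullet> y)"
proof (cases "x = y")
  case True
  then show ?thesis using y by (simp add: norm_eq_1[THEN iffD1])
next
  case False
  have "\<bar>x \<bullet> y\<bar> \<le> 1" using Cauchy_Schwarz_ineq2[of x y] x y by simp
  moreover have "x \<bullet> y \<noteq> 1"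
  proof
    assume "x \<bullet> y = 1"
    then have "(x - y) \<bullet> (x - y) = 0" using x y by (simp add: inner_diff_left inner_diff_right inner_commute norm_eq_1)
    then show False using False by simp
  qed
  ultimately have pos: "arccos (x \<bullet> y) > 0" using arccos_less_arccos[of "x \<bullet> y" 1] by auto
  have "ennreal (\<bar>f x - f y\<bar> / geodesic_dist x y) \<le> sphere_Lip f"
    unfolding sphere_Lip_def using x y False by (intro SUP_upper2[of "(x, y)"]) auto
  then have "ennreal (\<bar>f x - f y\<bar> / geodesic_dist x y) \<le> 1" using f by (rule order_trans)
  then have "\<bar>f x - f y\<bar> / arccos (x \<bullet> y) \<le> 1" by (simp add: geodesic_dist_def)
  then show ?thesis using pos by (simp add: pos_divide_le_eq)
qed

lemma angle_lipschitz_to_sphere: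
  fixes f :: "real ^ 'n \<Rightarrow> real"
  assumes "sphere_Lip f \<le> 1"
  shows "angle_lipschitz (\<lambda>x. f (to_sphere x))"
  unfolding angle_lipschitz_def
proof (intro allI impI)
  fix x y :: "real ^ 'n" assume xy: "x \<noteq> 0" "y \<noteq> 0"
  show "\<bar>f (to_sphere x) - f (to_sphere y)\<bar> \<le> vec_angle x y"
    using sphere_Lip_le_1D[OF assms norm_to_sphere[of x] norm_to_sphere[of y]] xy
    by (simp add: to_sphere_def vec_angle_def)
qed

lemma sphere_Lip_measurable:
  fixes f :: "real ^ 'n \<Rightarrow> real"
  assumes "sphere_Lip f \<le> 1"
  shows "f \<in> borel_measurable (restrict_space borel (sphere 0 1))"
proof -
  have eq: "to_sphere x = x" if "x \<in> sphere 0 1" for x :: "real ^ 'n"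
    using that by (auto simp: to_sphere_def sgn_div_norm)
  have "(\<lambda>x. f (to_sphere x)) \<in> borel_measurable (restrict_space borel (sphere 0 1))"
    by (intro measurable_restrict_space1 angle_lipschitz_measurable angle_lipschitz_to_sphere assms)
  then show ?thesis
    by (subst measurable_cong[of _ _ "\<lambda>x. f (to_sphere x)"]) (auto simp: space_restrict_space eq)
qed

text \<open>
  The function \<open>f \<circ> to_sphere\<close> is angle-Lipschitz, and its law under the Gaussian measure is the law of
  \<open>f\<close> on the sphere.
\<close>

theorem theorem1p3:
  fixes f :: "real ^ 'n \<Rightarrow> real" and m r :: real
  assumes "CARD('n) \<ge> 2"
    and "sphere_Lip f \<le> 1"
    and "m = (\<integral>x. f x \<partial>sphere_measure)"
    and "r > 0"
  shows "measure sphere_measure {x \<in> sphere 0 1. \<bar>f x - m\<bar> \<ge> r}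
           \<le> 1 / r * exp (- (real CARD('n) - 2) * r\<^sup>2 / 2) * (\<integral>x. \<bar>f x - m\<bar> \<partial>sphere_measure)"
proof -
  note [measurable] = sphere_Lip_measurable[OF assms(2)] measurable_to_sphere[where 'a="real^'n"]
  define F where "F x = f (to_sphere x)" for x
  have F: "angle_lipschitz F" unfolding F_def[abs_def] by (rule angle_lipschitz_to_sphere[OF assms(2)])
  have int: "(\<integral>x. h (f x) \<partial>sphere_measure) = (\<integral>x. h (F x) \<partial>std_gaussian)"
    if [measurable]: "h \<in> borel_measurable borel" for h :: "real \<Rightarrow> real"
    unfolding sphere_measure_eq_distr_std_gaussian F_def by (rule integral_distr) measurable
  have "{x \<in> sphere 0 1. \<bar>f x - m\<bar> \<ge> r} \<in> sets (restrict_space borel (sphere 0 1))"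
  proof -
    have "{x \<in> space (restrict_space borel (sphere 0 1)). \<bar>f x - m\<bar> \<ge> r} \<in> sets (restrict_space borel (sphere 0 1))"
      by measurable
    then show ?thesis by (simp add: space_restrict_space)
  qed
  then have "measure sphere_measure {x \<in> sphere 0 1. \<bar>f x - m\<bar> \<ge> r} = measure std_gaussian {x. \<bar>F x - m\<bar> \<ge> r}"
    unfolding sphere_measure_eq_distr_std_gaussian F_def
    by (subst measure_distr) (auto simp: norm_to_sphere vimage_def)
  then show ?thesis
    using gaussian_two_sided_deviation[of F m r] F assms(1,3,4) int[of "\<lambda>x. x"] int[of "\<lambda>x. \<bar>x - m\<bar>"]
    by simp
qed

end
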